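(* Let $\mathbb{K}_1$ denote the flat Klein bottle associated with the square torus, i.e. $\mathbb{K}_1=\mathbb{K}_{2\pi,2\pi}$, and let $\mathbb{K}_2$ denote the flat Klein bottle whose fundamental domain is a square, i.e. $\mathbb{K}_2=\mathbb{K}_{2\pi,\pi}$. Then, for $c\in\{1,2\}$, the only Courant-sharp eigenvalues of $\mathbb{K}_c$ are $\lambda_1(\mathbb{K}_c)$ and $\lambda_2(\mathbb{K}_c)$; that is, for $k\ge 1$, $\lambda_k(\mathbb{K}_c)$ is Courant-sharp if and only if $k\in\{1,2\}$.
   Context: For $a,b>0$, consider the isometries of $\mathbb{R}^2$ given by $\tau_1(x,y)=(x,y+b)$ and $\tau(x,y)=(x+\frac a2,\,b-y)$, and let $G$ be the group they generate; it acts freely and properly by isometries on Euclidean $\mathbb{R}^2$. The flat Klein bottle $\mathbb{K}_{a,b}$ is the quotient $\mathbb{R}^2/G$ with the induced flat Riemannian metric. A fundamental domain is the rectangle $(0,\frac a2)\times(0,b)$. (So $\mathbb{K}_1$ has fundamental domain $(0,\pi)\times(0,2\pi)$ and is covered twice by the square torus $\mathbb{R}^2/(2\pi\mathbb{Z})^2$, and $\mathbb{K}_2$ has fundamental domain $(0,\pi)\times(0,\pi)$.) For a closed connected Riemannian surface $M$, the eigenvalues of the (nonnegative) Laplace-Beltrami operator $-\Delta$ are listed as $\lambda_1(M)<\lambda_2(M)\le\lambda_3(M)\le\cdots$, in nondecreasing order, starting from the label $1$, with multiplicities accounted for. The nodal domains of a real eigenfunction are the connected components of the complement in $M$ of its zero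 set. The eigenvalue $\lambda_k(M)$ is called Courant-sharp if there exists a real eigenfunction associated with $\lambda_k(M)$ with precisely $k$ nodal domains. *)

theory Defs
  imports "HOL-Analysis.Analysis" "HOL-Algebra.Bij" "HOL-Algebra.Generated_Groups"
    "HOL-Library.Function_Algebras"
begin

type_synonym plane = "real \<times> real"

text \<open>
  \<^typ>\<open>real \<times> real\<close> carries the Euclidean metric and inner product, so it is the Euclidean plane.
\<close>

definition tau1 :: "real \<Rightarrow> plane \<Rightarrow> plane" where
  "tau1 b = (\<lambda>(x, y). (x, y + b))"

definition tau :: "real \<Rightarrow> real \<Rightarrow> plane \<Rightarrow> plane" where
  "tau a b = (\<lambda>(x, y). (x + a / 2, b - y))"

definition klein_group :: "real \<Rightarrow> real \<Rightarrow> (plane \<Rightarrow> plane) set" where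
  "klein_group a b = generate (BijGroup UNIV) {tau1 b, tau a b}"

lemma klein_generators_in_BijGroup:
  "tau1 b \<in> carrier (BijGroup UNIV)" "tau a b \<in> carrier (BijGroup UNIV)"
proof -
  have "bij (tau1 b)"
    by (rule o_bij[where g = "\<lambda>(x, y). (x, y - b)"]) (auto simp: tau1_def fun_eq_iff)
  moreover have "bij (tau a b)"
    by (rule o_bij[where g = "\<lambda>(x, y). (x - a / 2, b - y)"]) (auto simp: tau_def fun_eq_iff)
  ultimately show "tau1 b \<in> carrier (BijGroup UNIV)" "tau a b \<in> carrier (BijGroup UNIV)"
    by (auto simp: BijGroup_def Bij_def)
qed


section \<open>The quotient of the plane by a group of transformations\<close>

definition orbit_of :: "(plane \<Rightarrow> plane) set \<Rightarrow> plane \<Rightarrow> plane set" where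
  "orbit_of G p = {g p | g. g \<in> G}"

definition quotient_plane :: "(plane \<Rightarrow> plane) set \<Rightarrow> plane set topology" where
  "quotient_plane G = topology (\<lambda>U. U \<subseteq> range (orbit_of G) \<and> open (orbit_of G -` U))"

lemma openin_quotient_plane:
  "openin (quotient_plane G) U \<longleftrightarrow> U \<subseteq> range (orbit_of G) \<and> open (orbit_of G -` U)"
proof -
  have "istopology (\<lambda>U. U \<subseteq> range (orbit_of G) \<and> open (orbit_of G -` U))"
    unfolding istopology_def by (auto simp: vimage_Union)
  then show ?thesis
    by (simp add: quotient_plane_def topology_inverse')
qed

lemma topspace_quotient_plane: "topspace (quotient_plane G) = range (orbit_of G)"
proof (rule antisym)
  show "topspace (quotient_plane G) \<subseteq> range (orbit_of G)"
    unfolding topspace_def openin_quotient_plane by blast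
  show "range (orbit_of G) \<subseteq> topspace (quotient_plane G)"
    by (rule openin_subset) (simp add: openin_quotient_plane vimage_def)
qed

lemma quotient_map_orbit_of: "quotient_map euclidean (quotient_plane G) (orbit_of G)"
  unfolding quotient_map_def
  by (auto simp: topspace_quotient_plane openin_quotient_plane vimage_def)


section \<open>The spectrum of the quotient\<close>

text \<open>
  The projection from the plane to its quotient by a group of isometries acting freely and
  properly is a local isometry. Functions on the quotient are represented by
  their lifts, the invariant functions on the plane; the lift of a function is smooth iff
  the function is, and the Laplace--Beltrami operator acts on lifts as the Euclidean Laplacian.
\<close>

primrec cont_diff :: "nat \<Rightarrow> ('a::euclidean_space \<Rightarrow> real) \<Rightarrow> bool" where
  "cont_diff 0 f \<longleftrightarrow> continuous_on UNIV f"
| "cont_diff (Suc n) f \<longleftrightarrow>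
     (\<forall>p. f differentiable at p) \<and> (\<forall>v. cont_diff n (\<lambda>p. frechet_derivative f (at p) v))"

definition smooth :: "('a::euclidean_space \<Rightarrow> real) \<Rightarrow> bool" where
  "smooth f \<longleftrightarrow> (\<forall>n. cont_diff n f)"

definition laplacian :: "('a::euclidean_space \<Rightarrow> real) \<Rightarrow> 'a \<Rightarrow> real" where
  "laplacian f p =
     (\<Sum>e\<in>Basis. frechet_derivative (\<lambda>q. frechet_derivative f (at q) e) (at p) e)"

definition eigenspace :: "(plane \<Rightarrow> plane) set \<Rightarrow> real \<Rightarrow> (plane \<Rightarrow> real) set" where
  "eigenspace G \<mu> =
     {u. smooth u \<and> (\<forall>g\<in>G. \<forall>p. u (g p) = u p) \<and> (\<forall>p. - laplacian u p = \<mu> * u p)}"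

abbreviation scale_fun :: "real \<Rightarrow> ('a \<Rightarrow> real) \<Rightarrow> 'a \<Rightarrow> real" where
  "scale_fun c u \<equiv> (\<lambda>p. c * u p)"

lemma vector_space_scale_fun: "vector_space scale_fun"
  by unfold_locales (auto simp: fun_eq_iff algebra_simps)

definition multiplicity :: "(plane \<Rightarrow> plane) set \<Rightarrow> real \<Rightarrow> nat" where
  "multiplicity G \<mu> = vector_space.dim scale_fun (eigenspace G \<mu>)"

text \<open>
  A nondecreasing sequence taking each real value as often as its multiplicity as an eigenvalue
  (zero if it is not one). Such a sequence is unique if it exists. It exists when the quotient is
  a closed surface, since then the spectrum is discrete and unbounded, with eigenspaces of finite
  dimension (\<^const>\<open>vector_space.dim\<close> would be zero in infinite dimension).
\<close>

definition eigenvalue_listing :: "(plane \<Rightarrow> plane) set \<Rightarrow> (nat \<Rightarrow> real) \<Rightarrow> bool" where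
  "eigenvalue_listing G l \<longleftrightarrow>
     mono l \<and> (\<forall>\<mu>. finite {j. l j = \<mu>} \<and> card {j. l j = \<mu>} = multiplicity G \<mu>)"

text \<open>The labels of the eigenvalues start at 1; the value at label 0 is irrelevant.\<close>

definition eigenvalue :: "(plane \<Rightarrow> plane) set \<Rightarrow> nat \<Rightarrow> real" where
  "eigenvalue G k = (THE l. eigenvalue_listing G l) (k - 1)"


section \<open>Nodal domains\<close>

definition nodal_domains :: "(plane \<Rightarrow> plane) set \<Rightarrow> (plane \<Rightarrow> real) \<Rightarrow> plane set set set" where
  "nodal_domains G u =
     connected_components_of (subtopology (quotient_plane G) (orbit_of G ` {p. u p \<noteq> 0}))"

definition courant_sharp :: "(plane \<Rightarrow> plane) set \<Rightarrow> nat \<Rightarrow> bool" where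
  "courant_sharp G k \<longleftrightarrow>
     (\<exists>u\<in>eigenspace G (eigenvalue G k). (\<exists>p. u p \<noteq> 0) \<and>
        finite (nodal_domains G u) \<and> card (nodal_domains G u) = k)"

end

theory Submission
  imports Defs
begin

text \<open>
  Let \<open>r = 1\<close> for the first and \<open>r = 2\<close> for the second Klein bottle, with area \<open>2 * pi ^ 2 / r\<close>. If the \<open>k\<close>-th
  eigenvalue \<open>\<lambda>\<close> is Courant-sharp, then some eigenfunction has more nodal domains than there are eigenvalues
  below \<open>\<lambda>\<close>, a lattice point count of order \<open>pi * \<lambda> / (2 * r)\<close>. But an eigenfunction has at most about
  \<open>sqrt 2 * \<lambda> / r\<close> nodal domains. Indeed, its restriction to a horizontal or vertical closed geodesic is a
  trigonometric polynomial of degree at most \<open>sqrt \<lambda>\<close>, so the geodesic meets few nodal domains, and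
  integration over these geodesics bounds the sum of the widths and heights of all nodal domains. On the
  other hand, a nodal domain inside a rectangle with sides \<open>W\<close> and \<open>H\<close> satisfies
  \<open>(pi / W) ^ 2 + (pi / H) ^ 2 \<le> \<lambda>\<close>, hence \<open>W + H \<ge> sqrt 8 * pi / sqrt \<lambda>\<close>. For the few small eigenvalues that this
  leaves, the eigenfunctions are explicit, and each nodal domain contains one of a few critical points.
\<close>

section \<open>Trigonometric polynomials\<close>

text \<open>The scheme closes because sqrt 2 < pi / 2. The margin is small, which is why eigenvalues
  up to several hundred are checked by counting lattice points rather than by area. Width plus
  height, instead of area as in Faber-Krahn, needs only a maximum principle and one-dimensional
  measures, so no regularity of nodal sets enters. The glide reflection reverses the vertical
  direction, so the weights are taken not on the bottle but on the torus with periods 2 pi and 2 pi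
  / r, which covers it twice. A domain of the bottle has either two lifts, each of weight at least
  \<open>sqrt 8 * pi / sqrt lam\<close>, or a single lift invariant under the reflection, which must
  go around horizontally and so has width 2 pi. The second case yields as much as the first only if
  \<open>sqrt 8 * pi / sqrt lam \<le> pi\<close>, that is from 8 on; this separates the small
  eigenvalues from the rest. As the total weight is at most \<open>4 * pi * (M + N) / r\<close> with
  degrees \<open>M\<close> and \<open>N\<close> at most \<open>sqrt lam\<close>, division gives
  \<open>sqrt 2 * lam / r\<close>.\<close>

definition trig :: "int \<Rightarrow> real \<Rightarrow> real" where
  "trig m x = (if 0 \<le> m then cos (of_int m * x) else sin (- of_int m * x))"

text \<open>One integer indexes the whole real Fourier basis, cosines for \<open>m \<ge> 0\<close>
  and sines for \<open>m < 0\<close>. Differentiation then exchanges \<open>m\<close> and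
  \<open>- m\<close> up to the factor \<open>- m\<close>, with no case distinction, and the second
  derivative is multiplication by \<open>- m^2\<close>.\<close>

lemma trig_has_real_derivative:
  "(trig m has_real_derivative - of_int m * trig (- m) x) (at x within S)"
proof -
  have "((\<lambda>x. cos (of_int m * x)) has_real_derivative - of_int m * sin (of_int m * x)) (at x within S)"
    "((\<lambda>x. sin (- of_int m * x)) has_real_derivative - of_int m * cos (- of_int m * x)) (at x within S)"
    by (auto intro!: derivative_eq_intros)
  then show ?thesis
    by (cases "m = 0") (auto simp: trig_def[abs_def])
qed

lemma continuous_on_trig [continuous_intros]:
  fixes f :: "'a::t2_space \<Rightarrow> real"
  assumes "continuous_on S f"
  shows "continuous_on S (\<lambda>x. trig m (f x))"
proof (cases "0 \<le> m")
  case True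
  then show ?thesis
    using assms by (simp add: trig_def) (intro continuous_intros)
next
  case False
  then show ?thesis
    using assms by (simp add: trig_def) (intro continuous_intros)
qed

lemma trig_add_pi: "trig m (x + pi) = (if even m then trig m x else - trig m x)"
proof -
  have "cos (of_int m * pi) = (if even m then 1 else - 1)" "sin (of_int m * pi) = 0"
    by (auto simp: cos_int_times_real sin_int_times_real elim!: evenE oddE simp: cos_add algebra_simps)
  then show ?thesis
    by (auto simp: trig_def cos_add sin_add sin_diff ring_distribs)
qed

lemma trig_add_2pi [simp]: "trig m (x + 2 * pi) = trig m x"
  using trig_add_pi[of m x] trig_add_pi[of m "x + pi"] by (simp add: add.assoc split: if_splits)

lemma trig_minus: "trig m (- x) = (if 0 \<le> m then trig m x else - trig m x)"
  by (simp add: trig_def)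

lemma trig_0 [simp]: "trig 0 x = 1"
  by (simp add: trig_def)

text \<open>Two integrations by parts, carried out at once through the antiderivative
  \<open>F\<close>; periodicity cancels the boundary terms.\<close>

lemma integral_second_derivative_trig:
  fixes f f' f'' :: "real \<Rightarrow> real"
  assumes f: "\<And>x. (f has_real_derivative f' x) (at x)"
    and f': "\<And>x. (f' has_real_derivative f'' x) (at x)"
    and cont: "continuous_on UNIV f''"
    and per: "f (2 * pi) = f 0" "f' (2 * pi) = f' 0"
  shows "integral {0..2 * pi} (\<lambda>x. f'' x * trig m x) =
    - (of_int m)\<^sup>2 * integral {0..2 * pi} (\<lambda>x. f x * trig m x)"
proof -
  define F where "F x = f' x * trig m x + of_int m * f x * trig (- m) x" for x
  have "(F has_real_derivative f'' x * trig m x + (of_int m)\<^sup>2 * (f x * trig m x)) (at x within {0..2*pi})" for x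
    unfolding F_def
    by (rule derivative_eq_intros trig_has_real_derivative
          DERIV_subset[OF f] DERIV_subset[OF f'] refl subset_UNIV)+
      (simp add: algebra_simps power2_eq_square)
  then have 1: "((\<lambda>x. f'' x * trig m x + (of_int m)\<^sup>2 * (f x * trig m x)) has_integral F (2 * pi) - F 0) {0..2*pi}"
    by (intro fundamental_theorem_of_calculus) (auto simp: has_real_derivative_iff_has_vector_derivative)
  have "F (2 * pi) = F 0"
    using trig_add_2pi[of m 0] trig_add_2pi[of "-m" 0] by (simp add: F_def per)
  have cf: "continuous_on UNIV f"
    using f by (meson DERIV_continuous_on has_field_derivative_at_within)
  have int: "(\<lambda>x. f'' x * trig m x) integrable_on {0..2*pi}" "(\<lambda>x. f x * trig m x) integrable_on {0..2*pi}"
    by (auto intro!: integrable_continuous_interval continuous_intros continuous_on_subset[OF cont] continuous_on_subset[OF cf])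
  have "integral {0..2*pi} (\<lambda>x. f'' x * trig m x + (of_int m)\<^sup>2 * (f x * trig m x)) = 0"
    using 1 \<open>F (2 * pi) = F 0\<close> by (simp add: integral_unique)
  then show ?thesis
    using integral_add[OF int(1) integrable_on_cmult_left[OF int(2), of "(of_int m)\<^sup>2"]]
    by simp
qed

text \<open>If \<open>k^2\<close> and \<open>m^2\<close> differ, the factors are eigenfunctions of
  the symmetric second derivative with distinct eigenvalues. The pair \<open>k = - m\<close> shares
  its eigenvalue and is treated apart: there the product is, up to a factor, the derivative of a
  square.\<close>

lemma integral_trig_mult:
  "integral {0..2 * pi} (\<lambda>x. trig k x * trig m x) = 0 \<longleftrightarrow> k \<noteq> m"
proof -
  have "integral {0..2 * pi} (\<lambda>x. trig k x * trig m x) = 0" if "k \<noteq> m"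
  proof (cases "k = - m")
    case True
    define F where "F x = trig m x * trig m x" for x
    have "(F has_real_derivative - 2 * of_int m * (trig k x * trig m x)) (at x within {0..2*pi})" for x
      unfolding F_def
      by (rule derivative_eq_intros trig_has_real_derivative refl)+ (simp add: True)
    then have 1: "((\<lambda>x. - 2 * of_int m * (trig k x * trig m x)) has_integral F (2 * pi) - F 0) {0..2*pi}"
      by (intro fundamental_theorem_of_calculus) (auto simp: has_real_derivative_iff_has_vector_derivative)
    have "F (2 * pi) = F 0"
      using trig_add_2pi[of m 0] by (simp add: F_def)
    with 1 that True show ?thesis
      by (auto dest!: integral_unique)
  next
    case False
    have d1: "(trig k has_real_derivative - of_int k * trig (- k) x) (at x)"
      and d2: "((\<lambda>x. - of_int k * trig (- k) x) has_real_derivative - (of_int k)\<^sup>2 * trig k x) (at x)" for x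
      using trig_has_real_derivative[of k x UNIV] DERIV_cmult[OF trig_has_real_derivative[of "-k" x UNIV], of "- of_int k"]
      by (auto simp: power2_eq_square mult.assoc)
    have per: "trig j (2 * pi) = trig j 0" for j
      using trig_add_2pi[of j 0] by simp
    have "integral {0..2 * pi} (\<lambda>x. (- (of_int k)\<^sup>2 * trig k x) * trig m x) =
       - (of_int m)\<^sup>2 * integral {0..2 * pi} (\<lambda>x. trig k x * trig m x)"
      by (rule integral_second_derivative_trig[OF d1 d2]) (auto simp: per intro!: continuous_intros)
    moreover have "integral {0..2 * pi} (\<lambda>x. (- (of_int k)\<^sup>2 * trig k x) * trig m x) =
       - (of_int k)\<^sup>2 * integral {0..2 * pi} (\<lambda>x. trig k x * trig m x)"
      by (simp add: mult.assoc)
    ultimately have "((of_int m)\<^sup>2 - (of_int k)\<^sup>2) * integral {0..2 * pi} (\<lambda>x. trig k x * trig m x) = (0::real)"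
      unfolding left_diff_distrib by linarith
    moreover have "(of_int m)\<^sup>2 \<noteq> ((of_int k)\<^sup>2 :: real)"
      using that False by (auto simp: power2_eq_iff)
    ultimately show ?thesis
      by simp
  qed
  moreover have "integral {0..2 * pi} (\<lambda>x. trig m x * trig m x) \<noteq> 0"
  proof
    assume "integral {0..2 * pi} (\<lambda>x. trig m x * trig m x) = 0"
    then have z: "\<forall>x\<in>{0..2*pi}. trig m x * trig m x = 0"
      by (subst (asm) integral_eq_0_iff) (auto intro!: continuous_intros)
    show False
    proof (cases "m \<ge> 0")
      case True
      then show False using z[rule_format, of 0] by (simp add: trig_def)
    next
      case False
      have "- of_int m * (pi / (2 * - of_int m)) = pi / 2"
        using False by simp
      moreover have "pi / (2 * - of_int m) \<in> {0..2*pi}"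
      proof -
        have "1 \<le> - real_of_int m"
          using False by linarith
        then have "pi / (2 * - of_int m) \<le> pi / 1" "0 \<le> pi / (2 * - of_int m)"
          by (intro divide_left_mono divide_nonneg_nonneg; simp)+
        then show ?thesis by simp
      qed
      ultimately show False using z[rule_format, of "pi / (2 * - of_int m)"] False by (simp add: trig_def)
    qed
  qed
  ultimately show ?thesis by auto
qed

lemma periodic_add_of_int_mult:
  fixes f :: "real \<Rightarrow> 'a"
  assumes "\<And>x. f (x + L) = f x"
  shows "f (x + of_int j * L) = f x"
proof (induction j rule: int_induct[of _ 0])
  case base
  then show ?case by simp
next
  case (step1 i)
  have "x + of_int (i + 1) * L = (x + of_int i * L) + L"
    by (simp add: algebra_simps)
  then show ?case using step1 assms by metis
next
  case (step2 i)
  have "x + of_int i * L = (x + of_int (i - 1) * L) + L"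
    by (simp add: algebra_simps)
  then show ?case using step2 assms by metis
qed

lemma obtain_period_representative:
  fixes L x :: real
  assumes "L > 0"
  obtains j :: int where "x + of_int j * L \<in> {0..<L}"
proof
  have "of_int \<lfloor>x / L\<rfloor> * L \<le> x" "x < (of_int \<lfloor>x / L\<rfloor> + 1) * L"
    using assms by (simp_all flip: pos_le_divide_eq pos_divide_less_eq)
  then show "x + of_int (- \<lfloor>x / L\<rfloor>) * L \<in> {0..<L}"
    by (auto simp: algebra_simps)
qed

section \<open>Completeness of the trigonometric system\<close>

inductive trig_poly :: "(real \<Rightarrow> real) \<Rightarrow> bool" where
  cos: "trig_poly (\<lambda>x. cos (of_int k * x))"
| sin: "trig_poly (\<lambda>x. sin (of_int k * x))"
| add: "trig_poly f \<Longrightarrow> trig_poly g \<Longrightarrow> trig_poly (\<lambda>x. f x + g x)"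
| scale: "trig_poly f \<Longrightarrow> trig_poly (\<lambda>x. c * f x)"

lemma trig_poly_mult_cos_sin:
  assumes "trig_poly f"
  shows "trig_poly (\<lambda>x. f x * cos (of_int k * x)) \<and> trig_poly (\<lambda>x. f x * sin (of_int k * x))"
  using assms
proof induction
  case (cos j)
  have "(\<lambda>x. cos (of_int j * x) * cos (of_int k * x)) =
      (\<lambda>x::real. 1/2 * (cos (of_int (j - k) * x) + cos (of_int (j + k) * x)))"
    "(\<lambda>x. cos (of_int j * x) * sin (of_int k * x)) =
      (\<lambda>x::real. 1/2 * (sin (of_int (j + k) * x) + (-1) * sin (of_int (j - k) * x)))"
    by (auto simp: fun_eq_iff cos_times_cos cos_times_sin ring_distribs add_divide_distrib diff_divide_distrib)
  then show ?case
    by (simp only:) (intro conjI trig_poly.intros)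
next
  case (sin j)
  have "(\<lambda>x. sin (of_int j * x) * cos (of_int k * x)) =
      (\<lambda>x::real. 1/2 * (sin (of_int (j + k) * x) + sin (of_int (j - k) * x)))"
    "(\<lambda>x. sin (of_int j * x) * sin (of_int k * x)) =
      (\<lambda>x::real. 1/2 * (cos (of_int (j - k) * x) + (-1) * cos (of_int (j + k) * x)))"
    by (auto simp: fun_eq_iff sin_times_cos sin_times_sin ring_distribs add_divide_distrib diff_divide_distrib)
  then show ?case
    by (simp only:) (intro conjI trig_poly.intros)
next
  case (add f g)
  then show ?case by (auto simp: distrib_right intro: trig_poly.add)
next
  case (scale f c)
  then show ?case by (auto simp: mult.assoc intro: trig_poly.scale)
qed

lemma trig_poly_mult:
  assumes "trig_poly g" "trig_poly f"
  shows "trig_poly (\<lambda>x. f x * g x)"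
  using assms
proof induction
  case (scale g c)
  then have "trig_poly (\<lambda>x. c * (f x * g x))"
    by (intro trig_poly.scale) auto
  then show ?case by (simp add: mult_ac)
qed (use trig_poly_mult_cos_sin in \<open>auto simp: distrib_left intro: trig_poly.add\<close>)

text \<open>Linear maps of \<open>cis x\<close> are combinations of \<open>cos x\<close> and
  \<open>sin x\<close>, and products stay in the class by the product-to-sum formulas. This matches
  the notion of polynomial in the Stone-Weierstrass theorem.\<close>

lemma trig_poly_of_real_polynomial_function:
  fixes p :: "complex \<Rightarrow> real"
  assumes "real_polynomial_function p"
  shows "trig_poly (\<lambda>x. p (cis x))"
  using assms
proof induction
  case (linear f)
  then interpret bounded_linear f .
  have "f (cis x) = f 1 * cos (of_int 1 * x) + f \<i> * sin (of_int 1 * x)" for x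
  proof -
    have "cis x = cos x *\<^sub>R 1 + sin x *\<^sub>R \<i>"
      by (simp add: complex_eq_iff)
    then show ?thesis
      by (simp add: add scale mult.commute)
  qed
  moreover have "trig_poly (\<lambda>x. f 1 * cos (of_int 1 * x) + f \<i> * sin (of_int 1 * x))"
    by (intro trig_poly.intros)
  ultimately show ?case by presburger
next
  case (const c)
  have "trig_poly (\<lambda>x. c * cos (of_int 0 * x))"
    by (intro trig_poly.intros)
  then show ?case by simp
next
  case (add f g)
  then show ?case by (simp add: trig_poly.add)
next
  case (mult f g)
  then show ?case by (simp add: trig_poly_mult)
qed

lemma integral_trig_poly_eq_0:
  fixes f :: "real \<Rightarrow> real"
  assumes "trig_poly h" and f: "continuous_on {0..2*pi} f"
    and orth: "\<And>m. integral {0..2 * pi} (\<lambda>x. f x * trig m x) = 0"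
  shows "continuous_on {0..2*pi} h \<and> integral {0..2 * pi} (\<lambda>x. f x * h x) = 0"
  using assms(1)
proof induction
  case (cos k)
  have "(\<lambda>x. f x * cos (of_int k * x)) = (\<lambda>x. f x * trig \<bar>k\<bar> x)"
    by (auto simp: trig_def abs_if)
  then show ?case using orth[of "\<bar>k\<bar>"] by (auto intro!: continuous_intros)
next
  case (sin k)
  consider "k = 0" | "k < 0" | "k > 0" by linarith
  then have "integral {0..2 * pi} (\<lambda>x. f x * sin (of_int k * x)) = 0"
  proof cases
    case 1
    then show ?thesis by simp
  next
    case 2
    then have "(\<lambda>x. f x * sin (of_int k * x)) = (\<lambda>x. - (f x * trig k x))"
      by (auto simp: trig_def)
    then show ?thesis using orth[of k] by simp
  next
    case 3
    then have "(\<lambda>x. f x * sin (of_int k * x)) = (\<lambda>x. f x * trig (- k) x)"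
      by (auto simp: trig_def)
    then show ?thesis using orth[of "- k"] by simp
  qed
  then show ?case by (auto intro!: continuous_intros)
next
  case (add g h)
  have "integral {0..2 * pi} (\<lambda>x. f x * g x + f x * h x) = 0"
    using add.IH f by (subst integral_add) (auto intro!: integrable_continuous_interval continuous_intros)
  with add.IH show ?case by (auto simp: distrib_left intro!: continuous_intros)
next
  case (scale h c)
  have "(\<lambda>x. f x * (c * h x)) = (\<lambda>x. c * (f x * h x))"
    by (auto simp: mult_ac)
  with scale.IH show ?case by (auto intro!: continuous_intros)
qed

text \<open>Periodicity lets \<open>f\<close> descend to the unit circle, where Stone-Weierstrass
  applies. An approximant \<open>h\<close> is orthogonal to \<open>f\<close>, so the integral of
  \<open>f^2\<close> equals that of \<open>f * (f - h)\<close> and is at most \<open>e\<close> times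
  the integral of the absolute value of \<open>f\<close>, for every \<open>e > 0\<close>.\<close>

lemma trig_complete:
  fixes f :: "real \<Rightarrow> real"
  assumes f: "continuous_on UNIV f" and per: "\<And>x. f (x + 2 * pi) = f x"
    and orth: "\<And>m. integral {0..2 * pi} (\<lambda>x. f x * trig m x) = 0"
  shows "f x = 0"
proof -
  let ?I = "{0..2*pi}"
  have fI: "continuous_on ?I f"
    using f continuous_on_subset by blast
  \<comment> \<open>A continuous surjection from a compact interval onto a Hausdorff circle is a
    quotient map, which gives the continuity of the descended function \<open>g\<close>.\<close>
  have q: "quotient_map (top_of_set ?I) (top_of_set (sphere (0::complex) 1)) cis"
  proof (rule continuous_imp_quotient_map)
    show "cis ` topspace (top_of_set ?I) = topspace (top_of_set (sphere (0::complex) 1))"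
    proof (auto simp: dist_norm)
      fix z :: complex
      assume "norm z = 1"
      then have "z = cis (Arg2pi z)"
        using Arg2pi_eq[of z] by (simp add: cis_conv_exp)
      then show "z \<in> cis ` ?I"
        using Arg2pi_ge_0[of z] Arg2pi_lt_2pi[of z] by (metis atLeastAtMost_iff image_eqI less_imp_le)
    qed
    show "Hausdorff_space (top_of_set (sphere (0::complex) 1))"
      by (simp add: Hausdorff_space_subtopology)
  qed (auto simp: compact_space_subtopology dist_norm intro!: continuous_intros)
  have c: "continuous_map (top_of_set ?I) euclideanreal f"
    using fI by simp
  have eq: "f x = f y" if xy: "x \<in> ?I" "y \<in> ?I" "cis x = cis y" for x y
  proof -
    have "sin x = sin y \<and> cos x = cos y"
      using xy(3) by (auto simp: complex_eq_iff)
    then obtain n :: int where "x = y + 2 * pi * n"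
      unfolding sin_cos_eq_iff ..
    then have "x = y + of_int n * (2 * pi)"
      by simp
    then show ?thesis
      using periodic_add_of_int_mult[of f "2*pi", OF per] by auto
  qed
  have "f x = f y" if "x \<in> topspace (top_of_set ?I)" "y \<in> topspace (top_of_set ?I)" "cis x = cis y" for x y
    by (rule eq) (use that in auto)
  then obtain g where g: "continuous_map (top_of_set (sphere (0::complex) 1)) euclideanreal g"
    "\<And>x. x \<in> ?I \<Longrightarrow> g (cis x) = f x"
    using quotient_map_lift_exists[OF q c] by (metis topspace_euclidean_subtopology)
  have gc: "continuous_on (sphere 0 1) g"
    using g(1) by simp
  have le: "integral ?I (\<lambda>x. (f x)\<^sup>2) \<le> e * integral ?I (\<lambda>x. \<bar>f x\<bar>)" if "e > 0" for e
  proof -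
    obtain p where p: "real_polynomial_function p" "\<And>z. z \<in> sphere 0 1 \<Longrightarrow> \<bar>g z - p z\<bar> < e"
      using Stone_Weierstrass_real_polynomial_function[OF compact_sphere gc \<open>e > 0\<close>] by blast
    define h where "h x = p (cis x)" for x
    have h: "continuous_on ?I h" "integral ?I (\<lambda>x. f x * h x) = 0"
      using integral_trig_poly_eq_0[OF trig_poly_of_real_polynomial_function[OF p(1)] fI orth] unfolding h_def by auto
    have hf: "\<bar>f x - h x\<bar> < e" if "x \<in> ?I" for x
      using p(2)[of "cis x"] g(2)[OF that] by (simp add: h_def)
    have "integral ?I (\<lambda>x. (f x)\<^sup>2) = integral ?I (\<lambda>x. (f x)\<^sup>2) - integral ?I (\<lambda>x. f x * h x)"
      using h by simp
    also have "\<dots> = integral ?I (\<lambda>x. (f x)\<^sup>2 - f x * h x)"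
      using fI h(1) by (intro integral_diff[symmetric]) (auto intro!: integrable_continuous_interval continuous_intros)
    also have "\<dots> \<le> integral ?I (\<lambda>x. e * \<bar>f x\<bar>)"
    proof (rule integral_le)
      fix x assume "x \<in> ?I"
      have "(f x)\<^sup>2 - f x * h x \<le> \<bar>f x\<bar> * \<bar>f x - h x\<bar>"
        by (simp add: power2_eq_square flip: abs_mult right_diff_distrib)
      also have "\<dots> \<le> \<bar>f x\<bar> * e"
        using hf[OF \<open>x \<in> ?I\<close>] by (intro mult_left_mono) auto
      finally show "(f x)\<^sup>2 - f x * h x \<le> e * \<bar>f x\<bar>" by (simp add: mult.commute)
    qed (use fI h(1) in \<open>auto intro!: integrable_continuous_interval continuous_intros\<close>)
    finally show ?thesis by simp
  qed
  have "((\<lambda>e. e * integral ?I (\<lambda>x. \<bar>f x\<bar>)) \<longlongrightarrow> 0 * integral ?I (\<lambda>x. \<bar>f x\<bar>)) (at_right 0)"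
    by (intro tendsto_intros)
  moreover have "\<forall>\<^sub>F e in at_right 0. integral ?I (\<lambda>x. (f x)\<^sup>2) \<le> e * integral ?I (\<lambda>x. \<bar>f x\<bar>)"
    using le by (auto simp: eventually_at_right_less intro: eventually_at_rightI[of 0 1])
  ultimately have "integral ?I (\<lambda>x. (f x)\<^sup>2) \<le> 0"
    using tendsto_lowerbound by fastforce
  moreover have "integral ?I (\<lambda>x. (f x)\<^sup>2) \<ge> 0"
    using fI by (intro integral_nonneg) (auto intro!: integrable_continuous_interval continuous_intros)
  ultimately have "integral ?I (\<lambda>x. (f x)\<^sup>2) = 0" by simp
  then have z: "f x = 0" if "x \<in> ?I" for x
    using that fI by (subst (asm) integral_eq_0_iff) (auto intro!: continuous_intros)
  obtain j :: int where "x + of_int j * (2*pi) \<in> {0..<2*pi}"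
    using obtain_period_representative[of "2*pi" x] by auto
  then show ?thesis
    using z periodic_add_of_int_mult[of f "2*pi" x j, OF per] by auto
qed

text \<open>After multiplication by \<open>cis x ^ M\<close>, the sum becomes a complex polynomial
  of degree at most \<open>2 * M\<close> in \<open>cis x\<close>; and \<open>cis\<close> is
  injective on a half-open period, so zeros of \<open>h\<close> give distinct roots.\<close>

lemma card_zeros_trig_sum_le:
  fixes c :: "int \<Rightarrow> real" and M :: nat
  defines "h \<equiv> \<lambda>x. \<Sum>m = - int M..int M. c m * trig m x"
  assumes nz: "h x0 \<noteq> 0" and Z: "Z \<subseteq> {0..<2*pi}" "\<And>z. z \<in> Z \<Longrightarrow> h z = 0"
  shows "finite Z \<and> card Z \<le> 2 * M"
proof -
  define tp :: "int \<Rightarrow> complex poly" where "tp m =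
    (if 0 \<le> m then smult (1/2) (monom 1 (M + nat m) + monom 1 (M - nat m))
     else smult (1/(2*\<i>)) (monom 1 (M + nat (-m)) - monom 1 (M - nat (-m))))" for m
  define P where "P = (\<Sum>m = - int M..int M. smult (of_real (c m)) (tp m))"
  have cisp: "cis x ^ (M + k) = cis x ^ M * cis (k * x)" "k \<le> M \<Longrightarrow> cis x ^ (M - k) = cis x ^ M * cis (- (k * x))" for x k
  proof -
    show "cis x ^ (M + k) = cis x ^ M * cis (k * x)"
      by (simp add: power_add Complex.DeMoivre)
    assume "k \<le> M"
    then show "cis x ^ (M - k) = cis x ^ M * cis (- (k * x))"
      by (simp add: Complex.DeMoivre cis_mult of_nat_diff algebra_simps)
  qed
  have tp: "poly (tp m) (cis x) = cis x ^ M * of_real (trig m x)" if "m \<in> {- int M..int M}" for m x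
  proof (cases "0 \<le> m")
    case True
    then have "poly (tp m) (cis x) = (cis x ^ (M + nat m) + cis x ^ (M - nat m)) / 2"
      by (simp add: tp_def poly_monom)
    also have "\<dots> = cis x ^ M * ((cis (nat m * x) + cis (- (nat m * x))) / 2)"
      using True that by (subst cisp, subst cisp) (auto simp: algebra_simps)
    also have "(cis (nat m * x) + cis (- (nat m * x))) / 2 = of_real (trig m x)"
      using True by (simp add: trig_def complex_eq_iff)
    finally show ?thesis .
  next
    case False
    then have "poly (tp m) (cis x) = (cis x ^ (M + nat (-m)) - cis x ^ (M - nat (-m))) / (2*\<i>)"
      by (simp add: tp_def poly_monom)
    also have "\<dots> = cis x ^ M * ((cis (nat (-m) * x) - cis (- (nat (-m) * x))) / (2*\<i>))"
      using False that by (subst cisp, subst cisp) (auto simp: algebra_simps diff_divide_distrib)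
    also have "(cis (nat (-m) * x) - cis (- (nat (-m) * x))) / (2*\<i>) = of_real (trig m x)"
      using False by (simp add: trig_def complex_eq_iff)
    finally show ?thesis .
  qed
  have P: "poly P (cis x) = cis x ^ M * of_real (h x)" for x
    by (simp add: P_def h_def poly_sum tp sum_distrib_left mult_ac)
  have "poly P (cis x0) \<noteq> 0"
    using nz by (simp add: P)
  then have "P \<noteq> 0" by auto
  have "degree (tp m) \<le> 2 * M" if "m \<in> {- int M..int M}" for m
  proof -
    have "degree (monom (1::complex) (M + k)) \<le> 2 * M" "degree (monom (1::complex) (M - k)) \<le> 2 * M"
      if "k \<le> M" for k
      using that degree_monom_le[of "1::complex" "M + k"] degree_monom_le[of "1::complex" "M - k"] by linarith+
    then show ?thesis
      unfolding tp_def using that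
      by (auto intro!: order.trans[OF degree_smult_le] degree_add_le degree_diff_le)
  qed
  then have deg: "degree P \<le> 2 * M"
    unfolding P_def by (intro degree_sum_le) (auto intro!: order.trans[OF degree_smult_le])
  have inj: "inj_on cis Z"
  proof (rule inj_onI)
    fix x y assume xy: "x \<in> Z" "y \<in> Z" "cis x = cis y"
    then have "sin x = sin y \<and> cos x = cos y"
      by (auto simp: complex_eq_iff)
    then obtain n :: int where "x = y + 2 * pi * n"
      unfolding sin_cos_eq_iff ..
    then have n: "x = y + of_int n * (2 * pi)"
      by simp
    have "x \<in> {0..<2*pi}" "y \<in> {0..<2*pi}" using xy Z by auto
    then have "of_int n * (2 * pi) < 1 * (2*pi)" "(-1) * (2*pi) < of_int n * (2 * pi)"
      unfolding n atLeastLessThan_iff by linarith+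
    then have "of_int n < (1::real)" "(-1::real) < of_int n"
      by (meson mult_less_cancel_right_pos pi_gt_zero mult_pos_pos zero_less_numeral)+
    then have "n = 0" by linarith
    with n show "x = y" by simp
  qed
  have sub: "cis ` Z \<subseteq> {z. poly P z = 0}"
    using Z P by auto
  have fin: "finite {z. poly P z = 0}"
    by (rule poly_roots_finite[OF \<open>P \<noteq> 0\<close>])
  then have "finite (cis ` Z)" using sub finite_subset by blast
  then have "finite Z" using inj finite_imageD by blast
  have "card Z = card (cis ` Z)" using inj by (simp add: card_image)
  also have "\<dots> \<le> card {z. poly P z = 0}" using sub fin card_mono by blast
  also have "\<dots> \<le> 2 * M" using card_poly_roots_bound[OF \<open>P \<noteq> 0\<close>] deg by linarith
  finally show ?thesis using \<open>finite Z\<close> by blast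
qed

section \<open>Fourier expansion of the eigenfunctions\<close>

definition psi :: "int \<Rightarrow> int \<Rightarrow> plane \<Rightarrow> real" where
  "psi m n p = trig m (fst p) * trig n (snd p)"

lemma psi_has_derivative:
  "(psi m n has_derivative
     (\<lambda>v. fst v * (- of_int m) * psi (- m) n p + snd v * (- of_int n) * psi m (- n) p)) (at p)"
proof -
  have d: "((\<lambda>p. trig k (h p)) has_derivative (\<lambda>v. (- of_int k * trig (- k) (h p)) * h' v)) (at p)"
    if "(h has_derivative h') (at p)" for k h h'
    using has_derivative_compose[OF that, of "trig k" "(*) (- of_int k * trig (- k) (h p))"]
      trig_has_real_derivative[of k "h p" UNIV]
    by (simp add: has_field_derivative_def)
  have "((\<lambda>p. trig m (fst p) * trig n (snd p)) has_derivative
     (\<lambda>v. trig m (fst p) * ((- of_int n * trig (- n) (snd p)) * snd v) + ((- of_int m * trig (- m) (fst p)) * fst v) * trig n (snd p))) (at p)"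
    by (intro has_derivative_mult d has_derivative_fst has_derivative_snd has_derivative_ident)
  then show ?thesis
    unfolding psi_def by (rule has_derivative_eq_rhs) (simp add: fun_eq_iff)
qed

lemma frechet_derivative_psi:
  "frechet_derivative (psi m n) (at p) v =
     - of_int m * fst v * psi (- m) n p + - of_int n * snd v * psi m (- n) p"
  using fun_cong[OF frechet_derivative_at[OF psi_has_derivative[of m n p]], of v] by (simp add: mult_ac)

lemma frechet_derivative_lin_comb:
  fixes f g :: "'a::euclidean_space \<Rightarrow> real"
  assumes "f differentiable (at p)" "g differentiable (at p)"
  shows "(\<lambda>p. a * f p + b * g p) differentiable (at p)"
    and "frechet_derivative (\<lambda>p. a * f p + b * g p) (at p) =
      (\<lambda>v. a * frechet_derivative f (at p) v + b * frechet_derivative g (at p) v)"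
proof -
  have "((\<lambda>p. a * f p + b * g p) has_derivative
      (\<lambda>v. a * frechet_derivative f (at p) v + b * frechet_derivative g (at p) v)) (at p)"
    using assms by (intro has_derivative_add has_derivative_mult_right) (simp_all add: frechet_derivative_works)
  then show "(\<lambda>p. a * f p + b * g p) differentiable (at p)"
    and "frechet_derivative (\<lambda>p. a * f p + b * g p) (at p) =
      (\<lambda>v. a * frechet_derivative f (at p) v + b * frechet_derivative g (at p) v)"
    by (auto simp: differentiable_def frechet_derivative_at[symmetric])
qed

lemma cont_diff_lin_comb:
  fixes f g :: "'a::euclidean_space \<Rightarrow> real"
  assumes "cont_diff n f" "cont_diff n g"
  shows "cont_diff n (\<lambda>p. a * f p + b * g p)"
  using assms
proof (induction n arbitrary: f g)
  case 0
  then show ?case by (auto intro!: continuous_intros)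
next
  case (Suc n)
  then show ?case
    by (auto simp: frechet_derivative_lin_comb)
qed

lemma smooth_lin_comb:
  "smooth f \<Longrightarrow> smooth g \<Longrightarrow> smooth (\<lambda>p. a * f p + b * g p)"
  by (simp add: smooth_def cont_diff_lin_comb)

lemma smooth_differentiable: "smooth f \<Longrightarrow> f differentiable (at p)"
  unfolding smooth_def by (drule spec[of _ "Suc 0"]) simp

lemma smooth_continuous_on:
  assumes "smooth f"
  shows "continuous_on S f"
proof -
  have "cont_diff 0 f"
    using assms unfolding smooth_def ..
  then show ?thesis
    using continuous_on_subset by auto
qed

lemma smooth_frechet_derivative:
  assumes "smooth f"
  shows "smooth (\<lambda>p. frechet_derivative f (at p) v)"
  unfolding smooth_def
proof
  fix n
  have "cont_diff (Suc n) f"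
    using assms unfolding smooth_def ..
  then show "cont_diff n (\<lambda>p. frechet_derivative f (at p) v)"
    by simp
qed

lemma laplacian_lin_comb:
  assumes f: "smooth f" and g: "smooth g"
  shows "laplacian (\<lambda>p. a * f p + b * g p) p = a * laplacian f p + b * laplacian g p"
proof -
  have "frechet_derivative (\<lambda>p. a * f p + b * g p) (at q) e =
      a * frechet_derivative f (at q) e + b * frechet_derivative g (at q) e" for q e
    by (simp only: frechet_derivative_lin_comb(2)[OF smooth_differentiable[OF f] smooth_differentiable[OF g]])
  moreover have "frechet_derivative (\<lambda>q. a * frechet_derivative f (at q) e + b * frechet_derivative g (at q) e) (at p) e =
     a * frechet_derivative (\<lambda>q. frechet_derivative f (at q) e) (at p) e +
     b * frechet_derivative (\<lambda>q. frechet_derivative g (at q) e) (at p) e" for e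
    by (simp only: frechet_derivative_lin_comb(2)[OF smooth_differentiable smooth_differentiable,
          OF smooth_frechet_derivative[OF f] smooth_frechet_derivative[OF g]])
  ultimately show ?thesis
    unfolding laplacian_def by (simp only: sum.distrib sum_distrib_left)
qed

lemma smooth_psi: "smooth (psi m n)"
proof -
  have "cont_diff k (psi m n)" for k m n
  proof (induction k arbitrary: m n)
    case 0
    show ?case by (auto simp: psi_def intro!: continuous_intros)
  next
    case (Suc k)
    have "psi m n differentiable at p" for p
      using psi_has_derivative by (rule differentiableI)
    moreover have "cont_diff k (\<lambda>p. (- of_int m * fst v) * psi (- m) n p + (- of_int n * snd v) * psi m (- n) p)" for v
      by (rule cont_diff_lin_comb[OF Suc Suc])
    ultimately show ?case
      by (simp add: frechet_derivative_psi)
  qed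
  then show ?thesis by (simp add: smooth_def)
qed

lemma smooth_sum:
  fixes f :: "'i \<Rightarrow> plane \<Rightarrow> real"
  assumes "\<And>i. i \<in> I \<Longrightarrow> smooth (f i)"
  shows "smooth (\<lambda>p. \<Sum>i\<in>I. c i * f i p) \<and>
    laplacian (\<lambda>p. \<Sum>i\<in>I. c i * f i p) p = (\<Sum>i\<in>I. c i * laplacian (f i) p)"
  using assms
proof (induction I rule: infinite_finite_induct)
  case (insert i I)
  have "smooth (\<lambda>p. c i * f i p + 1 * (\<Sum>i\<in>I. c i * f i p))"
    using insert by (intro smooth_lin_comb) auto
  moreover have "laplacian (\<lambda>p. c i * f i p + 1 * (\<Sum>i\<in>I. c i * f i p)) p =
     c i * laplacian (f i) p + 1 * laplacian (\<lambda>p. \<Sum>i\<in>I. c i * f i p) p"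
    using insert by (intro laplacian_lin_comb) auto
  ultimately show ?case using insert by simp
next
  \<comment> \<open>A sum over an infinite index set is 0 by convention; the zero function is
    presented as a linear combination with both coefficients 0.\<close>
  case (infinite I)
  then show ?case using smooth_lin_comb[OF smooth_psi smooth_psi, of 0 _ _ 0] laplacian_lin_comb[OF smooth_psi smooth_psi, of 0 _ _ 0]
    by simp
next
  case empty
  then show ?case using smooth_lin_comb[OF smooth_psi smooth_psi, of 0 _ _ 0] laplacian_lin_comb[OF smooth_psi smooth_psi, of 0 _ _ 0]
    by simp
qed

lemma laplacian_plane:
  fixes u :: "plane \<Rightarrow> real"
  shows "laplacian u p = frechet_derivative (\<lambda>q. frechet_derivative u (at q) (1, 0)) (at p) (1, 0)
     + frechet_derivative (\<lambda>q. frechet_derivative u (at q) (0, 1)) (at p) (0, 1)"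
  by (simp add: laplacian_def Basis_prod_def)

lemma laplacian_psi: "laplacian (psi m n) p = - (of_int (m\<^sup>2 + n\<^sup>2)) * psi m n p"
proof -
  have *: "frechet_derivative (\<lambda>q. c * psi k l q) (at p) v = c * frechet_derivative (psi k l) (at p) v" for c k l v
    using frechet_derivative_lin_comb(2)[OF smooth_differentiable smooth_differentiable, OF smooth_psi smooth_psi, where b = 0 and a = c]
    by simp
  show ?thesis
    unfolding laplacian_plane
    using *[of "- of_int m" "- m" n "(1, 0)"] *[of "- of_int n" m "- n" "(0, 1)"]
    by (simp add: frechet_derivative_psi power2_eq_square algebra_simps)
qed

lemma partial_derivatives:
  fixes u :: "plane \<Rightarrow> real"
  assumes "u differentiable (at (x, y))"
  shows "((\<lambda>x. u (x, y)) has_real_derivative frechet_derivative u (at (x, y)) (1, 0)) (at x)"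
    and "((\<lambda>y. u (x, y)) has_real_derivative frechet_derivative u (at (x, y)) (0, 1)) (at y)"
proof -
  define D where "D = frechet_derivative u (at (x, y))"
  have D: "(u has_derivative D) (at (x, y))"
    using assms by (simp add: D_def frechet_derivative_works)
  then interpret bounded_linear D by (rule has_derivative_bounded_linear)
  have "(\<lambda>h. D (h, 0)) = (*) (D (1, 0))" "(\<lambda>h. D (0, h)) = (*) (D (0, 1))"
  proof -
    have "D (h, 0) = D (1, 0) * h" for h
      using scaleR[of h "(1, 0)"] by (simp add: mult.commute[of h])
    then show "(\<lambda>h. D (h, 0)) = (*) (D (1, 0))" ..
    have "D (0, h) = D (0, 1) * h" for h
      using scaleR[of h "(0, 1)"] by (simp add: mult.commute[of h])
    then show "(\<lambda>h. D (0, h)) = (*) (D (0, 1))" ..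
  qed
  moreover have "((\<lambda>x. u (x, y)) has_derivative (\<lambda>h. D (h, 0))) (at x)"
    by (rule has_derivative_compose[of "\<lambda>x. (x, y)" "\<lambda>h. (h, 0)", OF _ D]) (auto intro!: derivative_eq_intros)
  moreover have "((\<lambda>y. u (x, y)) has_derivative (\<lambda>h. D (0, h))) (at y)"
    by (rule has_derivative_compose[of "\<lambda>y. (x, y)" "\<lambda>h. (0, h)", OF _ D]) (auto intro!: derivative_eq_intros)
  ultimately have "((\<lambda>x. u (x, y)) has_derivative (*) (D (1, 0))) (at x)"
    "((\<lambda>y. u (x, y)) has_derivative (*) (D (0, 1))) (at y)"
    by (simp_all only:)
  then show "((\<lambda>x. u (x, y)) has_real_derivative frechet_derivative u (at (x, y)) (1, 0)) (at x)"
    "((\<lambda>y. u (x, y)) has_real_derivative frechet_derivative u (at (x, y)) (0, 1)) (at y)"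
    by (simp_all only: has_field_derivative_def D_def)
qed

lemma frechet_derivative_translate:
  fixes u :: "'a::euclidean_space \<Rightarrow> real"
  assumes "\<And>p. u differentiable (at p)" "\<And>p. u (p + c) = u p"
  shows "frechet_derivative u (at (p + c)) = frechet_derivative u (at p)"
proof -
  have "(u has_derivative frechet_derivative u (at (p + c))) (at (p + c))"
    using assms(1) by (simp add: frechet_derivative_works)
  then have "((\<lambda>p. u (p + c)) has_derivative frechet_derivative u (at (p + c))) (at p)"
    by (intro has_derivative_compose[of "\<lambda>p. p + c" "\<lambda>v. v" p UNIV u]) (auto intro!: derivative_eq_intros)
  then show ?thesis
    using assms(2) by (simp add: frechet_derivative_at)
qed

section \<open>Fourier coefficients on the torus\<close>

definition fourier :: "(plane \<Rightarrow> real) \<Rightarrow> int \<Rightarrow> int \<Rightarrow> real" where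
  "fourier u m n = integral {0..2*pi} (\<lambda>y. integral {0..2*pi} (\<lambda>x. u (x, y) * trig m x) * trig n y)"

lemma continuous_on_slice:
  fixes u :: "plane \<Rightarrow> real"
  assumes "continuous_on UNIV u"
  shows "continuous_on S (\<lambda>x. u (x, y))" "continuous_on S (\<lambda>y. u (x, y))"
  by (auto intro!: continuous_on_compose2[OF assms] continuous_intros)

lemma continuous_on_integral_trig:
  fixes u :: "plane \<Rightarrow> real"
  assumes u: "continuous_on UNIV u"
  shows "continuous_on S (\<lambda>y. integral {0..2*pi} (\<lambda>x. u (x, y) * trig m x))"
proof -
  have "continuous_on (UNIV \<times> cbox 0 (2*pi)) (\<lambda>(y, x). u (x, y) * trig m x)"
    by (auto simp: case_prod_unfold intro!: continuous_intros continuous_on_compose2[OF u])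
  then have "continuous_on UNIV (\<lambda>y. integral {0..2*pi} (\<lambda>x. u (x, y) * trig m x))"
    using integral_continuous_on_param[of UNIV 0 "2*pi" "\<lambda>y x. u (x, y) * trig m x"] by simp
  then show ?thesis
    using continuous_on_subset by blast
qed

text \<open>\<open>fourier\<close> integrates over \<open>x\<close> first, whereas integration by
  parts in the second variable wants the inner integral to be over \<open>y\<close>.\<close>

lemma fourier_swap:
  fixes u :: "plane \<Rightarrow> real"
  assumes u: "continuous_on UNIV u"
  shows "fourier u m n = integral {0..2*pi} (\<lambda>x. integral {0..2*pi} (\<lambda>y. u (x, y) * trig n y) * trig m x)"
proof -
  have "continuous_on (cbox (0, 0) (2*pi, 2*pi)) (\<lambda>(x, y). u (y, x) * trig m y * trig n x)"
    by (auto simp: case_prod_unfold intro!: continuous_intros continuous_on_compose2[OF u])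
  from integral_swap_continuous[OF this]
  have "integral {0..2*pi} (\<lambda>y. integral {0..2*pi} (\<lambda>x. u (x, y) * trig m x * trig n y)) =
    integral {0..2*pi} (\<lambda>x. integral {0..2*pi} (\<lambda>y. u (x, y) * trig m x * trig n y))"
    by simp
  moreover have "(\<lambda>y. u (x, y) * trig m x * trig n y) = (\<lambda>y. (u (x, y) * trig n y) * trig m x)" for x
    by (simp add: mult_ac)
  ultimately show ?thesis
    by (simp add: fourier_def)
qed

lemma fourier_lin_comb:
  fixes u v :: "plane \<Rightarrow> real"
  assumes u: "continuous_on UNIV u" and v: "continuous_on UNIV v"
  shows "fourier (\<lambda>p. a * u p + b * v p) m n = a * fourier u m n + b * fourier v m n"
proof -
  have "integral {0..2*pi} (\<lambda>x. (a * u (x, y) + b * v (x, y)) * trig m x) =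
     a * integral {0..2*pi} (\<lambda>x. u (x, y) * trig m x) + b * integral {0..2*pi} (\<lambda>x. v (x, y) * trig m x)" for y
  proof -
    have "(\<lambda>x. (a * u (x, y) + b * v (x, y)) * trig m x) =
       (\<lambda>x. a * (u (x, y) * trig m x) + b * (v (x, y) * trig m x))"
      by (simp add: algebra_simps)
    moreover have "integral {0..2*pi} \<dots> = integral {0..2*pi} (\<lambda>x. a * (u (x, y) * trig m x)) +
       integral {0..2*pi} (\<lambda>x. b * (v (x, y) * trig m x))"
      by (intro integral_add integrable_continuous_interval continuous_intros continuous_on_slice u v)
    ultimately show ?thesis by simp
  qed
  moreover have "integral {0..2*pi} (\<lambda>y. (a * integral {0..2*pi} (\<lambda>x. u (x, y) * trig m x)
      + b * integral {0..2*pi} (\<lambda>x. v (x, y) * trig m x)) * trig n y) = a * fourier u m n + b * fourier v m n"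
  proof -
    have "(\<lambda>y. (a * integral {0..2*pi} (\<lambda>x. u (x, y) * trig m x)
      + b * integral {0..2*pi} (\<lambda>x. v (x, y) * trig m x)) * trig n y) =
      (\<lambda>y. a * (integral {0..2*pi} (\<lambda>x. u (x, y) * trig m x) * trig n y)
      + b * (integral {0..2*pi} (\<lambda>x. v (x, y) * trig m x) * trig n y))"
      by (simp add: algebra_simps)
    moreover have "integral {0..2*pi} \<dots> =
       integral {0..2*pi} (\<lambda>y. a * (integral {0..2*pi} (\<lambda>x. u (x, y) * trig m x) * trig n y)) +
       integral {0..2*pi} (\<lambda>y. b * (integral {0..2*pi} (\<lambda>x. v (x, y) * trig m x) * trig n y))"
      by (intro integral_add integrable_continuous_interval continuous_intros continuous_on_integral_trig u v)
    ultimately show ?thesis by (simp add: fourier_def)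
  qed
  ultimately show ?thesis by (simp add: fourier_def)
qed

lemma fourier_psi:
  "fourier (psi k l) m n = integral {0..2*pi} (\<lambda>x. trig k x * trig m x) * integral {0..2*pi} (\<lambda>y. trig l y * trig n y)"
proof -
  have eq: "(\<lambda>x. trig k x * trig l y * trig m x) = (\<lambda>x. (trig k x * trig m x) * trig l y)" for y
    by (simp add: mult_ac)
  have i: "integral {0..2*pi} (\<lambda>x. trig k x * trig l y * trig m x) * trig n y =
      integral {0..2*pi} (\<lambda>x. trig k x * trig m x) * (trig l y * trig n y)" for y
    unfolding eq integral_mult_left by (simp add: mult.assoc)
  then show ?thesis
    unfolding fourier_def psi_def fst_conv snd_conv i by simp
qed

lemma fourier_psi_eq_0_iff: "fourier (psi k l) m n = 0 \<longleftrightarrow> (k, l) \<noteq> (m, n)"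
  by (auto simp: fourier_psi integral_trig_mult)

lemma fourier_sum_psi:
  assumes "finite I"
  shows "continuous_on UNIV (\<lambda>p. \<Sum>(k, l)\<in>I. c k l * psi k l p) \<and>
    fourier (\<lambda>p. \<Sum>(k, l)\<in>I. c k l * psi k l p) m n =
      (if (m, n) \<in> I then c m n * fourier (psi m n) m n else 0)"
  using assms
proof (induction I)
  case empty
  have "fourier (\<lambda>p. 0 * psi 0 0 p + 0 * psi 0 0 p) m n = 0"
    by (subst fourier_lin_comb) (auto intro: smooth_continuous_on smooth_psi)
  then show ?case by simp
next
  case (insert i I)
  obtain k l where i: "i = (k, l)" by fastforce
  have "fourier (\<lambda>p. c k l * psi k l p + 1 * (\<Sum>(k, l)\<in>I. c k l * psi k l p)) m n =
     c k l * fourier (psi k l) m n + 1 * fourier (\<lambda>p. \<Sum>(k, l)\<in>I. c k l * psi k l p) m n"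
    using insert by (intro fourier_lin_comb) (auto intro: smooth_continuous_on smooth_psi)
  moreover have "continuous_on UNIV (\<lambda>p. c k l * psi k l p + 1 * (\<Sum>(k, l)\<in>I. c k l * psi k l p))"
    using insert by (intro continuous_on_add continuous_on_mult continuous_on_const smooth_continuous_on[OF smooth_psi]) auto
  ultimately show ?case
    using insert fourier_psi_eq_0_iff[of k l m n] by (auto simp: i)
qed

text \<open>Linear independence of the \<open>psi\<close>, in the form used both for the invariance
  conditions on coefficients and for the dimension of an eigenspace.\<close>

lemma sum_psi_eq_0_imp:
  assumes "finite I" "\<And>p. (\<Sum>(k, l)\<in>I. c k l * psi k l p) = 0" "(m, n) \<in> I"
  shows "c m n = 0"
proof -
  have "fourier (\<lambda>p. 0 * psi 0 0 p + 0 * psi 0 0 p) m n = 0"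
    by (subst fourier_lin_comb) (auto intro: smooth_continuous_on smooth_psi)
  then have "fourier (\<lambda>p. \<Sum>(k, l)\<in>I. c k l * psi k l p) m n = 0"
    using assms(2) by simp
  then show ?thesis
    using fourier_sum_psi[OF assms(1), of c m n] assms(3) fourier_psi_eq_0_iff[of m n m n] by simp
qed

text \<open>One-dimensional completeness twice: for fixed \<open>m\<close> the inner integral is a
  function of \<open>y\<close> whose coefficients all vanish, and then every horizontal slice of
  \<open>u\<close> has vanishing coefficients.\<close>

lemma fourier_complete:
  fixes u :: "plane \<Rightarrow> real"
  assumes u: "continuous_on UNIV u"
    and per: "\<And>x y. u (x + 2 * pi, y) = u (x, y)" "\<And>x y. u (x, y + 2 * pi) = u (x, y)"
    and z: "\<And>m n. fourier u m n = 0"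
  shows "u p = 0"
proof -
  have "integral {0..2*pi} (\<lambda>x. u (x, y) * trig m x) = 0" for m y
  proof (rule trig_complete[of "\<lambda>y. integral {0..2*pi} (\<lambda>x. u (x, y) * trig m x)"])
    show "integral {0..2 * pi} (\<lambda>y. integral {0..2 * pi} (\<lambda>x. u (x, y) * trig m x) * trig n y) = 0" for n
      using z[of m n] by (simp add: fourier_def)
  qed (auto intro!: continuous_on_integral_trig u simp: per)
  then have "u (x, y) = 0" for x y
    by (rule trig_complete[of "\<lambda>x. u (x, y)", rotated 2]) (auto intro!: continuous_on_slice u simp: per)
  then show ?thesis by (cases p) auto
qed

lemma abs_le_square_int: "\<bar>k\<bar> \<le> (k::int)\<^sup>2"
proof (cases "k = 0")
  case False
  then have "\<bar>k\<bar> * 1 \<le> \<bar>k\<bar> * \<bar>k\<bar>"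
    by (intro mult_left_mono) auto
  then show ?thesis by (simp add: power2_eq_square)
qed simp

lemma finite_sum_squares_le: "finite {(m::int, n::int). m\<^sup>2 + n\<^sup>2 \<le> b}"
proof (rule finite_subset)
  have "(m, n) \<in> {- b..b} \<times> {- b..b}" if "m\<^sup>2 + n\<^sup>2 \<le> b" for m n :: int
    using that abs_le_square_int[of m] abs_le_square_int[of n] by auto
  then show "{(m::int, n::int). m\<^sup>2 + n\<^sup>2 \<le> b} \<subseteq> {- b..b} \<times> {- b..b}"
    by blast
qed auto

lemma finite_sum_squares_eq: "finite {(m::int, n::int). of_int (m\<^sup>2 + n\<^sup>2) = (\<mu>::real)}"
  by (rule finite_subset[OF _ finite_sum_squares_le[of "\<lfloor>\<mu>\<rfloor>"]]) (auto simp del: of_int_add)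

text \<open>Integration by parts in both variables turns the eigenvalue equation into
  \<open>(m^2 + n^2 - \<mu>) * fourier u m n = 0\<close>.\<close>

lemma fourier_eigenfunction:
  fixes u :: "plane \<Rightarrow> real"
  assumes u: "smooth u"
    and per: "\<And>x y. u (x + 2 * pi, y) = u (x, y)" "\<And>x y. u (x, y + 2 * pi) = u (x, y)"
    and eig: "\<And>p. - laplacian u p = \<mu> * u p"
  shows "of_int (m\<^sup>2 + n\<^sup>2) = \<mu> \<or> fourier u m n = 0"
proof -
  define ux uy where "ux = (\<lambda>q. frechet_derivative u (at q) (1, 0))" and "uy = (\<lambda>q. frechet_derivative u (at q) (0, 1))"
  define uxx uyy where "uxx = (\<lambda>q. frechet_derivative ux (at q) (1, 0))" and "uyy = (\<lambda>q. frechet_derivative uy (at q) (0, 1))"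
  have sm: "smooth ux" "smooth uy" "smooth uxx" "smooth uyy"
    using u by (auto simp: ux_def uy_def uxx_def uyy_def intro!: smooth_frechet_derivative)
  have cont: "continuous_on UNIV u" "continuous_on UNIV uxx" "continuous_on UNIV uyy"
    using u sm by (auto intro: smooth_continuous_on)
  have dx: "((\<lambda>x. u (x, y)) has_real_derivative ux (x, y)) (at x)" "((\<lambda>x. ux (x, y)) has_real_derivative uxx (x, y)) (at x)" for x y
    using partial_derivatives(1)[OF smooth_differentiable[OF u], where x = x and y = y] partial_derivatives(1)[OF smooth_differentiable[OF sm(1)], where x = x and y = y]
    by (simp_all add: ux_def uxx_def)
  have dy: "((\<lambda>y. u (x, y)) has_real_derivative uy (x, y)) (at y)" "((\<lambda>y. uy (x, y)) has_real_derivative uyy (x, y)) (at y)" for x y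
    using partial_derivatives(2)[OF smooth_differentiable[OF u], where x = x and y = y] partial_derivatives(2)[OF smooth_differentiable[OF sm(2)], where x = x and y = y]
    by (simp_all add: uy_def uyy_def)
  have perx: "ux (2 * pi, y) = ux (0, y)" for y
    using frechet_derivative_translate[of u "(2 * pi, 0)" "(0, y)"] smooth_differentiable[OF u] per by (auto simp: ux_def)
  have pery: "uy (x, 2 * pi) = uy (x, 0)" for x
    using frechet_derivative_translate[of u "(0, 2 * pi)" "(x, 0)"] smooth_differentiable[OF u] per by (auto simp: uy_def)
  have "integral {0..2*pi} (\<lambda>x. uxx (x, y) * trig m x) = - (of_int m)\<^sup>2 * integral {0..2*pi} (\<lambda>x. u (x, y) * trig m x)" for y
    using per(1)[of 0 y] perx[of y]
    by (intro integral_second_derivative_trig[OF dx] continuous_on_slice cont) auto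
  then have 1: "fourier uxx m n = - (of_int m)\<^sup>2 * fourier u m n"
    by (simp add: fourier_def mult.assoc)
  have "integral {0..2*pi} (\<lambda>y. uyy (x, y) * trig n y) = - (of_int n)\<^sup>2 * integral {0..2*pi} (\<lambda>y. u (x, y) * trig n y)" for x
    using per(2)[of x 0] pery[of x]
    by (intro integral_second_derivative_trig[OF dy] continuous_on_slice cont) auto
  then have 2: "fourier uyy m n = - (of_int n)\<^sup>2 * fourier u m n"
    by (simp add: fourier_swap cont mult.assoc)
  have "(\<lambda>p. 1 * uxx p + 1 * uyy p) = (\<lambda>p. (- \<mu>) * u p + 0 * u p)"
  proof
    fix p
    have "- (uxx p + uyy p) = \<mu> * u p"
      using eig[of p] by (simp add: laplacian_plane ux_def uy_def uxx_def uyy_def)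
    then show "1 * uxx p + 1 * uyy p = (- \<mu>) * u p + 0 * u p"
      by linarith
  qed
  then have "fourier (\<lambda>p. 1 * uxx p + 1 * uyy p) m n = fourier (\<lambda>p. (- \<mu>) * u p + 0 * u p) m n"
    by simp
  then have "fourier uxx m n + fourier uyy m n = - \<mu> * fourier u m n"
    unfolding fourier_lin_comb[OF cont(2,3)] fourier_lin_comb[OF cont(1,1)] by simp
  then have "(of_int (m\<^sup>2 + n\<^sup>2) - \<mu>) * fourier u m n = 0"
    unfolding 1 2 by (simp add: algebra_simps)
  then show ?thesis by auto
qed

text \<open>Only finitely many coefficients can be nonzero. The difference of \<open>u\<close> and
  its finite Fourier sum has no coefficient left, so completeness applies and no convergence
  question arises.\<close>

lemma eigenfunction_expansion:
  fixes u :: "plane \<Rightarrow> real"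
  assumes u: "smooth u"
    and per: "\<And>x y. u (x + 2 * pi, y) = u (x, y)" "\<And>x y. u (x, y + 2 * pi) = u (x, y)"
    and eig: "\<And>p. - laplacian u p = \<mu> * u p"
  obtains c where "\<And>p. u p = (\<Sum>(m, n)\<in>{(m, n). of_int (m\<^sup>2 + n\<^sup>2) = \<mu>}. c m n * psi m n p)"
proof
  let ?K = "{(m::int, n::int). of_int (m\<^sup>2 + n\<^sup>2) = \<mu>}"
  \<comment> \<open>The coefficient functional is not normalised, hence the division by its value on
    \<open>psi m n\<close> itself.\<close>
  define c where "c m n = fourier u m n / fourier (psi m n) m n" for m n
  define v where "v p = (\<Sum>(m, n)\<in>?K. c m n * psi m n p)" for p
  have v: "continuous_on UNIV v" "fourier v m n = (if (m, n) \<in> ?K then c m n * fourier (psi m n) m n else 0)" for m n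
    using fourier_sum_psi[OF finite_sum_squares_eq[of \<mu>], of c] by (auto simp: v_def[abs_def])
  have cu: "continuous_on UNIV u" using u by (rule smooth_continuous_on)
  have "1 * u p + (-1) * v p = 0" for p
  proof (rule fourier_complete)
    show "continuous_on UNIV (\<lambda>a. 1 * u a + (-1) * v a)"
      by (intro continuous_intros cu v)
    show "fourier (\<lambda>a. 1 * u a + (-1) * v a) m n = 0" for m n
      unfolding fourier_lin_comb[OF cu v(1)] v(2)
      using fourier_eigenfunction[OF u per eig, of m n] fourier_psi_eq_0_iff[of m n m n] by (auto simp: c_def)
  qed (auto simp: per v_def psi_def)
  then show "u p = (\<Sum>(m, n)\<in>?K. c m n * psi m n p)" for p
    by (simp add: v_def)
qed

section \<open>The spectrum of the Klein bottles\<close>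

text \<open>The vertical period is 2 pi / r, so both bottles are quotients of the same square torus
  and share the lattice of frequencies \<open>(m, n)\<close>.\<close>

definition klein :: "nat \<Rightarrow> (plane \<Rightarrow> plane) set" where
  "klein r = klein_group (2 * pi) (2 * pi / r)"

lemma subgroup_klein: "subgroup (klein r) (BijGroup UNIV)"
  unfolding klein_def klein_group_def
  by (intro group.generate_is_subgroup group_BijGroup) (use klein_generators_in_BijGroup in auto)

lemma generators_in_klein: "tau1 (2 * pi / r) \<in> klein r" "tau (2 * pi) (2 * pi / r) \<in> klein r"
  unfolding klein_def klein_group_def by (auto intro: generate.incl)

lemma BijGroup_apply:
  assumes "f \<in> carrier (BijGroup UNIV)" "g \<in> carrier (BijGroup UNIV)"
  shows "(f \<otimes>\<^bsub>BijGroup UNIV\<^esub> g) p = f (g p)" "\<one>\<^bsub>BijGroup UNIV\<^esub> p = p"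
    and "(inv\<^bsub>BijGroup UNIV\<^esub> f) (f p) = p" "f ((inv\<^bsub>BijGroup UNIV\<^esub> f) p) = p"
proof -
  have *: "(f \<otimes>\<^bsub>BijGroup UNIV\<^esub> g) p = f (g p)"
    if "f \<in> carrier (BijGroup UNIV)" "g \<in> carrier (BijGroup UNIV)" for f g :: "'a \<Rightarrow> 'a" and p
    using that by (auto simp: BijGroup_def compose_def)
  have one: "\<one>\<^bsub>BijGroup UNIV\<^esub> p = p" for p :: 'a
    by (simp add: BijGroup_def)
  interpret group "BijGroup (UNIV :: 'a set)" by (rule group_BijGroup)
  show "(f \<otimes>\<^bsub>BijGroup UNIV\<^esub> g) p = f (g p)" "\<one>\<^bsub>BijGroup UNIV\<^esub> p = p"
    using * one assms by auto
  show "(inv\<^bsub>BijGroup UNIV\<^esub> f) (f p) = p" "f ((inv\<^bsub>BijGroup UNIV\<^esub> f) p) = p"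
    using *[of "inv\<^bsub>BijGroup UNIV\<^esub> f" f p] *[of f "inv\<^bsub>BijGroup UNIV\<^esub> f" p] assms one by auto
qed

lemma orbit_ofI: "h \<in> H \<Longrightarrow> h p \<in> orbit_of H p"
  by (auto simp: orbit_of_def)

lemma orbit_of_apply:
  assumes H: "subgroup H (BijGroup UNIV)" and g: "g \<in> H"
  shows "orbit_of H (g p) = orbit_of H p"
proof (intro equalityI subsetI)
  note c = subgroup.mem_carrier[OF H]
  fix q
  show "q \<in> orbit_of H p" if "q \<in> orbit_of H (g p)"
  proof -
    obtain h where h: "h \<in> H" "q = h (g p)"
      using \<open>q \<in> orbit_of H (g p)\<close> by (auto simp: orbit_of_def)
    have "(h \<otimes>\<^bsub>BijGroup UNIV\<^esub> g) p \<in> orbit_of H p"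
      by (intro orbit_ofI subgroup.m_closed[OF H] h g)
    then show ?thesis
      by (simp only: h(2) BijGroup_apply(1)[OF c[OF h(1)] c[OF g]])
  qed
  show "q \<in> orbit_of H (g p)" if "q \<in> orbit_of H p"
  proof -
    obtain h where h: "h \<in> H" "q = h p"
      using \<open>q \<in> orbit_of H p\<close> by (auto simp: orbit_of_def)
    have i: "inv\<^bsub>BijGroup UNIV\<^esub> g \<in> H"
      using H g by (rule subgroup.m_inv_closed)
    have "(h \<otimes>\<^bsub>BijGroup UNIV\<^esub> inv\<^bsub>BijGroup UNIV\<^esub> g) (g p) \<in> orbit_of H (g p)"
      by (intro orbit_ofI subgroup.m_closed[OF H] h i)
    then show ?thesis
      by (simp only: h(2) BijGroup_apply(1)[OF c[OF h(1)] c[OF i]] BijGroup_apply(3)[OF c[OF g] c[OF g]])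
  qed
qed

lemma orbit_klein_translate:
  "orbit_of (klein r) (x + of_int j * (2 * pi), y + of_int k * (2 * pi / r)) = orbit_of (klein r) (x, y)"
    and orbit_klein_reflect:
  "orbit_of (klein r) (x + pi, - y) = orbit_of (klein r) (x, y)"
proof -
  let ?O = "orbit_of (klein r)" and ?b = "2 * pi / r"
  have 1: "?O (x, y + ?b) = ?O (x, y)" for x y
    using orbit_of_apply[OF subgroup_klein generators_in_klein(1), of r "(x, y)"] by (simp add: tau1_def)
  have 2: "?O (x + pi, ?b - y) = ?O (x, y)" for x y
    using orbit_of_apply[OF subgroup_klein generators_in_klein(2), of r "(x, y)"] by (simp add: tau_def)
  have 3: "?O (x + pi, - y) = ?O (x, y)" for x y
    using 1[of "x + pi" "- y"] 2[of x y] by simp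
  then show "?O (x + pi, - y) = ?O (x, y)" .
  have 4: "?O (x + 2 * pi, y) = ?O (x, y)" for x y
    using 3[of "x + pi" "- y"] 3[of x y] by (simp add: add.assoc)
  have a: "?O (x, y + of_int k * ?b) = ?O (x, y)" for x
    by (rule periodic_add_of_int_mult[of "\<lambda>y. ?O (x, y)"]) (rule 1)
  have b: "?O (x + of_int j * (2 * pi), y) = ?O (x, y)" for y
    by (rule periodic_add_of_int_mult[of "\<lambda>x. ?O (x, y)"]) (rule 4)
  show "?O (x + of_int j * (2 * pi), y + of_int k * ?b) = ?O (x, y)"
    by (rule trans[OF b a])
qed

text \<open>Modulo the vertical translation, \<open>tau\<close> may be replaced by the simpler glide
  reflection to \<open>(x + pi, - y)\<close>.\<close>

lemma invariant_klein_iff: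
  "(\<forall>g\<in>klein r. \<forall>p. u (g p) = u p) \<longleftrightarrow>
    (\<forall>x y. u (x, y + 2 * pi / r) = u (x, y) \<and> u (x + pi, - y) = u (x, y))" (is "?L \<longleftrightarrow> ?R")
proof
  assume ?L
  have 1: "u (x, y + 2 * pi / r) = u (x, y)" for x y
    using bspec[OF \<open>?L\<close> generators_in_klein(1), THEN spec, of "(x, y)"] by (simp add: tau1_def)
  moreover have "u (x + pi, 2 * pi / r - y) = u (x, y)" for x y
    using bspec[OF \<open>?L\<close> generators_in_klein(2), THEN spec, of "(x, y)"] by (simp add: tau_def)
  then have "u (x + pi, - y) = u (x, y)" for x y
    using 1[of "x + pi" "- y"] by simp
  ultimately show ?R by blast
next
  assume R: ?R
  have 0: "u (g p) = u p" if "g \<in> {tau1 (2 * pi / r), tau (2 * pi) (2 * pi / r)}" for g p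
  proof -
    have "u (x + pi, 2 * pi / r - y) = u (x, y)" for x y
      using R[rule_format, of "x + pi" "- y"] R[rule_format, of x y] by simp
    then show ?thesis
      using that R by (cases p) (auto simp: tau1_def tau_def)
  qed
  show ?L
  proof (intro ballI allI)
    fix g p
    assume "g \<in> klein r"
    then show "u (g p) = u p"
      unfolding klein_def klein_group_def
    proof (induction arbitrary: p rule: generate.induct)
      case one
      show ?case using BijGroup_apply(2)[OF klein_generators_in_BijGroup(1,1)] by simp
    next
      case (incl h)
      then show ?case by (rule 0)
    next
      case (inv h)
      then have "h \<in> carrier (BijGroup UNIV)"
        using klein_generators_in_BijGroup by auto
      then have "h ((inv\<^bsub>BijGroup UNIV\<^esub> h) p) = p"
        by (intro BijGroup_apply(4))
      then show ?case using 0[OF inv, of "(inv\<^bsub>BijGroup UNIV\<^esub> h) p"] by simp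
    next
      case (eng h1 h2)
      have c: "h \<in> carrier (BijGroup UNIV)"
        if "h \<in> generate (BijGroup UNIV) {tau1 (2 * pi / r), tau (2 * pi) (2 * pi / r)}" for h
        using group.generate_in_carrier[OF group_BijGroup _ that] klein_generators_in_BijGroup by blast
      have "u ((h1 \<otimes>\<^bsub>BijGroup UNIV\<^esub> h2) p) = u (h1 (h2 p))"
        by (simp only: BijGroup_apply(1)[OF c c, OF eng.hyps])
      also have "\<dots> = u p"
        using eng.IH by (rule trans)
      finally show ?case .
    qed
  qed
qed

text \<open>The indices \<open>(m, n)\<close> for which \<open>psi m n\<close> is invariant under \<open>klein r\<close>.\<close>

definition J :: "nat \<Rightarrow> (int \<times> int) set" where
  "J r = {(m, n). int r dvd n \<and> (if even m then 0 \<le> n else n < 0)}"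

lemma psi_reflect:
  "psi m n (x + pi, - y) = (if even m \<longleftrightarrow> 0 \<le> n then 1 else - 1) * psi m n (x, y)"
  by (simp add: psi_def trig_add_pi trig_minus)

lemma psi_translate:
  assumes "r \<in> {1, 2}"
  shows "psi m n (x, y + 2 * pi / real r) = (if int r dvd n then 1 else - 1) * psi m n (x, y)"
  using assms by (auto simp: psi_def trig_add_pi)

text \<open>Each \<open>psi m n\<close> is an eigenvector of the glide reflection and of the
  vertical translation, with value \<open>s\<close> equal to 1 or -1. For an invariant combination,
  linear independence gives \<open>c m n * (s - 1) = 0\<close>, so every coefficient with
  \<open>s = - 1\<close> vanishes; what survives are the indices in \<open>J r\<close>.\<close>

lemma eigenspace_klein:
  assumes r: "r \<in> {1, 2}"
  shows "eigenspace (klein r) \<mu> =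
    {u. \<exists>c. u = (\<lambda>p. \<Sum>(m, n)\<in>{(m, n) \<in> J r. of_int (m\<^sup>2 + n\<^sup>2) = \<mu>}. c m n * psi m n p)}"
    (is "_ = ?E")
proof (intro equalityI subsetI)
  let ?F = "{(m::int, n::int). of_int (m\<^sup>2 + n\<^sup>2) = \<mu>}"
  fix u assume u: "u \<in> eigenspace (klein r) \<mu>"
  have inv: "u (x, y + 2 * pi / r) = u (x, y)" "u (x + pi, - y) = u (x, y)" for x y
    using u invariant_klein_iff[of r u] by (auto simp: eigenspace_def)
  have px: "u (x + 2 * pi, y) = u (x, y)" for x y
    using inv(2)[of "x + pi" "- y"] inv(2)[of x y] by (simp add: add.assoc)
  have py: "u (x, y + 2 * pi) = u (x, y)" for x y
    using inv(1)[of x y] inv(1)[of x "y + 2 * pi / r"] r by (auto simp: add.assoc)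
  obtain c where c: "\<And>p. u p = (\<Sum>(m, n)\<in>?F. c m n * psi m n p)"
  proof (rule eigenfunction_expansion)
    show "smooth u" "\<And>p. - laplacian u p = \<mu> * u p"
      using u by (auto simp: eigenspace_def)
  qed (use px py in auto)
  have alg: "a * (s - 1) * b = a * (s * b) - a * b" for a s b :: real
    by (simp add: algebra_simps)
  have z1: "c m n * ((if even m \<longleftrightarrow> 0 \<le> n then 1 else - 1) - 1) = 0" if "(m, n) \<in> ?F" for m n
  proof (rule sum_psi_eq_0_imp[OF finite_sum_squares_eq _ that])
    fix p :: plane
    obtain x y where p: "p = (x, y)" by fastforce
    have "(\<Sum>(m, n)\<in>?F. c m n * ((if even m \<longleftrightarrow> 0 \<le> n then 1 else - 1) - 1) * psi m n (x, y)) =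
      u (x + pi, - y) - u (x, y)"
      unfolding c sum_subtractf[symmetric]
      by (intro sum.cong refl) (simp only: split_paired_all prod.case psi_reflect alg)
    then show "(\<Sum>(m, n)\<in>?F. c m n * ((if even m \<longleftrightarrow> 0 \<le> n then 1 else - 1) - 1) * psi m n p) = 0"
      unfolding p inv by simp
  qed
  have z2: "c m n * ((if int r dvd n then 1 else - 1) - 1) = 0" if "(m, n) \<in> ?F" for m n
  proof (rule sum_psi_eq_0_imp[OF finite_sum_squares_eq _ that])
    fix p :: plane
    obtain x y where p: "p = (x, y)" by fastforce
    have "(\<Sum>(m, n)\<in>?F. c m n * ((if int r dvd n then 1 else - 1) - 1) * psi m n (x, y)) =
      u (x, y + 2 * pi / r) - u (x, y)"
      unfolding c sum_subtractf[symmetric]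
      by (intro sum.cong refl) (simp only: split_paired_all prod.case psi_translate[OF r] alg)
    then show "(\<Sum>(m, n)\<in>?F. c m n * ((if int r dvd n then 1 else - 1) - 1) * psi m n p) = 0"
      unfolding p inv by simp
  qed
  have "u p = (\<Sum>(m, n)\<in>{(m, n) \<in> J r. of_int (m\<^sup>2 + n\<^sup>2) = \<mu>}. c m n * psi m n p)" for p
    unfolding c
  proof (rule sum.mono_neutral_right)
    have c0: "c m n = 0" if "(m, n) \<in> ?F" "(m, n) \<notin> J r" for m n
      using z1[OF that(1)] z2[OF that(1)] that(2) by (auto simp: J_def split: if_splits)
    show "\<forall>i\<in>?F - {(m, n) \<in> J r. of_int (m\<^sup>2 + n\<^sup>2) = \<mu>}. (case i of (m, n) \<Rightarrow> c m n * psi m n p) = 0"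
    proof
      fix i assume i: "i \<in> ?F - {(m, n) \<in> J r. of_int (m\<^sup>2 + n\<^sup>2) = \<mu>}"
      obtain a b where ab: "i = (a, b)" by (cases i)
      have "c a b = 0"
        by (rule c0) (use i ab in auto)
      then show "(case i of (m, n) \<Rightarrow> c m n * psi m n p) = 0"
        by (simp add: ab)
    qed
  qed (auto simp: finite_sum_squares_eq simp del: of_int_add)
  then show "u \<in> ?E" by blast
next
  let ?K = "{(m, n) \<in> J r. of_int (m\<^sup>2 + n\<^sup>2) = \<mu>}"
  fix u assume "u \<in> ?E"
  then obtain c where u: "u = (\<lambda>p. \<Sum>i\<in>?K. c (fst i) (snd i) * psi (fst i) (snd i) p)"
    by (auto simp: case_prod_unfold)
  have s: "smooth u" "laplacian u p = (\<Sum>i\<in>?K. c (fst i) (snd i) * laplacian (psi (fst i) (snd i)) p)" for p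
    unfolding u using smooth_sum[of ?K "\<lambda>i. psi (fst i) (snd i)" "\<lambda>i. c (fst i) (snd i)"] smooth_psi by auto
  moreover have "- laplacian u p = \<mu> * u p" for p
    unfolding s(2) unfolding u sum_distrib_left sum_negf[symmetric]
    by (intro sum.cong refl) (auto simp: laplacian_psi simp del: of_int_add)
  moreover have "u (x, y + 2 * pi / r) = u (x, y)" for x y
    unfolding u by (intro sum.cong refl) (auto simp: psi_translate[OF r] J_def)
  moreover have "u (x + pi, - y) = u (x, y)" for x y
    unfolding u by (intro sum.cong refl) (auto simp: psi_reflect J_def split: if_splits)
  ultimately show "u \<in> eigenspace (klein r) \<mu>"
    unfolding eigenspace_def invariant_klein_iff by auto
qed

lemma multiplicity_klein:
  assumes r: "r \<in> {1, 2}"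
  shows "multiplicity (klein r) \<mu> = card {(m, n) \<in> J r. of_int (m\<^sup>2 + n\<^sup>2) = \<mu>}" (is "_ = card ?K")
proof -
  let ?f = "\<lambda>i. psi (fst i) (snd i)"
  have finK: "finite ?K"
    by (rule finite_subset[OF _ finite_sum_squares_eq[of \<mu>]]) (auto simp del: of_int_add)
  have inj: "inj_on ?f ?K"
  proof (rule inj_onI, rule ccontr)
    fix i j :: "int \<times> int"
    assume eq: "?f i = ?f j" and "i \<noteq> j"
    then have "fourier (?f i) (fst j) (snd j) = 0"
      using fourier_psi_eq_0_iff[of "fst i" "snd i" "fst j" "snd j"] by simp
    moreover have "fourier (?f j) (fst j) (snd j) \<noteq> 0"
      using fourier_psi_eq_0_iff[of "fst j" "snd j" "fst j" "snd j"] by simp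
    ultimately show False
      unfolding eq by contradiction
  qed
  have E: "eigenspace (klein r) \<mu> = {u. \<exists>c. u = (\<lambda>p. \<Sum>i\<in>?K. c i * ?f i p)}"
    unfolding eigenspace_klein[OF r]
  proof (intro equalityI subsetI CollectI; elim CollectE exE)
    fix u and c :: "int \<Rightarrow> int \<Rightarrow> real"
    assume "u = (\<lambda>p. \<Sum>(m, n)\<in>?K. c m n * psi m n p)"
    then have "u = (\<lambda>p. \<Sum>i\<in>?K. (case i of (m, n) \<Rightarrow> c m n) * ?f i p)"
      by (simp add: case_prod_unfold)
    then show "\<exists>c. u = (\<lambda>p. \<Sum>i\<in>?K. c i * ?f i p)" by - (rule exI)
  next
    fix u and c :: "int \<times> int \<Rightarrow> real"
    assume "u = (\<lambda>p. \<Sum>i\<in>?K. c i * ?f i p)"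
    then have "u = (\<lambda>p. \<Sum>(m, n)\<in>?K. (curry c) m n * psi m n p)"
      by (simp add: case_prod_unfold)
    then show "\<exists>c. u = (\<lambda>p. \<Sum>(m, n)\<in>?K. c m n * psi m n p)" by - (rule exI)
  qed
  have psi_mem: "?f ` ?K \<subseteq> eigenspace (klein r) \<mu>"
  proof
    fix u assume "u \<in> ?f ` ?K"
    then obtain j where j: "j \<in> ?K" "u = ?f j" by (rule imageE)
    have "(\<Sum>i\<in>?K. of_bool (i = j) * ?f i p) = ?f j p" for p
    proof -
      have "(\<Sum>i\<in>?K. of_bool (i = j) * ?f i p) = (\<Sum>i\<in>?K. if i = j then ?f j p else 0)"
        by (intro sum.cong refl) simp
      also have "\<dots> = ?f j p"
        using j(1) finK by (simp only: sum.delta if_True)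
      finally show ?thesis .
    qed
    then have "u = (\<lambda>p. \<Sum>i\<in>?K. of_bool (i = j) * ?f i p)"
      by (simp only: j(2))
    then show "u \<in> eigenspace (klein r) \<mu>"
      unfolding E by (intro CollectI exI)
  qed
  \<comment> \<open>Sums in the vector space of functions are evaluated pointwise; this rule passes
    between the two readings.\<close>
  have app: "(\<Sum>x\<in>A. scale_fun (g x) x) p = (\<Sum>x\<in>A. g x * x p)" for A and g :: "(plane \<Rightarrow> real) \<Rightarrow> real" and p
    by (induction A rule: infinite_finite_induct) auto
  have indep: "g w = 0" if z: "(\<Sum>x\<in>?f ` ?K. scale_fun (g x) x) = 0" and w: "w \<in> ?f ` ?K" for g w
  proof -
    obtain m n where mn: "(m, n) \<in> ?K" "w = psi m n" using w by auto
    have "g (psi m n) = 0"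
    proof (rule sum_psi_eq_0_imp[OF finK _ mn(1)])
      fix p
      have "(\<Sum>(k, l)\<in>?K. g (psi k l) * psi k l p) = (\<Sum>x\<in>?f ` ?K. g x * x p)"
        unfolding sum.reindex[OF inj] by (simp add: case_prod_unfold)
      also have "\<dots> = 0"
        unfolding app[symmetric] z by simp
      finally show "(\<Sum>(k, l)\<in>?K. g (psi k l) * psi k l p) = 0" .
    qed
    then show "g w = 0" by (simp only: mn)
  qed
  have emp: "(\<lambda>p. \<Sum>i\<in>{}. c i * ?f i p) = 0" for c
    by (simp add: fun_eq_iff)
  have ins: "(\<lambda>p. \<Sum>i\<in>insert j I. c i * ?f i p) = (\<lambda>p. c j * ?f j p) + (\<lambda>p. \<Sum>i\<in>I. c i * ?f i p)"
    if "finite I" "j \<notin> I" for c j I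
    using that by (simp add: fun_eq_iff)
  interpret V: vector_space "scale_fun :: real \<Rightarrow> (plane \<Rightarrow> real) \<Rightarrow> plane \<Rightarrow> real"
    by (rule vector_space_scale_fun)
  have mem: "(\<lambda>p. \<Sum>i\<in>I. c i * ?f i p) \<in> V.span (?f ` ?K)" if "finite I" "I \<subseteq> ?K" for c I
    using that
  proof (induction I)
    case empty
    show ?case unfolding emp by (rule V.span_zero)
  next
    case (insert i I)
    have "i \<in> ?K" and I: "I \<subseteq> ?K"
      using insert.prems by (simp_all only: insert_subset)
    have "(\<lambda>p. c i * ?f i p) \<in> V.span (?f ` ?K)"
      by (rule V.span_scale[OF V.span_base[OF imageI[OF \<open>i \<in> ?K\<close>]]])
    then show ?case
      unfolding ins[OF insert.hyps(1,2)] by (rule V.span_add[OF _ insert.IH[OF I]])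
  qed
  have "V.dim (eigenspace (klein r) \<mu>) = card ?K"
  proof (rule V.dim_unique[OF psi_mem])
    show "eigenspace (klein r) \<mu> \<subseteq> V.span (?f ` ?K)"
    proof
      fix u assume "u \<in> eigenspace (klein r) \<mu>"
      then obtain c where u: "u = (\<lambda>p. \<Sum>i\<in>?K. c i * ?f i p)"
        unfolding E by blast
      show "u \<in> V.span (?f ` ?K)"
        unfolding u by (rule mem[OF finK subset_refl])
    qed
    show "V.independent (?f ` ?K)"
    proof (rule V.independent_if_scalars_zero)
      show "finite (?f ` ?K)" by (rule finite_imageI[OF finK])
    qed (rule indep)
    show "card (?f ` ?K) = card ?K"
      by (rule card_image[OF inj])
  qed
  then show ?thesis by (simp only: multiplicity_def)
qed

section \<open>The ordered listing of the spectrum\<close>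

text \<open>At the first index \<open>j\<close> of disagreement let \<open>h\<close> be the smaller
  listing. From \<open>j\<close> on, \<open>h'\<close> exceeds the value \<open>h j\<close>, so it
  takes this value only where it agrees with \<open>h\<close>, hence at least once less often than
  \<open>h\<close>; but the multiplicities are equal.\<close>

lemma listing_unique:
  fixes l l' :: "nat \<Rightarrow> real"
  assumes "eigenvalue_listing G l" "eigenvalue_listing G l'"
  shows "l = l'"
proof (rule ccontr)
  assume "l \<noteq> l'"
  then have ex: "\<exists>j. l j \<noteq> l' j" by auto
  define j where "j = (LEAST j. l j \<noteq> l' j)"
  have j: "l j \<noteq> l' j" "\<And>i. i < j \<Longrightarrow> l i = l' i"
    unfolding j_def by (rule LeastI_ex[OF ex]) (drule not_less_Least, simp)
  have no: False if h: "eigenvalue_listing G h" and h': "eigenvalue_listing G h'"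
    and lt: "h j < h' j" and eq: "\<And>i. i < j \<Longrightarrow> h i = h' i" for h h'
  proof -
    have "{i. h' i = h j} \<subseteq> {i. h i = h j} - {j}"
    proof (intro subsetI DiffI CollectI)
      fix i assume i: "i \<in> {i. h' i = h j}"
      have "i < j"
      proof (rule ccontr)
        assume "\<not> i < j"
        then have "h' j \<le> h' i"
          using h' monoD[of h' j i] by (simp add: eigenvalue_listing_def)
        then show False using i lt by simp
      qed
      then show "h i = h j" "i \<notin> {j}" using eq[of i] i by auto
    qed
    moreover have "finite {i. h i = h j}"
      using h by (simp add: eigenvalue_listing_def)
    ultimately have "card {i. h' i = h j} < card {i. h i = h j}"
      by (intro psubset_card_mono) auto
    then show False
      using h h' by (simp add: eigenvalue_listing_def)
  qed
  show False
  proof (cases "l j < l' j")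
    case True
    then show False by (rule no[OF assms _ j(2)])
  next
    case False
    then have "l' j < l j" using j(1) by simp
    then show False by (rule no[OF assms(2,1) _ j(2)[symmetric]])
  qed
qed

text \<open>\<open>L\<close> is the generalised inverse of the counting function \<open>C\<close>:
  \<open>L j \<le> v\<close> holds iff \<open>j < C v\<close>. Monotonicity, the multiplicities and
  both counting bounds follow from this equivalence.\<close>

lemma listing_exists:
  fixes q :: "'i \<Rightarrow> nat"
  assumes fin: "\<And>v. finite {i \<in> I. q i \<le> v}" and inf: "infinite I"
  obtains L :: "nat \<Rightarrow> nat" where "mono L"
    "\<And>v. finite {j. L j = v} \<and> card {j. L j = v} = card {i \<in> I. q i = v}"
    "\<And>j. card {i \<in> I. q i < L j} \<le> j \<and> j < card {i \<in> I. q i \<le> L j}"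
proof -
  define C where "C v = card {i \<in> I. q i \<le> v}" for v
  define L where "L j = (LEAST v. j < C v)" for j
  have ex: "\<exists>v. j < C v" for j
  proof -
    obtain F where F: "finite F" "card F = Suc j" "F \<subseteq> I"
      using infinite_arbitrarily_large[OF inf] by blast
    then have "F \<subseteq> {i \<in> I. q i \<le> Max (q ` F)}" by auto
    then have "card F \<le> C (Max (q ` F))"
      unfolding C_def by (intro card_mono fin)
    then have "j < C (Max (q ` F))" using F by linarith
    then show ?thesis ..
  qed
  have mono: "C v \<le> C w" if "v \<le> w" for v w
    unfolding C_def using that by (intro card_mono fin) auto
  have le: "L j \<le> v \<longleftrightarrow> j < C v" for j v
  proof
    assume "L j \<le> v"
    moreover have "j < C (L j)" unfolding L_def by (rule LeastI_ex[OF ex])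
    ultimately show "j < C v" using mono[of "L j" v] by linarith
  qed (simp add: L_def Least_le)
  have lt: "L j < v \<longleftrightarrow> j < card {i \<in> I. q i < v}" for j v
  proof (cases v)
    case (Suc w)
    then show ?thesis using le[of j w] by (simp add: C_def less_Suc_eq_le)
  qed simp
  show thesis
  proof
    show "mono L"
    proof (rule monoI)
      fix i j :: nat assume "i \<le> j"
      then show "L i \<le> L j" using le[of i "L j"] le[of j "L j"] by simp
    qed
    have "{j. L j = v} = {card {i \<in> I. q i < v}..<C v}" for v
    proof -
      have "L j = v \<longleftrightarrow> j < C v \<and> \<not> j < card {i \<in> I. q i < v}" for j
        using le[of j v] lt[of j v] by linarith
      then have "{j. L j = v} = {j. j < C v \<and> \<not> j < card {i \<in> I. q i < v}}"
        by (simp only:)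
      also have "\<dots> = {card {i \<in> I. q i < v}..<C v}"
        by (simp only: set_eq_iff mem_Collect_eq atLeastLessThan_iff not_less conj_commute simp_thms)
      finally show ?thesis .
    qed
    moreover have "C v - card {i \<in> I. q i < v} = card {i \<in> I. q i = v}" for v
    proof -
      have "{i \<in> I. q i \<le> v} = {i \<in> I. q i < v} \<union> {i \<in> I. q i = v}" by auto
      moreover have "finite {i \<in> I. q i < v}" "finite {i \<in> I. q i = v}"
        by (auto intro: finite_subset[OF _ fin[of v]])
      ultimately have "C v = card {i \<in> I. q i < v} + card {i \<in> I. q i = v}"
        unfolding C_def by (auto intro!: card_Un_disjoint)
      then show ?thesis by simp
    qed
    ultimately show "finite {j. L j = v} \<and> card {j. L j = v} = card {i \<in> I. q i = v}" for v
      by simp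
    show "card {i \<in> I. q i < L j} \<le> j \<and> j < card {i \<in> I. q i \<le> L j}" for j
      using lt[of j "L j"] le[of j "L j"] by (simp add: C_def)
  qed
qed

lemma finite_J_le: "finite {(m, n) \<in> J r. m\<^sup>2 + n\<^sup>2 \<le> b}"
  by (rule finite_subset[OF _ finite_sum_squares_le[of b]]) auto

text \<open>With labels starting at 1, at most \<open>k - 1\<close> eigenvalues lie below the one
  labelled \<open>k\<close>, and at least \<open>k\<close> do not exceed it. The ordering of the
  spectrum enters later only through these two counts.\<close>

lemma eigenvalue_klein:
  assumes r: "r \<in> {1, 2}"
  obtains L :: nat where "eigenvalue (klein r) k = real L"
    "card {(m, n) \<in> J r. m\<^sup>2 + n\<^sup>2 < int L} \<le> k - 1"
    "k - 1 < card {(m, n) \<in> J r. m\<^sup>2 + n\<^sup>2 \<le> int L}"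
proof -
  define q where "q = (\<lambda>(m::int, n::int). nat (m\<^sup>2 + n\<^sup>2))"
  have q: "int (q (m, n)) = m\<^sup>2 + n\<^sup>2" for m n by (simp add: q_def)
  have q': "{i \<in> J r. R (int (q i))} = {(m, n) \<in> J r. R (m\<^sup>2 + n\<^sup>2)}" for R
    by (auto simp: q)
  have "infinite (J r)"
  proof
    assume "finite (J r)"
    moreover have "(\<lambda>n. (0, int r * int n)) ` UNIV \<subseteq> J r" by (auto simp: J_def)
    moreover have "inj (\<lambda>n. (0::int, int r * int n))" using r by (auto simp: inj_def)
    ultimately show False
      using finite_subset finite_imageD infinite_UNIV_nat by blast
  qed
  moreover have "finite {i \<in> J r. q i \<le> v}" for v
    using finite_J_le[of r "int v"] q'[of "\<lambda>t. t \<le> int v"] by simp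
  ultimately obtain L where L: "mono L"
    "\<And>v. finite {j. L j = v} \<and> card {j. L j = v} = card {i \<in> J r. q i = v}"
    "\<And>j. card {i \<in> J r. q i < L j} \<le> j \<and> j < card {i \<in> J r. q i \<le> L j}"
    using listing_exists[of "J r" q] by blast
  have "eigenvalue_listing (klein r) (\<lambda>j. real (L j))"
    unfolding eigenvalue_listing_def
  proof (intro conjI allI)
    show "mono (\<lambda>j. real (L j))"
      using L(1) by (auto simp: mono_def)
    fix \<mu> :: real
    have *: "finite {j. real (L j) = \<mu>} \<and> card {j. real (L j) = \<mu>} = card {(m, n) \<in> J r. real_of_int (m\<^sup>2 + n\<^sup>2) = \<mu>}"
    proof (cases "\<mu> \<in> \<nat>")
      case True
      then obtain v where v: "\<mu> = real v" by (auto elim: Nats_cases)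
      have "real_of_int (m\<^sup>2 + n\<^sup>2) = real v \<longleftrightarrow> q (m, n) = v" for m n
        unfolding q[symmetric] of_int_of_nat_eq of_nat_eq_iff ..
      then have "{(m, n) \<in> J r. real_of_int (m\<^sup>2 + n\<^sup>2) = \<mu>} = {i \<in> J r. q i = v}"
        unfolding v by auto
      then show ?thesis using L(2)[of v] by (simp add: v)
    next
      case False
      have "real_of_int (m\<^sup>2 + n\<^sup>2) \<in> \<nat>" for m n :: int
        unfolding q[symmetric] by simp
      then have "{(m, n) \<in> J r. real_of_int (m\<^sup>2 + n\<^sup>2) = \<mu>} = {}"
        using False by blast
      moreover have "{j. real (L j) = \<mu>} = {}" using False by auto
      ultimately show ?thesis by (simp only: finite.emptyI card.empty simp_thms)
    qed
    show "finite {j. real (L j) = \<mu>}" using * by blast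
    show "card {j. real (L j) = \<mu>} = multiplicity (klein r) \<mu>"
      using * multiplicity_klein[OF r] by simp
  qed
  then have "(THE l. eigenvalue_listing (klein r) l) = (\<lambda>j. real (L j))"
    using listing_unique by blast
  then have "eigenvalue (klein r) k = real (L (k - 1))"
    by (simp add: eigenvalue_def)
  moreover have "card {(m, n) \<in> J r. m\<^sup>2 + n\<^sup>2 < int (L (k - 1))} \<le> k - 1"
    "k - 1 < card {(m, n) \<in> J r. m\<^sup>2 + n\<^sup>2 \<le> int (L (k - 1))}"
    using L(3)[of "k - 1"] q'[of "\<lambda>t. t < int (L (k - 1))"] q'[of "\<lambda>t. t \<le> int (L (k - 1))"] by simp_all
  ultimately show thesis by (rule that)
qed

section \<open>Nodal domains in rectangles\<close>

lemma second_derivative_nonpos_at_local_max: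
  fixes f :: "real \<Rightarrow> real"
  assumes f: "\<And>t. (f has_real_derivative f' t) (at t)" and f': "(f' has_real_derivative D) (at x)"
    and e: "e > 0" and max: "\<And>t. \<bar>t - x\<bar> < e \<Longrightarrow> f t \<le> f x"
  shows "D \<le> 0"
proof (rule ccontr)
  assume "\<not> D \<le> 0"
  then have "D > 0" by simp
  have "f' x = 0"
    by (rule DERIV_local_max[OF f e]) (use max in \<open>auto simp: abs_minus_commute\<close>)
  obtain d where d: "d > 0" "\<And>h. h > 0 \<Longrightarrow> h < d \<Longrightarrow> f' x < f' (x + h)"
    using DERIV_pos_inc_right[OF f' \<open>D > 0\<close>] by blast
  define h where "h = min d e / 2"
  have h: "0 < h" "h < d" "h < e" using d e by (auto simp: h_def min_def)
  obtain z where z: "x < z" "z < x + h" "f (x + h) - f x = h * f' z"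
    using MVT2[of x "x + h" f f'] f h by auto
  have "f' x < f' z"
    using d(2)[of "z - x"] z h by simp
  then have "h * f' z > 0"
    using h \<open>f' x = 0\<close> by simp
  moreover have "f (x + h) \<le> f x"
    by (rule max) (use h in simp)
  ultimately show False using z by simp
qed

lemma closure_component_subset:
  assumes "z \<in> closure (connected_component_set S p)" "z \<in> S"
  shows "z \<in> connected_component_set S p"
proof -
  obtain T where T: "closed T" "connected_component_set S p = S \<inter> T"
    using closedin_connected_component[of S p] by (auto simp: closedin_closed)
  have "connected_component_set S p \<subseteq> T" using T(2) by blast
  then have "closure (connected_component_set S p) \<subseteq> T"
    using T(1) by (rule closure_minimal)
  then show ?thesis using assms T(2) by blast
qed

text \<open>
  Barta's argument: at a maximum of \<open>\<bar>u\<bar>\<close> divided by the first Dirichlet eigenfunction of a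
  slightly larger rectangle, the second derivatives have a sign that bounds \<open>\<lambda>\<close> from below.
\<close>

lemma nodal_domain_in_rectangle:
  fixes u ux uxx uy uyy :: "real \<times> real \<Rightarrow> real"
  assumes cont: "continuous_on UNIV u"
    and dx: "\<And>x y. ((\<lambda>x. u (x, y)) has_real_derivative ux (x, y)) (at x)"
      "\<And>x y. ((\<lambda>x. ux (x, y)) has_real_derivative uxx (x, y)) (at x)"
    and dy: "\<And>x y. ((\<lambda>y. u (x, y)) has_real_derivative uy (x, y)) (at y)"
      "\<And>x y. ((\<lambda>y. uy (x, y)) has_real_derivative uyy (x, y)) (at y)"
    and eig: "\<And>p. uxx p + uyy p = - lam * u p"
    and p0: "u p0 \<noteq> 0"
    and sub: "connected_component_set {p. u p \<noteq> 0} p0 \<subseteq> {a<..<a + W} \<times> {b<..<b + H}"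
    and WH: "W > 0" "H > 0"
  shows "pi\<^sup>2 / W\<^sup>2 + pi\<^sup>2 / H\<^sup>2 \<le> lam"
proof (rule ccontr)
  assume less: "\<not> pi\<^sup>2 / W\<^sup>2 + pi\<^sup>2 / H\<^sup>2 \<le> lam"
  define Z where "Z = {p. u p \<noteq> 0}"
  define C where "C = connected_component_set Z p0"
  \<comment> \<open>The closure of the domain may touch the boundary of the rectangle, where the
    Dirichlet eigenfunction vanishes. Enlarging the rectangle by \<open>e\<close> on each side keeps
    \<open>v\<close> positive on the closure, and the strict inequality survives for small
    \<open>e\<close>.\<close>
  have "((\<lambda>e. pi\<^sup>2 / (W + 2 * e)\<^sup>2 + pi\<^sup>2 / (H + 2 * e)\<^sup>2) \<longlongrightarrow> pi\<^sup>2 / (W + 2 * 0)\<^sup>2 + pi\<^sup>2 / (H + 2 * 0)\<^sup>2) (at_right 0)"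
    using WH by (intro tendsto_intros) auto
  then have "\<forall>\<^sub>F e in at_right 0. lam < pi\<^sup>2 / (W + 2 * e)\<^sup>2 + pi\<^sup>2 / (H + 2 * e)\<^sup>2"
    using less by (intro order_tendstoD(1)) auto
  moreover have "\<forall>\<^sub>F e::real in at_right 0. e > 0"
    by (rule eventually_at_right_less)
  ultimately have "\<forall>\<^sub>F e in at_right 0. lam < pi\<^sup>2 / (W + 2 * e)\<^sup>2 + pi\<^sup>2 / (H + 2 * e)\<^sup>2 \<and> e > 0"
    by (rule eventually_conj)
  then obtain e where e: "lam < pi\<^sup>2 / (W + 2 * e)\<^sup>2 + pi\<^sup>2 / (H + 2 * e)\<^sup>2" "e > 0"
    using eventually_happens' trivial_limit_at_right_real by blast
  define k1 k2 where "k1 = pi / (W + 2 * e)" and "k2 = pi / (H + 2 * e)"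
  define s1 s2 where "s1 x = sin (k1 * (x - a + e))" and "s2 y = sin (k2 * (y - b + e))" for x y
  have kpos: "k1 > 0" "k2 > 0" using WH e by (auto simp: k1_def k2_def)
  have k12: "lam < k1\<^sup>2 + k2\<^sup>2" using e by (simp add: k1_def k2_def power_divide)
  have s1pos: "s1 x > 0" if "a \<le> x" "x \<le> a + W" for x
  proof -
    have "k1 * (x - a + e) < k1 * (W + 2 * e)"
      using that kpos e by (intro mult_strict_left_mono) auto
    then have "k1 * (x - a + e) < pi" using WH e by (simp add: k1_def)
    then show ?thesis unfolding s1_def using that kpos e by (intro sin_gt_zero) auto
  qed
  have s2pos: "s2 y > 0" if "b \<le> y" "y \<le> b + H" for y
  proof -
    have "k2 * (y - b + e) < k2 * (H + 2 * e)"
      using that kpos e by (intro mult_strict_left_mono) auto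
    then have "k2 * (y - b + e) < pi" using WH e by (simp add: k2_def)
    then show ?thesis unfolding s2_def using that kpos e by (intro sin_gt_zero) auto
  qed
  define v where "v p = s1 (fst p) * s2 (snd p)" for p
  have closure_sub: "closure C \<subseteq> cbox (a, b) (a + W, b + H)"
  proof (rule closure_minimal)
    show "C \<subseteq> cbox (a, b) (a + W, b + H)"
      using sub by (auto simp: C_def Z_def cbox_Pair_eq)
  qed (rule closed_cbox)
  have compact: "compact (closure C)"
    using bounded_subset[OF bounded_cbox closure_sub] by (simp add: compact_eq_bounded_closed)
  have vpos: "v p > 0" if "p \<in> closure C" for p
  proof -
    have "p \<in> cbox (a, b) (a + W, b + H)" using that closure_sub by blast
    then have "a \<le> fst p" "fst p \<le> a + W" "b \<le> snd p" "snd p \<le> b + H"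
      by (cases p; auto simp: cbox_Pair_eq)+
    then show ?thesis unfolding v_def by (intro mult_pos_pos s1pos s2pos)
  qed
  have "p0 \<in> C"
    using p0 by (simp add: C_def Z_def)
  then have p0C: "p0 \<in> closure C" using closure_subset by blast
  have cv: "continuous_on (closure C) v"
    unfolding v_def s1_def s2_def by (intro continuous_intros)
  have cq: "continuous_on (closure C) (\<lambda>p. \<bar>u p\<bar> / v p)"
    using vpos by (intro continuous_intros cv continuous_on_subset[OF cont]) (auto dest!: vpos)
  have "\<exists>z\<in>closure C. \<forall>p\<in>closure C. \<bar>u p\<bar> / v p \<le> \<bar>u z\<bar> / v z"
    by (rule continuous_attains_sup[OF compact _ cq]) (metis p0C empty_iff)
  then obtain z where z: "z \<in> closure C" "\<forall>p\<in>closure C. \<bar>u p\<bar> / v p \<le> \<bar>u z\<bar> / v z"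
    by (elim bexE)
  note z = z(1) bspec[OF z(2)]
  define Q where "Q = \<bar>u z\<bar> / v z"
  have "\<bar>u p0\<bar> / v p0 > 0" using p0 vpos[OF p0C] by simp
  then have "Q > 0" using z(2)[OF p0C] by (simp add: Q_def)
  then have uz: "u z \<noteq> 0" by (auto simp: Q_def)
  \<comment> \<open>As \<open>u z \<noteq> 0\<close>, the maximum point is not on the nodal set,
    hence lies in the open domain itself. There \<open>sgn (u z) * u - Q * v\<close> has a local
    maximum with value 0, to which the second derivative test applies in each variable.\<close>
  have "z \<in> C"
    unfolding C_def by (rule closure_component_subset) (use z(1) uz in \<open>auto simp: C_def Z_def\<close>)
  have "open Z"
    unfolding Z_def by (intro open_Collect_neq cont continuous_intros)
  then have "open C" unfolding C_def by (rule open_connected_component)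
  then obtain d where d: "d > 0" "ball z d \<subseteq> C"
    using \<open>z \<in> C\<close> open_contains_ball by blast
  have bound: "sgn (u z) * u p \<le> Q * v p" if "dist z p < d" for p
  proof -
    have "p \<in> closure C"
      by (rule subsetD[OF closure_subset subsetD[OF d(2)]]) (use that in simp)
    then have "\<bar>u p\<bar> \<le> Q * v p"
      using z(2)[of p] vpos[of p] by (simp add: Q_def divide_le_eq)
    moreover have "sgn (u z) * u p \<le> \<bar>u p\<bar>" by (auto simp: sgn_if)
    ultimately show ?thesis by linarith
  qed
  have eq: "sgn (u z) * u z = Q * v z"
    using vpos[OF z(1)] by (simp add: Q_def mult_sgn_abs abs_sgn_eq_1 mult.commute[of "sgn _"] abs_sgn)
  obtain x0 y0 where z0: "z = (x0, y0)" by fastforce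
  have d1: "((\<lambda>x. sgn (u z) * u (x, y0) - Q * (s1 x * s2 y0)) has_real_derivative
      sgn (u z) * ux (x, y0) - Q * (k1 * cos (k1 * (x - a + e)) * s2 y0)) (at x)" for x
    unfolding s1_def by (rule derivative_eq_intros dx refl)+ (simp add: mult_ac)
  have d2: "((\<lambda>x. sgn (u z) * ux (x, y0) - Q * (k1 * cos (k1 * (x - a + e)) * s2 y0)) has_real_derivative
      sgn (u z) * uxx (x0, y0) + Q * (k1\<^sup>2 * s1 x0 * s2 y0)) (at x0)"
    unfolding s1_def by (rule derivative_eq_intros dx refl)+ (simp add: power2_eq_square mult_ac)
  have "sgn (u z) * uxx (x0, y0) + Q * (k1\<^sup>2 * s1 x0 * s2 y0) \<le> 0"
  proof (rule second_derivative_nonpos_at_local_max[OF d1 d2 d(1)])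
    fix t assume "\<bar>t - x0\<bar> < d"
    then have "dist z (t, y0) < d" by (simp add: z0 dist_Pair_Pair dist_real_def abs_minus_commute)
    from bound[OF this] show "sgn (u z) * u (t, y0) - Q * (s1 t * s2 y0) \<le> sgn (u z) * u (x0, y0) - Q * (s1 x0 * s2 y0)"
      using eq by (simp add: v_def z0)
  qed
  moreover have d3: "((\<lambda>y. sgn (u z) * u (x0, y) - Q * (s1 x0 * s2 y)) has_real_derivative
      sgn (u z) * uy (x0, y) - Q * (s1 x0 * (k2 * cos (k2 * (y - b + e))))) (at y)" for y
    unfolding s2_def by (rule derivative_eq_intros dy refl)+ (simp add: mult_ac)
  have d4: "((\<lambda>y. sgn (u z) * uy (x0, y) - Q * (s1 x0 * (k2 * cos (k2 * (y - b + e))))) has_real_derivative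
      sgn (u z) * uyy (x0, y0) + Q * (k2\<^sup>2 * s1 x0 * s2 y0)) (at y0)"
    unfolding s2_def by (rule derivative_eq_intros dy refl)+ (simp add: power2_eq_square mult_ac)
  have "sgn (u z) * uyy (x0, y0) + Q * (k2\<^sup>2 * s1 x0 * s2 y0) \<le> 0"
  proof (rule second_derivative_nonpos_at_local_max[OF d3 d4 d(1)])
    fix t assume "\<bar>t - y0\<bar> < d"
    then have "dist z (x0, t) < d" by (simp add: z0 dist_Pair_Pair dist_real_def abs_minus_commute)
    from bound[OF this] show "sgn (u z) * u (x0, t) - Q * (s1 x0 * s2 t) \<le> sgn (u z) * u (x0, y0) - Q * (s1 x0 * s2 y0)"
      using eq by (simp add: v_def z0)
  qed
  ultimately have "sgn (u z) * (uxx z + uyy z) + (k1\<^sup>2 + k2\<^sup>2) * (Q * v z) \<le> 0"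
    by (simp add: z0 v_def algebra_simps)
  then have "(k1\<^sup>2 + k2\<^sup>2 - lam) * (Q * v z) \<le> 0"
    unfolding eig eq[symmetric] by (simp add: algebra_simps)
  moreover have "0 < (k1\<^sup>2 + k2\<^sup>2 - lam) * (Q * v z)"
    using k12 \<open>Q > 0\<close> vpos[OF z(1)] by (intro mult_pos_pos) auto
  ultimately show False by linarith
qed

text \<open>The scale-invariant quantity \<open>(W + H)^2 * (1 / W^2 + 1 / H^2)\<close> is at least
  8, with equality for squares; this is the origin of the constant sqrt 8. The parameter
  \<open>k\<close> stands for any number below \<open>sqrt 8 * pi / sqrt lam\<close>, written
  without roots.\<close>

lemma sum_ge_of_inverse_squares:
  fixes W H lam k :: real
  assumes "W > 0" "H > 0" "pi\<^sup>2 / W\<^sup>2 + pi\<^sup>2 / H\<^sup>2 \<le> lam" "k\<^sup>2 * lam < 8 * pi\<^sup>2"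
  shows "k < W + H"
proof (rule ccontr)
  assume "\<not> k < W + H"
  then have k: "(W + H)\<^sup>2 \<le> k\<^sup>2" using assms(1,2) by (intro power_mono) auto
  have "8 \<le> (W + H)\<^sup>2 * (1 / W\<^sup>2 + 1 / H\<^sup>2)"
  proof -
    \<comment> \<open>This product is the factorisation of
      \<open>(W + H)^2 * (W^2 + H^2) - 8 * W^2 * H^2\<close>.\<close>
    have "0 \<le> (W - H)\<^sup>2 * (W\<^sup>2 + H\<^sup>2 + 4 * W * H)"
      using assms(1,2) by (intro mult_nonneg_nonneg add_nonneg_nonneg) auto
    then have "8 * (W\<^sup>2 * H\<^sup>2) \<le> (W + H)\<^sup>2 * (H\<^sup>2 + W\<^sup>2)"
      by (simp add: power2_eq_square algebra_simps)
    moreover have "(W + H)\<^sup>2 * (1 / W\<^sup>2 + 1 / H\<^sup>2) = (W + H)\<^sup>2 * (H\<^sup>2 + W\<^sup>2) / (W\<^sup>2 * H\<^sup>2)"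
      using assms(1,2) by (simp add: field_simps)
    moreover have "0 < W\<^sup>2 * H\<^sup>2" using assms(1,2) by simp
    ultimately show ?thesis by (simp add: pos_le_divide_eq)
  qed
  then have "8 * pi\<^sup>2 \<le> (W + H)\<^sup>2 * (1 / W\<^sup>2 + 1 / H\<^sup>2) * pi\<^sup>2"
    by (intro mult_right_mono) auto
  also have "\<dots> = (W + H)\<^sup>2 * (pi\<^sup>2 / W\<^sup>2 + pi\<^sup>2 / H\<^sup>2)" by (simp add: field_simps)
  also have "\<dots> \<le> k\<^sup>2 * lam"
    using k assms by (intro mult_mono) auto
  finally show False using assms(4) by simp
qed

text \<open>Meant for the projections of a nodal domain: either the projection covers a whole circle
  of length \<open>L\<close>, or it is an interval short enough to be embedded in that
  circle.\<close>

lemma connected_open_real_cases: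
  fixes A :: "real set"
  assumes "open A" "connected A" "A \<noteq> {}" and L: "L > 0"
  obtains (long) s where "{s<..<s + L} \<subseteq> A"
  | (short) s d where "A = {s<..<s + d}" "0 < d" "d \<le> L"
proof (cases "\<exists>s\<in>A. \<exists>t\<in>A. t - s \<ge> L")
  case True
  then obtain s t where "s \<in> A" "t \<in> A" "t - s \<ge> L" by blast
  then have "{s<..<s + L} \<subseteq> A"
    using connected_contains_Icc[OF assms(2), of s t] by auto
  then show thesis by (rule long)
next
  case False
  then have lt: "t - s < L" if "s \<in> A" "t \<in> A" for s t using that by force
  obtain a where a: "a \<in> A" using assms(3) by blast
  have bd: "bdd_above A" "bdd_below A"
    using lt[OF a] lt[OF _ a] by (auto intro!: bdd_aboveI[of _ "a + L"] bdd_belowI[of _ "a - L"] simp: less_imp_le field_simps)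
  have gt: "Inf A < x \<and> x < Sup A" if x: "x \<in> A" for x
  proof -
    obtain e where e: "e > 0" "ball x e \<subseteq> A"
      using assms(1) x open_contains_ball by blast
    have "x - e / 2 \<in> A" "x + e / 2 \<in> A"
      using e by (auto simp: dist_real_def subset_iff)
    then have "Inf A \<le> x - e / 2" "x + e / 2 \<le> Sup A"
      using bd by (auto intro: cInf_lower cSup_upper)
    then show ?thesis using e(1) by auto
  qed
  have "A = {Inf A<..<Sup A}"
  proof (intro equalityI subsetI)
    fix x assume "x \<in> {Inf A<..<Sup A}"
    then obtain s t where "s \<in> A" "s < x" "t \<in> A" "x < t"
      using cInf_lessD[OF assms(3), of x] less_cSupD[OF assms(3), of x] by auto
    then show "x \<in> A"
      using connected_contains_Icc[OF assms(2), of s t] by auto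
  qed (use gt in auto)
  moreover have "Sup A - Inf A \<le> L"
  proof -
    have "Sup A \<le> Inf A + L"
    proof (rule cSup_least[OF assms(3)])
      fix x assume x: "x \<in> A"
      have "x - L \<le> Inf A"
        by (rule cInf_greatest[OF assms(3)]) (use lt[OF _ x] in force)
      then show "x \<le> Inf A + L" by simp
    qed
    then show ?thesis by simp
  qed
  moreover have "0 < Sup A - Inf A" using gt[OF a] by simp
  ultimately show thesis using short[of "Inf A" "Sup A - Inf A"] by simp
qed

text \<open>An open interval of length at most \<open>L\<close> injects into the circle of length
  \<open>L\<close>, so its image has measure \<open>d\<close>. If the image crosses the base point,
  it splits into the end piece \<open>B\<close> and the initial piece \<open>B'\<close>.\<close>

lemma measure_periodized_interval:
  fixes A :: "real set"
  assumes "open A" "{s<..<s + d} \<subseteq> A" "0 < d" "d \<le> L"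
  defines "S \<equiv> {t \<in> {0..<L}. \<exists>j::int. t + of_int j * L \<in> A}"
  shows "S \<in> sets lborel" "d \<le> measure lborel S"
proof -
  have L: "L > 0" using assms by simp
  have "open {t. t + of_int j * L \<in> A}" for j :: int
  proof -
    have "continuous_on UNIV (\<lambda>t. t + of_int j * L)" by (intro continuous_intros)
    from open_vimage[OF assms(1) this] show ?thesis by (simp add: vimage_def)
  qed
  then have "open (\<Union>j::int. {t. t + of_int j * L \<in> A})" by blast
  moreover have "S = {0..<L} \<inter> (\<Union>j::int. {t. t + of_int j * L \<in> A})"
    by (auto simp: S_def)
  ultimately show S: "S \<in> sets lborel" by simp
  have "emeasure lborel S \<le> emeasure lborel {0..<L}"
    by (rule emeasure_mono) (auto simp: S_def)
  also have "\<dots> < \<infinity>"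
    using L by simp
  finally have fin: "emeasure lborel S < \<infinity>" .
  obtain j :: int where j: "s + of_int j * L \<in> {0..<L}"
    using obtain_period_representative[OF L] .
  define s' where "s' = s + of_int j * L"
  have s': "0 \<le> s'" "s' < L" using j by (auto simp: s'_def)
  have in1: "t \<in> S" if "t \<in> {0..<L}" "s' < t" "t < s' + d" for t
  proof -
    have "t + of_int (- j) * L \<in> A" using that assms(2) by (auto simp: s'_def)
    then have "\<exists>j::int. t + of_int j * L \<in> A" by - (rule exI)
    then show ?thesis using that(1) by (simp add: S_def)
  qed
  have in2: "t \<in> S" if "t \<in> {0..<L}" "s' < t + L" "t + L < s' + d" for t
  proof -
    have "t + of_int (1 - j) * L = t + L - of_int j * L" by (simp add: algebra_simps)
    then have "t + of_int (1 - j) * L \<in> A" using that assms(2) by (auto simp: s'_def)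
    then have "\<exists>j::int. t + of_int j * L \<in> A" by - (rule exI)
    then show ?thesis using that(1) by (simp add: S_def)
  qed
  define B where "B = {s'<..<min L (s' + d)}"
  define B' where "B' = {0..<max 0 (s' + d - L)}"
  have "B \<union> B' \<subseteq> S"
    using in1 in2 s' assms(3,4) by (auto simp: B_def B'_def)
  moreover have "measure lborel (B \<union> B') = measure lborel B + measure lborel B'"
  proof (rule measure_Union)
    show "B \<inter> B' = {}" using assms(4) by (auto simp: B_def B'_def)
    show "emeasure lborel B \<noteq> \<infinity>" "emeasure lborel B' \<noteq> \<infinity>"
      using s' assms(3,4) by (auto simp: B_def B'_def)
  qed (auto simp: B_def B'_def)
  moreover have "measure lborel B + measure lborel B' = d"
    using s' assms(3,4) by (auto simp: B_def B'_def min_def max_def)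
  moreover have "S \<in> fmeasurable lborel" using S fin by (auto simp: fmeasurable_def)
  ultimately show "d \<le> measure lborel S"
    using measure_mono_fmeasurable[of "B \<union> B'" S lborel] by (auto simp: B_def B'_def)
qed

text \<open>Between cyclically consecutive points of \<open>X\<close> there is a zero, and these zeros are distinct.\<close>

lemma card_le_card_zeros_cyclic:
  fixes h :: "real \<Rightarrow> real"
  assumes per: "\<And>x. h (x + L) = h x"
    and X: "finite X" "X \<subseteq> {0..<L}" "card X \<ge> 2"
    and inner: "\<And>x y. x \<in> X \<Longrightarrow> y \<in> X \<Longrightarrow> x < y \<Longrightarrow> \<exists>z. x < z \<and> z < y \<and> h z = 0"
    and outer: "\<And>x y. x \<in> X \<Longrightarrow> y \<in> X \<Longrightarrow> x < y \<Longrightarrow> \<exists>z. y < z \<and> z < x + L \<and> h z = 0"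
  obtains Y where "Y \<subseteq> {0..<L}" "card Y = card X" "finite Y" "\<And>z. z \<in> Y \<Longrightarrow> h z = 0"
proof -
  define mx mn where "mx = Max X" and "mn = Min X"
  have "X \<noteq> {}" using X(3) by auto
  then have mX: "mx \<in> X" "mn \<in> X" "\<And>x. x \<in> X \<Longrightarrow> x \<le> mx" "\<And>x. x \<in> X \<Longrightarrow> mn \<le> x"
    using X(1) by (auto simp: mx_def mn_def)
  have "mn < mx"
  proof (rule ccontr)
    assume "\<not> mn < mx"
    then have "X \<subseteq> {mx}" using mX by fastforce
    then have "card X \<le> card {mx}" by (intro card_mono) auto
    then show False using X(3) by simp
  qed
  have main: "\<exists>z. 0 \<le> z \<and> z < L \<and> h z = 0 \<and>
      (if x = mx then z < mn \<or> mx < z else x < z \<and> (\<forall>y\<in>X. x < y \<longrightarrow> z < y))" if x: "x \<in> X" for x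
  proof (cases "x = mx")
    case True
    \<comment> \<open>The largest point takes its zero from the arc through the base point, moved
      back by \<open>L\<close> if necessary; this zero lies outside the interval from
      \<open>mn\<close> to \<open>mx\<close> and so differs from all others.\<close>
    obtain z where z: "mx < z" "z < mn + L" "h z = 0"
      using outer[OF mX(2,1) \<open>mn < mx\<close>] by blast
    have "0 \<le> mn" "mn < L" "0 \<le> mx" "mx < L" using X(2) mX(1,2) by auto
    then show ?thesis
      using True z per[of "z - L"] by (cases "z < L") (auto intro: exI[of _ z] exI[of _ "z - L"])
  next
    case False
    then have "x < mx" using mX(3)[OF x] by simp
    define y where "y = Min {y \<in> X. x < y}"
    have "{y \<in> X. x < y} \<noteq> {}" using \<open>x < mx\<close> mX(1) by blast
    then have "y \<in> {y \<in> X. x < y}" unfolding y_def using X(1) by (intro Min_in) auto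
    then have y: "y \<in> X" "x < y" by auto
    have ymin: "y \<le> w" if "w \<in> X" "x < w" for w
      unfolding y_def using X(1) that by (intro Min_le) auto
    obtain z where z: "x < z" "z < y" "h z = 0" using inner[OF x y] by blast
    have "0 \<le> x" "y < L" using X(2) x y by auto
    then have "0 \<le> z \<and> z < L \<and> h z = 0 \<and> x < z \<and> (\<forall>w\<in>X. x < w \<longrightarrow> z < w)"
      using z ymin by force
    then show ?thesis using False by auto
  qed
  define P where "P x z \<longleftrightarrow> 0 \<le> z \<and> z < L \<and> h z = 0 \<and>
      (if x = mx then z < mn \<or> mx < z else x < z \<and> (\<forall>y\<in>X. x < y \<longrightarrow> z < y))" for x z
  obtain f where f: "\<And>x. x \<in> X \<Longrightarrow> P x (f x)"
    using main unfolding P_def[symmetric] by metis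
  have ne: "f x \<noteq> f y" if xy: "x \<in> X" "y \<in> X" "x < y" for x y
  proof (cases "y = mx")
    case True
    have "x \<noteq> mx" using xy True by simp
    then have "x < f x" "f x < mx"
      using f[OF xy(1)] xy True by (auto simp: P_def)
    moreover have "mn \<le> x" using mX xy by simp
    moreover have "f y < mn \<or> mx < f y" using f[OF xy(2)] True by (simp add: P_def)
    ultimately show ?thesis by auto
  next
    case False
    have "x \<noteq> mx" using xy mX(3)[OF xy(2)] by simp
    then have "f x < y" using f[OF xy(1)] xy by (auto simp: P_def)
    moreover have "y < f y" using f[OF xy(2)] False by (simp add: P_def)
    ultimately show ?thesis by simp
  qed
  have "inj_on f X"
  proof (rule inj_onI, rule ccontr)
    fix x y assume xy: "x \<in> X" "y \<in> X" "f x = f y" "x \<noteq> y"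
    then show False using ne[of x y] ne[of y x] by (cases "x < y") auto
  qed
  show thesis
  proof (rule that)
    show "card (f ` X) = card X" using \<open>inj_on f X\<close> by (rule card_image)
    show "f ` X \<subseteq> {0..<L}" "\<And>z. z \<in> f ` X \<Longrightarrow> h z = 0" using f by (auto simp: P_def)
    show "finite (f ` X)" using X(1) by simp
  qed
qed

section \<open>The number of nodal domains\<close>

definition nodal_domain_at :: "(plane \<Rightarrow> plane) set \<Rightarrow> (plane \<Rightarrow> real) \<Rightarrow> plane \<Rightarrow> plane set set" where
  "nodal_domain_at G u p =
     connected_component_of_set (subtopology (quotient_plane G) (orbit_of G ` {p. u p \<noteq> 0})) (orbit_of G p)"

lemma nodal_domains_eq: "nodal_domains G u = nodal_domain_at G u ` {p. u p \<noteq> 0}"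
proof -
  have "topspace (subtopology (quotient_plane G) (orbit_of G ` {p. u p \<noteq> 0})) = orbit_of G ` {p. u p \<noteq> 0}"
    by (auto simp: topspace_quotient_plane)
  then show ?thesis
    by (simp add: nodal_domains_def connected_components_of_def nodal_domain_at_def image_image)
qed

lemma nodal_domain_at_orbit:
  "orbit_of G p = orbit_of G q \<Longrightarrow> nodal_domain_at G u p = nodal_domain_at G u q"
  by (simp add: nodal_domain_at_def)

lemma nodal_domain_at_component:
  assumes "connected_component {p. u p \<noteq> 0} p q"
  shows "nodal_domain_at G u p = nodal_domain_at G u q"
proof -
  obtain T where T: "connected T" "T \<subseteq> {p. u p \<noteq> 0}" "p \<in> T" "q \<in> T"
    using assms by (auto simp: connected_component_def)
  have "connectedin (quotient_plane G) (orbit_of G ` T)"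
    by (rule connectedin_continuous_map_image[OF quotient_imp_continuous_map[OF quotient_map_orbit_of]])
      (simp add: T(1))
  then have "connectedin (subtopology (quotient_plane G) (orbit_of G ` {p. u p \<noteq> 0})) (orbit_of G ` T)"
    using T(2) by (auto simp: connectedin_subtopology)
  then have "connected_component_of (subtopology (quotient_plane G) (orbit_of G ` {p. u p \<noteq> 0})) (orbit_of G p) (orbit_of G q)"
    using T(3,4) unfolding connected_component_of_def by blast
  then have "connected_component_of (subtopology (quotient_plane G) (orbit_of G ` {p. u p \<noteq> 0})) (orbit_of G p) =
      connected_component_of (subtopology (quotient_plane G) (orbit_of G ` {p. u p \<noteq> 0})) (orbit_of G q)"
    by (subst (asm) connected_component_of_equiv) blast
  then show ?thesis
    by (simp only: nodal_domain_at_def)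
qed

lemma connected_component_map:
  assumes "connected_component S p q" "continuous_on UNIV g" "\<And>p. p \<in> S \<Longrightarrow> g p \<in> S"
  shows "connected_component S (g p) (g q)"
proof -
  obtain T where T: "connected T" "T \<subseteq> S" "p \<in> T" "q \<in> T"
    using assms(1) by (auto simp: connected_component_def)
  have "connected (g ` T)"
    using connected_continuous_image[OF continuous_on_subset[OF assms(2)] T(1)] by blast
  moreover have "g ` T \<subseteq> S" using T(2) assms(3) by blast
  ultimately show ?thesis
    unfolding connected_component_def using T(3,4) by blast
qed

text \<open>The sum runs over a full box, with coefficients 0 off the lattice circle, so that on a
  horizontal or vertical line \<open>u\<close> is visibly a trigonometric sum of degree
  \<open>M\<close> or \<open>N\<close>. The degrees are kept apart because for \<open>r = 2\<close>
  only even \<open>n\<close> occur.\<close>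

locale klein_eigenfunction =
  fixes r :: nat and u :: "plane \<Rightarrow> real" and c :: "int \<Rightarrow> int \<Rightarrow> real" and M N :: nat and lam :: real
  assumes r: "r \<in> {1, 2}"
    and u_eq: "u = (\<lambda>p. \<Sum>m = - int M..int M. \<Sum>n = - int N..int N. c m n * psi m n p)"
    and coeff: "\<And>m n. c m n \<noteq> 0 \<Longrightarrow> (m, n) \<in> J r \<and> of_int (m\<^sup>2 + n\<^sup>2) = lam"
    and nonzero: "\<exists>p. u p \<noteq> 0"
    and MN: "M \<ge> 1" "N \<ge> 1"
begin

definition "b = 2 * pi / r"

definition shift :: "int \<Rightarrow> int \<Rightarrow> plane \<Rightarrow> plane" where
  "shift j k p = (fst p + of_int j * (2 * pi), snd p + of_int k * b)"

definition refl :: "plane \<Rightarrow> plane" where "refl p = (fst p + pi, - snd p)"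

definition "Z = {p. u p \<noteq> 0}"

text \<open>\<open>linked p q\<close>: the images of \<open>p\<close> and \<open>q\<close> in the torus with periods \<open>2 * pi\<close> and \<open>b\<close> lie in the same nodal domain there.\<close>

definition linked :: "plane \<Rightarrow> plane \<Rightarrow> bool" where
  "linked p q \<longleftrightarrow> (\<exists>j k. connected_component Z (shift j k p) q)"

lemma b: "pi \<le> b" "b \<le> 2 * pi" "0 < b" "r * b = 2 * pi"
  using r by (auto simp: b_def)

lemma r_pos: "r > 0" using r by auto

lemma u_reflect: "u (x + pi, - y) = u (x, y)"
  unfolding u_eq
proof (intro sum.cong HOL.refl)
  fix m n
  show "c m n * psi m n (x + pi, - y) = c m n * psi m n (x, y)"
    using coeff[of m n] by (cases "c m n = 0") (auto simp: psi_reflect J_def split: if_splits)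
qed

lemma u_translate: "u (x, y + b) = u (x, y)"
  unfolding u_eq
proof (intro sum.cong HOL.refl)
  fix m n
  show "c m n * psi m n (x, y + b) = c m n * psi m n (x, y)"
    using coeff[of m n] by (cases "c m n = 0") (auto simp: b_def psi_translate[OF r] J_def)
qed

lemma u_2pi: "u (x + 2 * pi, y) = u (x, y)"
  by (simp add: u_eq psi_def)

lemma u_shift: "u (shift j k p) = u p"
proof -
  have "u (fst p + of_int j * (2 * pi), snd p + of_int k * b) = u (fst p, snd p + of_int k * b)"
    by (rule periodic_add_of_int_mult[of "\<lambda>x. u (x, snd p + of_int k * b)"]) (rule u_2pi)
  also have "\<dots> = u (fst p, snd p)"
    by (rule periodic_add_of_int_mult[of "\<lambda>y. u (fst p, y)"]) (rule u_translate)
  finally show ?thesis by (simp add: shift_def)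
qed

lemma u_refl: "u (refl p) = u p"
  using u_reflect[of "fst p" "snd p"] by (simp add: refl_def)

lemma continuous_shift: "continuous_on S (shift j k)"
  unfolding shift_def by (intro continuous_intros)

lemma continuous_refl: "continuous_on S refl"
  unfolding refl_def by (intro continuous_intros)

lemma shift_shift: "shift j k (shift j' k' p) = shift (j + j') (k + k') p"
  by (simp add: shift_def algebra_simps)

lemma shift_0 [simp]: "shift 0 0 p = p"
  by (simp add: shift_def)

lemma refl_shift: "refl (shift j k p) = shift j (- k) (refl p)"
  by (simp add: shift_def refl_def)

lemma component_shift:
  "connected_component Z p q \<Longrightarrow> connected_component Z (shift j k p) (shift j k q)"
  by (rule connected_component_map[OF _ continuous_shift]) (simp_all add: Z_def u_shift)

lemma component_refl:
  "connected_component Z p q \<Longrightarrow> connected_component Z (refl p) (refl q)"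
  by (rule connected_component_map[OF _ continuous_refl]) (simp_all add: Z_def u_refl)

lemma linkedI: "connected_component Z (shift j k p) q \<Longrightarrow> linked p q"
  unfolding linked_def by blast

lemma linkedE:
  assumes "linked p q"
  obtains j k where "connected_component Z (shift j k p) q"
  using assms unfolding linked_def by blast

lemma linked_refl: "p \<in> Z \<Longrightarrow> linked p p"
  by (rule linkedI[of 0 0]) simp

lemma linked_sym:
  assumes "linked p q"
  shows "linked q p"
proof -
  obtain j k where "connected_component Z (shift j k p) q"
    using assms by (rule linkedE)
  from component_shift[OF this, of "- j" "- k"]
  have "connected_component Z p (shift (- j) (- k) q)" by (simp add: shift_shift)
  then have "connected_component Z (shift (- j) (- k) q) p" by (rule connected_component_sym)
  then show ?thesis by (rule linkedI)
qed

lemma linked_trans: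
  assumes "linked p q" "linked q s"
  shows "linked p s"
proof -
  obtain j k where 1: "connected_component Z (shift j k p) q"
    using assms(1) by (rule linkedE)
  obtain j' k' where 2: "connected_component Z (shift j' k' q) s"
    using assms(2) by (rule linkedE)
  have "connected_component Z (shift (j' + j) (k' + k) p) (shift j' k' q)"
    using component_shift[OF 1, of j' k'] by (simp only: shift_shift)
  then have "connected_component Z (shift (j' + j) (k' + k) p) s"
    using 2 by (rule connected_component_trans)
  then show ?thesis by (rule linkedI)
qed

lemma linked_shift:
  assumes "u p \<noteq> 0"
  shows "linked (shift j k p) p"
proof (rule linkedI[of "- j" "- k"])
  show "connected_component Z (shift (- j) (- k) (shift j k p)) p"
    using assms by (simp add: shift_shift Z_def)
qed

lemma linked_nodal_domain:
  assumes "linked p q"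
  shows "nodal_domain_at (klein r) u p = nodal_domain_at (klein r) u q"
proof -
  obtain j k where 1: "connected_component Z (shift j k p) q"
    using assms by (rule linkedE)
  have "nodal_domain_at (klein r) u (shift j k p) = nodal_domain_at (klein r) u q"
    using 1 unfolding Z_def by (rule nodal_domain_at_component)
  moreover have "orbit_of (klein r) (shift j k p) = orbit_of (klein r) p"
    using orbit_klein_translate[of r "fst p" j "snd p" k] by (simp add: shift_def b_def)
  ultimately show ?thesis using nodal_domain_at_orbit by metis
qed

lemma refl_nodal_domain: "nodal_domain_at (klein r) u (refl p) = nodal_domain_at (klein r) u p"
  by (rule nodal_domain_at_orbit) (use orbit_klein_reflect[of r "fst p" "snd p"] in \<open>simp add: refl_def\<close>)

lemma continuous_u: "continuous_on S u"
  unfolding u_eq by (intro continuous_intros smooth_continuous_on smooth_psi)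

lemma open_Z: "open Z"
  unfolding Z_def by (intro open_Collect_neq continuous_u continuous_intros)

lemma weight_rectangle:
  assumes "p \<in> Z" "connected_component_set Z p \<subseteq> {a<..<a + W} \<times> {b'<..<b' + H}" "W > 0" "H > 0"
  shows "pi\<^sup>2 / W\<^sup>2 + pi\<^sup>2 / H\<^sup>2 \<le> lam"
proof -
  \<comment> \<open>The coefficients \<open>a\<close> and the frequency map \<open>s\<close> stay
    general in the two rules below, so that each rule serves for the first and the second
    derivative.\<close>
  define f where "f g = (\<lambda>p. \<Sum>m = - int M..int M. \<Sum>n = - int N..int N. c m n * g m n p)" for g :: "int \<Rightarrow> int \<Rightarrow> plane \<Rightarrow> real"
  have dx: "((\<lambda>x. f (\<lambda>m n p. a m n * psi (s m) n p) (x, y)) has_real_derivative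
      f (\<lambda>m n p. (- of_int (s m) * a m n) * psi (- s m) n p) (x, y)) (at x)" for a s x y
  proof -
    have "((\<lambda>x. a m n * psi (s m) n (x, y)) has_real_derivative (- of_int (s m) * a m n) * psi (- s m) n (x, y)) (at x)" for m n
      unfolding psi_def fst_conv snd_conv
      by (rule derivative_eq_intros trig_has_real_derivative HOL.refl)+ (simp add: mult_ac)
    then show ?thesis
      unfolding f_def by (intro DERIV_sum DERIV_cmult)
  qed
  have dy: "((\<lambda>y. f (\<lambda>m n p. a m n * psi m (s n) p) (x, y)) has_real_derivative
      f (\<lambda>m n p. (- of_int (s n) * a m n) * psi m (- s n) p) (x, y)) (at y)" for a s x y
  proof -
    have "((\<lambda>y. a m n * psi m (s n) (x, y)) has_real_derivative (- of_int (s n) * a m n) * psi m (- s n) (x, y)) (at y)" for m n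
      unfolding psi_def fst_conv snd_conv
      by (rule derivative_eq_intros trig_has_real_derivative HOL.refl)+ (simp add: mult_ac)
    then show ?thesis
      unfolding f_def by (intro DERIV_sum DERIV_cmult)
  qed
  have u: "u = f (\<lambda>m n p. 1 * psi m n p)" by (simp add: u_eq f_def)
  show ?thesis
  proof (rule nodal_domain_in_rectangle[OF continuous_u])
    show "((\<lambda>x. u (x, y)) has_real_derivative f (\<lambda>m n p. (- of_int m * 1) * psi (- m) n p) (x, y)) (at x)" for x y
      unfolding u by (rule dx[of "\<lambda>_ _. 1" "\<lambda>m. m"])
    show "((\<lambda>x. f (\<lambda>m n p. (- of_int m * 1) * psi (- m) n p) (x, y)) has_real_derivative
       f (\<lambda>m n p. (- of_int (- m) * (- of_int m * 1)) * psi (- (- m)) n p) (x, y)) (at x)" for x y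
      by (rule dx[of "\<lambda>m _. - of_int m * 1" "\<lambda>m. - m"])
    show "((\<lambda>y. u (x, y)) has_real_derivative f (\<lambda>m n p. (- of_int n * 1) * psi m (- n) p) (x, y)) (at y)" for x y
      unfolding u by (rule dy[of "\<lambda>_ _. 1" "\<lambda>m. m"])
    show "((\<lambda>y. f (\<lambda>m n p. (- of_int n * 1) * psi m (- n) p) (x, y)) has_real_derivative
       f (\<lambda>m n p. (- of_int (- n) * (- of_int n * 1)) * psi m (- (- n)) p) (x, y)) (at y)" for x y
      by (rule dy[of "\<lambda>_ n. - of_int n * 1" "\<lambda>n. - n"])
    show "f (\<lambda>m n p. (- of_int (- m) * (- of_int m * 1)) * psi (- (- m)) n p) p +
      f (\<lambda>m n p. (- of_int (- n) * (- of_int n * 1)) * psi m (- (- n)) p) p = - lam * u p" for p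
      unfolding u f_def sum_distrib_left sum.distrib[symmetric]
    proof (intro sum.cong HOL.refl)
      fix m n
      show "c m n * ((- of_int (- m) * (- of_int m * 1)) * psi (- (- m)) n p) +
        c m n * ((- of_int (- n) * (- of_int n * 1)) * psi m (- (- n)) p) = - lam * (c m n * (1 * psi m n p))"
      proof (cases "c m n = 0")
        case False
        then have "lam = of_int (m\<^sup>2 + n\<^sup>2)" using coeff[of m n] by simp
        then show ?thesis by (simp add: power2_eq_square algebra_simps)
      qed simp
    qed
    show "u p \<noteq> 0" using assms(1) by (simp add: Z_def)
    show "connected_component_set {p. u p \<noteq> 0} p \<subseteq> {a<..<a + W} \<times> {b'<..<b' + H}"
      using assms(2) by (simp add: Z_def)
  qed (use assms in auto)
qed

section \<open>Widths and heights of the nodal domains of the torus\<close>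

text \<open>Shadows of the component of \<open>p\<close> on the circles of length 2 pi and
  \<open>b\<close>. Their measures stand for width and height, since the component in the plane may
  be unbounded.\<close>

definition "X p = {t \<in> {0..<2 * pi}. \<exists>j::int. t + of_int j * (2 * pi) \<in> fst ` connected_component_set Z p}"
definition "Y p = {t \<in> {0..<b}. \<exists>k::int. t + of_int k * b \<in> snd ` connected_component_set Z p}"

lemma projections:
  assumes "p \<in> Z"
  shows "open (fst ` connected_component_set Z p)" "open (snd ` connected_component_set Z p)"
    "connected (fst ` connected_component_set Z p)" "connected (snd ` connected_component_set Z p)"
    "fst ` connected_component_set Z p \<noteq> {}" "snd ` connected_component_set Z p \<noteq> {}"
proof -
  have "open (connected_component_set Z p)"
    by (rule open_connected_component[OF open_Z])
  then show "open (fst ` connected_component_set Z p)" "open (snd ` connected_component_set Z p)"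
    by (rule open_image_fst, rule open_image_snd)
  show "connected (fst ` connected_component_set Z p)" "connected (snd ` connected_component_set Z p)"
    by (intro connected_continuous_image continuous_intros connected_connected_component)+
  have "p \<in> connected_component_set Z p" using assms by simp
  then show "fst ` connected_component_set Z p \<noteq> {}" "snd ` connected_component_set Z p \<noteq> {}"
    by blast+
qed

lemma weight_X:
  assumes "p \<in> Z" "{s<..<s + d} \<subseteq> fst ` connected_component_set Z p" "0 < d" "d \<le> 2 * pi"
  shows "d \<le> measure lborel (X p)"
  using measure_periodized_interval(2)[OF projections(1)[OF assms(1)] assms(2-4)] by (simp add: X_def)

lemma weight_Y:
  assumes "p \<in> Z" "{s<..<s + d} \<subseteq> snd ` connected_component_set Z p" "0 < d" "d \<le> b"
  shows "d \<le> measure lborel (Y p)"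
  using measure_periodized_interval(2)[OF projections(2)[OF assms(1)] assms(2-4)] by (simp add: Y_def)

lemma open_contains_interval:
  fixes A :: "real set"
  assumes "open A" "A \<noteq> {}" "L > 0"
  obtains s d where "{s<..<s + d} \<subseteq> A" "0 < d" "d \<le> L"
proof -
  obtain a where "a \<in> A" using assms(2) by blast
  then obtain e where e: "e > 0" "ball a e \<subseteq> A" using assms(1) open_contains_ball by blast
  have "{a<..<a + min e L} \<subseteq> ball a e" by (auto simp: dist_real_def)
  then show thesis using that[of a "min e L"] e assms(3) by auto
qed

lemma measurable_XY: "p \<in> Z \<Longrightarrow> X p \<in> sets lborel" "p \<in> Z \<Longrightarrow> Y p \<in> sets lborel"
proof -
  assume p: "p \<in> Z"
  obtain s d where "{s<..<s + d} \<subseteq> fst ` connected_component_set Z p" "0 < d" "d \<le> 2 * pi"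
    using open_contains_interval[OF projections(1,5)[OF p], of "2 * pi"] by auto
  from measure_periodized_interval(1)[OF projections(1)[OF p] this] show "X p \<in> sets lborel"
    by (simp add: X_def)
  obtain s d where "{s<..<s + d} \<subseteq> snd ` connected_component_set Z p" "0 < d" "d \<le> b"
    using open_contains_interval[OF projections(2,6)[OF p] b(3)] by auto
  from measure_periodized_interval(1)[OF projections(2)[OF p] this] show "Y p \<in> sets lborel"
    by (simp add: Y_def)
qed

lemma weight_pos:
  assumes p: "p \<in> Z"
  shows "0 < measure lborel (X p)" "0 < measure lborel (Y p)"
proof -
  obtain s d where "{s<..<s + d} \<subseteq> fst ` connected_component_set Z p" "0 < d" "d \<le> 2 * pi"
    using open_contains_interval[OF projections(1,5)[OF p], of "2 * pi"] by auto
  from weight_X[OF p this] \<open>0 < d\<close> show "0 < measure lborel (X p)" by linarith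
  obtain s d where "{s<..<s + d} \<subseteq> snd ` connected_component_set Z p" "0 < d" "d \<le> b"
    using open_contains_interval[OF projections(2,6)[OF p] b(3)] by auto
  from weight_Y[OF p this] \<open>0 < d\<close> show "0 < measure lborel (Y p)" by linarith
qed

text \<open>If a projection covers its whole circle, that shadow alone has measure at least
  \<open>pi\<close>, as \<open>b \<ge> pi\<close>, and the positive measure of the other one makes
  the inequality strict. Otherwise the component lies in a rectangle whose sides are bounded by the
  two measures.\<close>

lemma weight_gt:
  assumes p: "p \<in> Z" and k: "k \<le> pi" "k\<^sup>2 * lam < 8 * pi\<^sup>2"
  shows "k < measure lborel (X p) + measure lborel (Y p)"
proof (cases rule: connected_open_real_cases[OF projections(1,3,5)[OF p], of "2 * pi"])
  case (2 s)
  have "2 * pi \<le> measure lborel (X p)"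
    by (rule weight_X[OF p 2]) auto
  then show ?thesis using k weight_pos[OF p] pi_gt_zero by linarith
next
  case (3 s d)
  show ?thesis
  proof (cases rule: connected_open_real_cases[OF projections(2,4,6)[OF p] b(3)])
    case (1 s)
    have "b \<le> measure lborel (Y p)"
      by (rule weight_Y[OF p 1 b(3)]) auto
    then show ?thesis using k weight_pos[OF p] b by linarith
  next
    case (2 s' d')
    have "d \<le> measure lborel (X p)"
      by (rule weight_X[OF p]) (use 3 in auto)
    moreover have "d' \<le> measure lborel (Y p)"
      by (rule weight_Y[OF p]) (use 2 in auto)
    moreover have "k < d + d'"
    proof (rule sum_ge_of_inverse_squares)
      show "pi\<^sup>2 / d\<^sup>2 + pi\<^sup>2 / d'\<^sup>2 \<le> lam"
      proof (rule weight_rectangle[OF p])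
        show "connected_component_set Z p \<subseteq> {s<..<s + d} \<times> {s'<..<s' + d'}"
          unfolding 3(1)[symmetric] 2(1)[symmetric] by (auto simp: image_iff)
      qed (use 2 3 in auto)
    qed (use 2 3 k in auto)
    ultimately show ?thesis by linarith
  qed
qed (use pi_gt_zero in auto)

text \<open>The glide reflection followed by a translation, called \<open>g\<close>, maps
  \<open>p\<close> into its own component, and the square of \<open>g\<close> shifts horizontally by
  an odd multiple of 2 pi, which is never 0. So the component spans a full horizontal period. Such a
  domain is the only lift of its image in the bottle, so it has to carry the weight of two
  domains.\<close>

lemma weight_invariant:
  assumes p: "p \<in> Z" and l: "linked p (refl p)"
  shows "2 * pi < measure lborel (X p) + measure lborel (Y p)"
proof -
  obtain j k where jk: "connected_component Z (shift j k p) (refl p)"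
    using l by (rule linkedE)
  define g where "g q = shift (- j) (- k) (refl q)" for q
  have "connected_component Z (shift (- j) (- k) (shift j k p)) (g p)"
    unfolding g_def by (rule component_shift[OF jk])
  then have 1: "connected_component Z p (g p)" by (simp add: shift_shift)
  then have "connected_component Z (g p) (g (g p))"
    unfolding g_def by (rule component_shift[OF component_refl])
  then have "connected_component Z p (g (g p))"
    using 1 by (metis connected_component_trans)
  moreover have "fst (g (g p)) = fst p + 2 * (pi * (1 - 2 * of_int j))"
    by (simp add: g_def shift_def refl_def algebra_simps)
  ultimately have in2: "fst p + 2 * (pi * (1 - 2 * of_int j)) \<in> fst ` connected_component_set Z p"
    by (metis image_eqI mem_Collect_eq)
  have in1: "fst p \<in> fst ` connected_component_set Z p"
    using p by simp
  have conn: "{x..y} \<subseteq> fst ` connected_component_set Z p"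
    if "x \<in> fst ` connected_component_set Z p" "y \<in> fst ` connected_component_set Z p" for x y
    by (rule connected_contains_Icc[OF projections(3)[OF p] that])
  have sub1: "{a<..<a + 2 * pi} \<subseteq> {a..a + D}" if "2 * pi \<le> D" for a D :: real
    using that by auto
  have sub2: "{a - 2 * pi<..<a - 2 * pi + 2 * pi} \<subseteq> {a + D..a}" if "D \<le> - (2 * pi)" for a D :: real
    using that by auto
  have "\<exists>s. {s<..<s + 2 * pi} \<subseteq> fst ` connected_component_set Z p"
  proof (cases "j \<le> 0")
    case True
    then have "pi * 1 \<le> pi * (1 - 2 * of_int j)" by (intro mult_left_mono) auto
    then have "2 * pi \<le> 2 * (pi * (1 - 2 * of_int j))" by linarith
    then have "{fst p<..<fst p + 2 * pi} \<subseteq> {fst p..fst p + 2 * (pi * (1 - 2 * of_int j))}" by (rule sub1)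
    then show ?thesis using conn[OF in1 in2] by (intro exI) (rule order.trans)
  next
    case False
    then have "real_of_int j \<ge> 1" by linarith
    then have "pi * (1 - 2 * of_int j) \<le> pi * (-1)" by (intro mult_left_mono) auto
    then have "2 * (pi * (1 - 2 * of_int j)) \<le> - (2 * pi)" by linarith
    then have "{fst p - 2 * pi<..<fst p - 2 * pi + 2 * pi} \<subseteq> {fst p + 2 * (pi * (1 - 2 * of_int j))..fst p}" by (rule sub2)
    then show ?thesis using conn[OF in2 in1] by (intro exI) (rule order.trans)
  qed
  then obtain s where "{s<..<s + 2 * pi} \<subseteq> fst ` connected_component_set Z p" ..
  from weight_X[OF p this] have "2 * pi \<le> measure lborel (X p)" by simp
  then show ?thesis using weight_pos[OF p] by linarith
qed

section \<open>Counting along closed geodesics\<close>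

lemma segment_linked:
  fixes g :: "real \<Rightarrow> plane"
  assumes g: "continuous_on UNIV g" and nz: "\<And>s. s \<in> {x..y} \<Longrightarrow> u (g s) \<noteq> 0" and "x \<le> y"
  shows "linked (g x) (g y)"
proof (rule linkedI[of 0 0])
  have "connected (g ` {x..y})"
    by (rule connected_continuous_image[OF continuous_on_subset[OF g]]) auto
  moreover have "g ` {x..y} \<subseteq> Z" using nz by (auto simp: Z_def)
  moreover have "g x \<in> g ` {x..y}" "g y \<in> g ` {x..y}" using \<open>x \<le> y\<close> by auto
  ultimately show "connected_component Z (shift 0 0 (g x)) (g y)"
    unfolding connected_component_def shift_0 by blast
qed

text \<open>\<open>T\<close> represents distinct domains that the closed curve \<open>g\<close>
  meets. Between cyclically consecutive meeting points \<open>u\<close> has a zero, since otherwise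
  the arc would link two elements of \<open>T\<close>. A single domain can be met without any zero,
  whence \<open>B \<ge> 1\<close>.\<close>

lemma line_count:
  fixes g :: "real \<Rightarrow> plane"
  assumes g: "continuous_on UNIV g" "\<And>s. g (s + L) = shift j0 k0 (g s)"
    and T: "finite T" "\<And>p q. p \<in> T \<Longrightarrow> q \<in> T \<Longrightarrow> linked p q \<Longrightarrow> p = q"
    and hit: "\<And>p. p \<in> T \<Longrightarrow> \<exists>s\<in>{0..<L}. u (g s) \<noteq> 0 \<and> linked (g s) p"
    and zeros: "\<And>Y. Y \<subseteq> {0..<L} \<Longrightarrow> finite Y \<Longrightarrow> (\<And>z. z \<in> Y \<Longrightarrow> u (g z) = 0) \<Longrightarrow> card Y \<le> B"
    and "B \<ge> 1"
  shows "card T \<le> B"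
proof (cases "card T \<ge> 2")
  case True
  have "\<forall>p\<in>T. \<exists>s. s \<in> {0..<L} \<and> u (g s) \<noteq> 0 \<and> linked (g s) p"
    using hit by blast
  from bchoice[OF this] obtain f where f: "\<forall>p\<in>T. f p \<in> {0..<L} \<and> u (g (f p)) \<noteq> 0 \<and> linked (g (f p)) p" ..
  have eqI: "p = q" if p: "p \<in> T" and q: "q \<in> T" and l: "linked (g (f p)) (g (f q))" for p q
  proof (rule T(2)[OF p q])
    have "linked p (g (f p))" using f p linked_sym by blast
    then have "linked p (g (f q))" using l by (rule linked_trans)
    moreover have "linked (g (f q)) q" using f q by blast
    ultimately show "linked p q" by (rule linked_trans)
  qed
  have inj: "inj_on f T"
  proof (rule inj_onI)
    fix p q assume pq: "p \<in> T" "q \<in> T" "f p = f q"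
    have "g (f p) \<in> Z" using f pq(1) by (simp add: Z_def)
    then have "linked (g (f p)) (g (f q))" unfolding pq(3)[symmetric] by (rule linked_refl)
    then show "p = q" by (rule eqI[OF pq(1,2)])
  qed
  obtain Y where Y: "Y \<subseteq> {0..<L}" "card Y = card (f ` T)" "finite Y" "\<And>z. z \<in> Y \<Longrightarrow> u (g z) = 0"
  proof (rule card_le_card_zeros_cyclic[of "\<lambda>s. u (g s)" L "f ` T"])
    show "u (g (x + L)) = u (g x)" for x by (simp only: g(2) u_shift)
    show "finite (f ` T)" using T(1) by simp
    show "f ` T \<subseteq> {0..<L}" using f by blast
    show "2 \<le> card (f ` T)" using True card_image[OF inj] by simp
  next
    fix x y assume "x \<in> f ` T" "y \<in> f ` T" and less: "x < y"
    then obtain p q where pq: "p \<in> T" "q \<in> T" "x = f p" "y = f q" by blast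
    have ne: "p \<noteq> q" using less pq by auto
    have nz: "u (g x) \<noteq> 0" "u (g y) \<noteq> 0" using f pq by simp_all
    show "\<exists>z. x < z \<and> z < y \<and> u (g z) = 0"
    proof (rule ccontr)
      assume no: "\<nexists>z. x < z \<and> z < y \<and> u (g z) = 0"
      have "linked (g x) (g y)"
      proof (rule segment_linked[OF g(1)])
        fix s assume "s \<in> {x..y}"
        then consider "s = x" | "s = y" | "x < s \<and> s < y" by fastforce
        then show "u (g s) \<noteq> 0" using nz no by cases auto
      qed (use less in simp)
      then show False using eqI[OF pq(1,2)] ne pq(3,4) by simp
    qed
    show "\<exists>z. y < z \<and> z < x + L \<and> u (g z) = 0"
    proof (rule ccontr)
      assume no: "\<nexists>z. y < z \<and> z < x + L \<and> u (g z) = 0"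
      have "y < L" "0 \<le> x" using f pq by auto
      then have le: "y \<le> x + L" by simp
      \<comment> \<open>The arc that closes the curve: it ends at \<open>g (x + L)\<close>, a
        translate of \<open>g x\<close>, which is linked to \<open>g x\<close>.\<close>
      have "linked (g y) (g (x + L))"
      proof (rule segment_linked[OF g(1) _ le])
        fix s assume "s \<in> {y..x + L}"
        then consider "s = y" | "s = x + L" | "y < s \<and> s < x + L" by fastforce
        then show "u (g s) \<noteq> 0"
        proof cases
          case 2
          show ?thesis unfolding 2 g(2) u_shift by (rule nz)
        qed (use nz no in auto)
      qed
      then have "linked (g y) (g x)"
        unfolding g(2) using linked_shift[OF nz(1)] by (rule linked_trans)
      then show False using eqI[OF pq(2,1)] ne pq(3,4) by simp
    qed
  qed (rule that)
  have "card Y \<le> B" by (rule zeros[OF Y(1,3,4)])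
  then show ?thesis using Y(2) card_image[OF inj] by simp
qed (use \<open>B \<ge> 1\<close> in simp)

lemma zeros_horizontal:
  assumes "u (x0, t) \<noteq> 0" "V \<subseteq> {0..<2 * pi}" "\<And>z. z \<in> V \<Longrightarrow> u (z, t) = 0"
  shows "finite V \<and> card V \<le> 2 * M"
proof -
  have eq: "u (x, t) = (\<Sum>m = - int M..int M. (\<Sum>n = - int N..int N. c m n * trig n t) * trig m x)" for x
    unfolding u_eq psi_def fst_conv snd_conv sum_distrib_right
    by (intro sum.cong HOL.refl) (simp only: mult_ac)
  show ?thesis
    by (rule card_zeros_trig_sum_le[where c = "\<lambda>m. \<Sum>n = - int N..int N. c m n * trig n t" and M = M,
          folded eq, OF assms])
qed

lemma zeros_vertical:
  assumes "u (t, y0) \<noteq> 0" "V \<subseteq> {0..<2 * pi}" "\<And>z. z \<in> V \<Longrightarrow> u (t, z) = 0"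
  shows "finite V \<and> card V \<le> 2 * N"
proof -
  have eq: "u (t, y) = (\<Sum>n = - int N..int N. (\<Sum>m = - int M..int M. c m n * trig m t) * trig n y)" for y
    unfolding u_eq psi_def fst_conv snd_conv sum_distrib_right
    by (subst sum.swap) (intro sum.cong HOL.refl, simp only: mult_ac)
  show ?thesis
    by (rule card_zeros_trig_sum_le[where c = "\<lambda>n. \<Sum>m = - int M..int M. c m n * trig m t" and M = N,
          folded eq, OF assms])
qed

lemma horizontal_count:
  assumes "u (x0, t) \<noteq> 0"
    and T: "finite T" "\<And>p q. p \<in> T \<Longrightarrow> q \<in> T \<Longrightarrow> linked p q \<Longrightarrow> p = q"
  shows "card {p \<in> T. t \<in> Y p} \<le> 2 * M"
proof (rule line_count[of "\<lambda>s. (s, t)" "2 * pi" 1 0])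
  show "(s + 2 * pi, t) = shift 1 0 (s, t)" for s by (simp add: shift_def)
  show "finite {p \<in> T. t \<in> Y p}" using T(1) by simp
  show "p = q" if "p \<in> {p \<in> T. t \<in> Y p}" "q \<in> {p \<in> T. t \<in> Y p}" "linked p q" for p q
    using T(2) that by blast
  show "card V \<le> 2 * M" if "V \<subseteq> {0..<2 * pi}" "finite V" "\<And>z. z \<in> V \<Longrightarrow> u (z, t) = 0" for V
    using zeros_horizontal[OF assms(1) that(1,3)] by blast
  show "\<exists>s\<in>{0..<2 * pi}. u (s, t) \<noteq> 0 \<and> linked (s, t) p" if "p \<in> {p \<in> T. t \<in> Y p}" for p
  proof -
    obtain k :: int where "t + of_int k * b \<in> snd ` connected_component_set Z p"
      using \<open>p \<in> {p \<in> T. t \<in> Y p}\<close> by (auto simp: Y_def)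
    then obtain q where q: "connected_component Z p q" "t + of_int k * b = snd q" by blast
    obtain j :: int where j: "fst q + of_int j * (2 * pi) \<in> {0..<2 * pi}"
      using obtain_period_representative[of "2 * pi" "fst q"] by auto
    \<comment> \<open>Membership of \<open>t\<close> in \<open>Y p\<close> provides a point of the
      component at height \<open>t\<close> modulo \<open>b\<close>; lattice translations bring it
      onto the given line and into one period.\<close>
    have eq: "(fst q + of_int j * (2 * pi), t) = shift j (- k) q"
      using q(2)[symmetric] by (simp add: shift_def)
    have "q \<in> Z" using q(1) connected_component_in by blast
    then have nz: "u q \<noteq> 0" by (simp add: Z_def)
    have "linked p q" using q(1) by (intro linkedI[of 0 0]) simp
    then have "linked q p" by (rule linked_sym)
    with linked_shift[OF nz] have "linked (shift j (- k) q) p" by (rule linked_trans)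
    then have "u (fst q + of_int j * (2 * pi), t) \<noteq> 0 \<and> linked (fst q + of_int j * (2 * pi), t) p"
      unfolding eq u_shift using nz by blast
    then show ?thesis using j by blast
  qed
qed (use MN in \<open>auto intro!: continuous_intros\<close>)

text \<open>For \<open>r = 2\<close> the closed geodesic has length \<open>pi\<close> only, and each
  zero on it yields two zeros in the interval of length 2 pi for which the degree bound is stated.
  This gains the factor \<open>r\<close>.\<close>

lemma vertical_count:
  assumes "u (t, y0) \<noteq> 0"
    and T: "finite T" "\<And>p q. p \<in> T \<Longrightarrow> q \<in> T \<Longrightarrow> linked p q \<Longrightarrow> p = q"
  shows "r * card {p \<in> T. t \<in> X p} \<le> 2 * N"
proof -
  have "card {p \<in> T. t \<in> X p} \<le> 2 * N div r"
  proof (rule line_count[of "\<lambda>s. (t, s)" b 0 1])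
    show "(t, s + b) = shift 0 1 (t, s)" for s by (simp add: shift_def)
    show "finite {p \<in> T. t \<in> X p}" using T(1) by simp
    show "p = q" if "p \<in> {p \<in> T. t \<in> X p}" "q \<in> {p \<in> T. t \<in> X p}" "linked p q" for p q
      using T(2) that by blast
    show "card V \<le> 2 * N div r" if V: "V \<subseteq> {0..<b}" "finite V" "\<And>z. z \<in> V \<Longrightarrow> u (t, z) = 0" for V
    proof -
      have "r = 1 \<or> r = 2" using r by auto
      then show ?thesis
      proof
        assume "r = 1"
        then have "b = 2 * pi" using b(4) by simp
        then have "V \<subseteq> {0..<2 * pi}" using V(1) by simp
        then have "card V \<le> 2 * N" using zeros_vertical[OF assms(1) _ V(3)] by blast
        then show ?thesis by (simp add: \<open>r = 1\<close>)
      next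
        assume r2: "r = 2"
        then have b2: "b = pi" using b(4) by simp
        have "card (V \<union> (\<lambda>z. z + pi) ` V) \<le> 2 * N"
        proof -
          have "V \<union> (\<lambda>z. z + pi) ` V \<subseteq> {0..<2 * pi}" using V(1) by (auto simp: b2)
          moreover have "u (t, z) = 0" if "z \<in> V \<union> (\<lambda>z. z + pi) ` V" for z
            using that V(3) u_translate[of t] unfolding b2 by auto
          ultimately show ?thesis using zeros_vertical[OF assms(1)] by blast
        qed
        moreover have "card (V \<union> (\<lambda>z. z + pi) ` V) = card V + card ((\<lambda>z. z + pi) ` V)"
        proof (rule card_Un_disjoint)
          have "z + pi \<notin> V" if "z \<in> V" for z
            using subsetD[OF V(1) that] subsetD[OF V(1), of "z + pi"] by (auto simp: b2)
          then show "V \<inter> (\<lambda>z. z + pi) ` V = {}" by auto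
        qed (use V(2) in auto)
        moreover have "card ((\<lambda>z. z + pi) ` V) = card V"
          by (rule card_image) (auto simp: inj_on_def)
        ultimately show ?thesis using r2 by simp
      qed
    qed
    show "1 \<le> 2 * N div r" using r MN by auto
    show "\<exists>s\<in>{0..<b}. u (t, s) \<noteq> 0 \<and> linked (t, s) p" if "p \<in> {p \<in> T. t \<in> X p}" for p
    proof -
      obtain j :: int where "t + of_int j * (2 * pi) \<in> fst ` connected_component_set Z p"
        using \<open>p \<in> {p \<in> T. t \<in> X p}\<close> by (auto simp: X_def)
      then obtain q where q: "connected_component Z p q" "t + of_int j * (2 * pi) = fst q" by blast
      obtain k :: int where k: "snd q + of_int k * b \<in> {0..<b}"
        using obtain_period_representative[OF b(3), of "snd q"] by auto
      have eq: "(t, snd q + of_int k * b) = shift (- j) k q"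
        using q(2)[symmetric] by (simp add: shift_def)
      have "q \<in> Z" using q(1) connected_component_in by blast
      then have nz: "u q \<noteq> 0" by (simp add: Z_def)
      have "linked p q" using q(1) by (intro linkedI[of 0 0]) simp
      then have "linked q p" by (rule linked_sym)
      with linked_shift[OF nz] have "linked (shift (- j) k q) p" by (rule linked_trans)
      then have "u (t, snd q + of_int k * b) \<noteq> 0 \<and> linked (t, snd q + of_int k * b) p"
        unfolding eq u_shift using nz by blast
      then show ?thesis using k by blast
    qed
  qed (auto intro!: continuous_intros)
  then have "r * card {p \<in> T. t \<in> X p} \<le> r * (2 * N div r)" by (rule mult_le_mono2)
  also have "\<dots> \<le> 2 * N" by simp
  finally show ?thesis .
qed

text \<open>The sum of the measures is the integral over \<open>t\<close> of the number of sets that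
  contain \<open>t\<close>. The finite exceptional set \<open>F\<close> is there to absorb the lines
  on which \<open>u\<close> vanishes identically, where zeros cannot be counted.\<close>

lemma sum_measure_le:
  fixes S :: "'i \<Rightarrow> real set"
  assumes "finite T" "\<And>p. p \<in> T \<Longrightarrow> S p \<in> sets lborel" "\<And>p. p \<in> T \<Longrightarrow> S p \<subseteq> {0..<L}"
    and F: "finite F" "\<And>t. t \<in> {0..<L} \<Longrightarrow> t \<notin> F \<Longrightarrow> real (card {p \<in> T. t \<in> S p}) \<le> B"
    and L: "L \<ge> 0"
  shows "(\<Sum>p\<in>T. measure lborel (S p)) \<le> B * L"
proof -
  have int: "integrable lborel (indicator (S p) :: real \<Rightarrow> real)" if p: "p \<in> T" for p
  proof (rule integrable_real_indicator[OF assms(2)[OF p]])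
    have "emeasure lborel (S p) \<le> emeasure lborel {0..<L}"
      by (rule emeasure_mono[OF assms(3)[OF p]]) simp
    also have "\<dots> < \<infinity>" using L by simp
    finally show "emeasure lborel (S p) < \<infinity>" .
  qed
  have "(\<Sum>p\<in>T. measure lborel (S p)) = (\<Sum>p\<in>T. integral\<^sup>L lborel (indicator (S p)))"
    using assms(2) by (intro sum.cong HOL.refl) (simp add: integral_indicator)
  also have "\<dots> = integral\<^sup>L lborel (\<lambda>t. \<Sum>p\<in>T. indicator (S p) t)"
    by (rule Bochner_Integration.integral_sum[symmetric]) (rule int)
  also have "\<dots> \<le> integral\<^sup>L lborel (\<lambda>t. B * indicator {0..<L} t)"
  proof (rule integral_mono_AE)
    show "integrable lborel (\<lambda>t. \<Sum>p\<in>T. indicator (S p) t :: real)"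
      by (rule Bochner_Integration.integrable_sum) (rule int)
    show "integrable lborel (\<lambda>t. B * indicator {0..<L} t)"
      by (intro integrable_mult_right integrable_real_indicator) (use L in auto)
    have "AE t in lborel. t \<notin> F"
      by (rule AE_not_in) (rule finite_imp_null_set_lborel[OF F(1)])
    then show "AE t in lborel. (\<Sum>p\<in>T. indicator (S p) t) \<le> B * indicator {0..<L} t"
    proof (rule AE_mp, intro AE_I2 impI)
      fix t assume t: "t \<notin> F"
      have eq: "(\<Sum>p\<in>T. indicator (S p) t) = real (card {p \<in> T. t \<in> S p})"
        using assms(1) by (simp add: indicator_def sum.If_cases Int_def)
      show "(\<Sum>p\<in>T. indicator (S p) t) \<le> B * indicator {0..<L} t"
      proof (cases "t \<in> {0..<L}")
        case True
        then show ?thesis unfolding eq using F(2)[OF True t] by simp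
      next
        case False
        then have "{p \<in> T. t \<in> S p} = {}" using assms(3) by blast
        then show ?thesis unfolding eq using False by (simp only: card.empty) simp
      qed
    qed
  qed
  also have "\<dots> = B * L"
    using L by simp
  finally show ?thesis .
qed

lemma total_weight_le:
  assumes T: "finite T" "T \<subseteq> Z" "\<And>p q. p \<in> T \<Longrightarrow> q \<in> T \<Longrightarrow> linked p q \<Longrightarrow> p = q"
  shows "(\<Sum>p\<in>T. measure lborel (X p) + measure lborel (Y p)) \<le> 4 * pi * (M + N) / r"
proof -
  obtain x0 y0 where nz: "u (x0, y0) \<noteq> 0" using nonzero by (metis surj_pair)
  have mem: "p \<in> Z" if "p \<in> T" for p using T(2) that by blast
  have "(\<Sum>p\<in>T. measure lborel (Y p)) \<le> real (2 * M) * b"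
  proof (rule sum_measure_le[OF T(1)])
    \<comment> \<open>A horizontal line on which \<open>u\<close> vanishes identically crosses the
      vertical line \<open>x = x0\<close> in a zero. That vertical line contains a point with
      \<open>u \<noteq> 0\<close>, so it has only finitely many zeros.\<close>
    show "finite {t \<in> {0..<2 * pi}. u (x0, t) = 0}"
      by (rule conjunct1[OF zeros_vertical[OF nz]]) blast+
    show "Y p \<in> sets lborel" if "p \<in> T" for p
      by (rule measurable_XY(2)[OF mem[OF that]])
    show "Y p \<subseteq> {0..<b}" for p
      unfolding Y_def by (rule Collect_restrict)
    show "0 \<le> b" using b(3) by simp
    fix t assume "t \<in> {0..<b}" "t \<notin> {t \<in> {0..<2 * pi}. u (x0, t) = 0}"
    then have "u (x0, t) \<noteq> 0" using b(2) by auto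
    then show "real (card {p \<in> T. t \<in> Y p}) \<le> real (2 * M)"
      unfolding of_nat_le_iff by (rule horizontal_count[OF _ T(1,3)])
  qed
  moreover have "(\<Sum>p\<in>T. measure lborel (X p)) \<le> (2 * N / r) * (2 * pi)"
  proof (rule sum_measure_le[OF T(1)])
    show "finite {t \<in> {0..<2 * pi}. u (t, y0) = 0}"
      by (rule conjunct1[OF zeros_horizontal[OF nz]]) blast+
    show "X p \<in> sets lborel" if "p \<in> T" for p
      by (rule measurable_XY(1)[OF mem[OF that]])
    show "X p \<subseteq> {0..<2 * pi}" for p
      unfolding X_def by (rule Collect_restrict)
    show "0 \<le> 2 * pi" by simp
    fix t :: real assume "t \<in> {0..<2 * pi}" "t \<notin> {t \<in> {0..<2 * pi}. u (t, y0) = 0}"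
    then have "u (t, y0) \<noteq> 0" by auto
    then have "r * card {p \<in> T. t \<in> X p} \<le> 2 * N"
      by (rule vertical_count[OF _ T(1,3)])
    then have "real (r * card {p \<in> T. t \<in> X p}) \<le> real (2 * N)"
      by (simp only: of_nat_le_iff)
    then show "real (card {p \<in> T. t \<in> X p}) \<le> 2 * N / r"
      using r_pos by (simp add: pos_le_divide_eq mult.commute)
  qed
  moreover have "real (2 * M) * b + (2 * N / r) * (2 * pi) = 4 * pi * (M + N) / r"
    by (simp add: b_def add_divide_distrib algebra_simps)
  ultimately show ?thesis unfolding sum.distrib by linarith
qed

text \<open>\<open>P\<close> holds one point for each domain of the bottle that is counted, and
  \<open>R\<close> those points of \<open>P\<close> whose reflection lies in another torus domain.
  The points of \<open>P\<close> together with the reflections of \<open>R\<close> represent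
  distinct torus domains. So every point of \<open>P\<close> accounts for more than
  \<open>2 * k\<close> of the total weight, by \<open>weight_gt\<close> used twice or by
  \<open>weight_invariant\<close>.\<close>

lemma nodal_count_bound:
  assumes P: "finite P" "P \<subseteq> Z" "inj_on (nodal_domain_at (klein r) u) P" "P \<noteq> {}"
    and k: "k \<le> pi" "k\<^sup>2 * lam < 8 * pi\<^sup>2"
  shows "k * card P < 2 * pi * (M + N) / r"
proof -
  define R where "R = {p \<in> P. \<not> linked p (refl p)}"
  define w where "w p = measure lborel (X p) + measure lborel (Y p)" for p
  have mem: "p \<in> Z" "refl p \<in> Z" if "p \<in> P" for p
    using P(2) that by (auto simp: Z_def u_refl)
  have PI: "p = q" if "p \<in> P" "q \<in> P" "nodal_domain_at (klein r) u p = nodal_domain_at (klein r) u q" for p q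
    using inj_onD[OF P(3)] that by blast
  have disj: "P \<inter> refl ` R = {}"
  proof (rule ccontr)
    assume "P \<inter> refl ` R \<noteq> {}"
    then obtain q where q: "q \<in> R" "refl q \<in> P" by blast
    then have "q \<in> P" by (simp add: R_def)
    have "refl q = q" using PI[OF q(2) \<open>q \<in> P\<close>] refl_nodal_domain by blast
    then have "linked q (refl q)" using linked_refl[OF mem(1)[OF \<open>q \<in> P\<close>]] by simp
    then show False using q(1) by (simp add: R_def)
  qed
  have sep: "p = q" if pq: "p \<in> P \<union> refl ` R" "q \<in> P \<union> refl ` R" and l: "linked p q" for p q
  proof -
    have eq: "nodal_domain_at (klein r) u p = nodal_domain_at (klein r) u q"
      using l by (rule linked_nodal_domain)
    from pq consider "p \<in> P" "q \<in> P" | p' where "p = refl p'" "p' \<in> R" "q \<in> P"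
      | q' where "p \<in> P" "q = refl q'" "q' \<in> R" | p' q' where "p = refl p'" "p' \<in> R" "q = refl q'" "q' \<in> R"
      by blast
    then show ?thesis
    proof cases
      case 1
      then show ?thesis using PI eq by blast
    next
      case 2
      then have "p' = q" using PI[of p' q] eq by (simp add: refl_nodal_domain R_def)
      then have "linked q (refl q)" using 2 l linked_sym by blast
      then show ?thesis using 2 \<open>p' = q\<close> by (simp add: R_def)
    next
      case 3
      then have "q' = p" using PI[of q' p] eq by (simp add: refl_nodal_domain R_def)
      then show ?thesis using 3 l by (simp add: R_def)
    next
      case 4
      then have "p' = q'" using PI[of p' q'] eq by (simp add: refl_nodal_domain R_def)
      then show ?thesis using 4 by simp
    qed
  qed
  have finR: "finite R" using P(1) by (simp add: R_def)
  have inj: "inj_on refl R" by (auto simp: inj_on_def refl_def prod_eq_iff)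
  have "(\<Sum>p\<in>P \<union> refl ` R. w p) = (\<Sum>p\<in>P. w p) + (\<Sum>p\<in>refl ` R. w p)"
    by (rule sum.union_disjoint) (use P(1) finR disj in auto)
  also have "(\<Sum>p\<in>refl ` R. w p) = (\<Sum>p\<in>R. w (refl p))"
    by (simp add: sum.reindex[OF inj])
  also have "\<dots> = (\<Sum>p\<in>P. if \<not> linked p (refl p) then w (refl p) else 0)"
    unfolding R_def by (rule sum.inter_filter[OF P(1)])
  finally have total: "(\<Sum>p\<in>P \<union> refl ` R. w p) = (\<Sum>p\<in>P. w p + (if \<not> linked p (refl p) then w (refl p) else 0))"
    by (simp only: sum.distrib)
  have "(\<Sum>p\<in>P. 2 * k) < (\<Sum>p\<in>P. w p + (if \<not> linked p (refl p) then w (refl p) else 0))"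
  proof (rule sum_strict_mono[OF P(1,4)])
    fix p assume p: "p \<in> P"
    show "2 * k < w p + (if \<not> linked p (refl p) then w (refl p) else 0)"
    proof (cases "linked p (refl p)")
      case True
      then show ?thesis using weight_invariant[OF mem(1)[OF p]] k(1) by (simp add: w_def)
    next
      case False
      then show ?thesis
        using weight_gt[OF mem(1)[OF p] k] weight_gt[OF mem(2)[OF p] k] by (simp add: w_def)
    qed
  qed
  also have "\<dots> = (\<Sum>p\<in>P \<union> refl ` R. w p)"
    by (rule total[symmetric])
  also have "\<dots> \<le> 4 * pi * (M + N) / r"
    unfolding w_def
    by (rule total_weight_le) (use P(1) finR mem sep in \<open>auto simp: R_def\<close>)
  finally have "2 * (k * card P) < 2 * (2 * pi * (M + N) / r)"
    by (simp add: mult_ac)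
  then show ?thesis by simp
qed

end

section \<open>Counting lattice points\<close>

text \<open>In view of \<open>multiplicity_klein\<close> this counts the eigenvalues below
  \<open>L\<close>. The smallest label of an eigenvalue \<open>L\<close> is one more, whence the
  summand 1 in \<open>count_suffices\<close>.\<close>

definition count_below :: "nat \<Rightarrow> nat \<Rightarrow> nat" where
  "count_below r L = card {(m, n) \<in> J r. m\<^sup>2 + n\<^sup>2 < int L}"

text \<open>What \<open>nodal_count_bound\<close> needs to give fewer nodal domains than Courant's bound.\<close>

definition count_suffices :: "nat \<Rightarrow> nat \<Rightarrow> bool" where
  "count_suffices r L \<longleftrightarrow> (\<forall>M N. M\<^sup>2 \<le> L \<longrightarrow> N\<^sup>2 \<le> L \<longrightarrow> r dvd N \<longrightarrow>
     (M + N)\<^sup>2 * L < 2 * r\<^sup>2 * (count_below r L + 1)\<^sup>2)"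

text \<open>A list is a certificate for a lower bound on \<open>count_below\<close>. The entry
  \<open>a\<close> at position \<open>m\<close> stands for the values \<open>r\<close>,
  \<open>2 * r\<close>, ..., \<open>a * r\<close> of the absolute value of \<open>n\<close>, at both
  \<open>m\<close> and \<open>- m\<close>; an even \<open>m\<close> admits \<open>n = 0\<close> as
  well.\<close>

fun row_sum :: "nat \<Rightarrow> nat list \<Rightarrow> nat" where
  "row_sum m [] = 0"
| "row_sum m (a # as) = (if m = 0 then 1 else 2) * (if even m then a + 1 else a) + row_sum (m + 1) as"

fun rows_below :: "nat \<Rightarrow> nat \<Rightarrow> nat \<Rightarrow> nat list \<Rightarrow> bool" where
  "rows_below r L m [] = True"
| "rows_below r L m (a # as) = (m\<^sup>2 + (r * a)\<^sup>2 < L \<and> rows_below r L (m + 1) as)"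

lemma finite_J_less: "finite {(m, n) \<in> J r. m\<^sup>2 + n\<^sup>2 < b}"
  by (rule finite_subset[OF _ finite_J_le[of r b]]) auto

lemma row_sum_le:
  assumes "r > 0" "rows_below r L k as"
  shows "row_sum k as \<le> card {(m, n) \<in> J r. m\<^sup>2 + n\<^sup>2 < int L \<and> int k \<le> \<bar>m\<bar>}"
  using assms(2)
proof (induction as arbitrary: k)
  case (Cons a as)
  let ?S = "\<lambda>k. {(m, n) \<in> J r. m\<^sup>2 + n\<^sup>2 < int L \<and> int k \<le> \<bar>m\<bar>}"
  define row where "row = (if even k then (\<lambda>i. int (r * i)) ` {0..a} else (\<lambda>i. - int (r * i)) ` {1..a})"
  define W where "W = {int k, - int k} \<times> row"
  have fin: "finite (?S j)" for j
    by (rule finite_subset[OF _ finite_J_less[of r "int L"]]) auto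
  have "card row = (if even k then a + 1 else a)"
    using assms(1) by (auto simp: row_def card_image inj_on_def)
  moreover have "card {int k, - int k} = (if k = 0 then 1 else 2)" by auto
  ultimately have cW: "card W = (if k = 0 then 1 else 2) * (if even k then a + 1 else a)"
    by (simp only: W_def card_cartesian_product)
  have "W \<subseteq> ?S k"
  proof
    fix z assume "z \<in> W"
    then obtain m n where z: "z = (m, n)" "m = int k \<or> m = - int k" "n \<in> row" by (auto simp: W_def)
    obtain i where i: "i \<le> a" "n = (if even k then int (r * i) else - int (r * i))" "odd k \<longrightarrow> 1 \<le> i"
      using z(3) by (auto simp: row_def split: if_splits)
    have "(r * i)\<^sup>2 \<le> (r * a)\<^sup>2" using i(1) by (intro power_mono) auto
    moreover have "k\<^sup>2 + (r * a)\<^sup>2 < L" using Cons.prems by (simp only: rows_below.simps)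
    ultimately have "k\<^sup>2 + (r * i)\<^sup>2 < L" by (rule order.strict_trans1[OF add_left_mono])
    then have "int (k\<^sup>2 + (r * i)\<^sup>2) < int L" by (simp only: of_nat_less_iff)
    moreover have "m\<^sup>2 = int (k\<^sup>2)" "n\<^sup>2 = int ((r * i)\<^sup>2)" using z(2) i(2) by (auto split: if_splits)
    ultimately have "m\<^sup>2 + n\<^sup>2 < int L" by simp
    moreover have "(m, n) \<in> J r" using z(2) i assms(1) by (auto simp: J_def split: if_splits)
    moreover have "int k \<le> \<bar>m\<bar>" using z(2) by auto
    ultimately show "z \<in> ?S k" using z(1) by simp
  qed
  moreover have "?S (k + 1) \<subseteq> ?S k" by auto
  ultimately have "card (W \<union> ?S (k + 1)) \<le> card (?S k)"
    by (intro card_mono fin) auto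
  moreover have "card (W \<union> ?S (k + 1)) = card W + card (?S (k + 1))"
  proof (rule card_Un_disjoint)
    show "finite W" by (simp add: W_def row_def)
    show "W \<inter> ?S (k + 1) = {}" by (auto simp: W_def)
  qed (rule fin)
  moreover have "row_sum (k + 1) as \<le> card (?S (k + 1))"
    by (rule Cons.IH) (use Cons.prems in simp)
  ultimately show ?case by (simp only: row_sum.simps cW)
qed simp

lemma row_sum_le_count_below:
  assumes "r > 0" "rows_below r lo 0 as" "lo \<le> L"
  shows "row_sum 0 as \<le> count_below r L"
proof -
  have "card {(m, n) \<in> J r. m\<^sup>2 + n\<^sup>2 < int lo} \<le> count_below r L"
    unfolding count_below_def using assms(3) by (intro card_mono finite_J_less) auto
  then show ?thesis using row_sum_le[OF assms(1,2)] by simp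
qed

text \<open>One numerical test serves a whole range of \<open>L\<close>: the left side is at most
  its value for \<open>hi\<close>, \<open>M = s\<close> and the largest multiple of \<open>r\<close>
  up to \<open>s\<close> as \<open>N\<close>, while the count on the right is at least the one at
  \<open>lo\<close>.\<close>

lemma count_sufficesI:
  assumes L: "lo \<le> L" "L \<le> hi" and "r > 0" "rows_below r lo 0 as" and hi: "hi < (s + 1)\<^sup>2"
    and num: "(s + r * (s div r))\<^sup>2 * hi < 2 * r\<^sup>2 * (row_sum 0 as + 1)\<^sup>2"
  shows "count_suffices r L"
  unfolding count_suffices_def
proof (intro allI impI)
  fix M N assume MN: "M\<^sup>2 \<le> L" "N\<^sup>2 \<le> L" "r dvd N"
  have le: "k \<le> s" if "k\<^sup>2 \<le> L" for k
  proof -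
    have "k\<^sup>2 < (s + 1)\<^sup>2" using that L(2) hi by linarith
    then have "k < s + 1" by (rule power_less_imp_less_base) simp
    then show ?thesis by simp
  qed
  have "N div r \<le> s div r" by (rule div_le_mono[OF le[OF MN(2)]])
  then have "r * (N div r) \<le> r * (s div r)" by simp
  then have "N \<le> r * (s div r)" using MN(3) by simp
  then have "M + N \<le> s + r * (s div r)" using le[OF MN(1)] by simp
  then have "(M + N)\<^sup>2 * L \<le> (s + r * (s div r))\<^sup>2 * hi"
    using L(2) by (intro mult_le_mono power_mono) auto
  also have "\<dots> < 2 * r\<^sup>2 * (row_sum 0 as + 1)\<^sup>2" by (rule num)
  also have "\<dots> \<le> 2 * r\<^sup>2 * (count_below r L + 1)\<^sup>2"
    using row_sum_le_count_below[OF assms(3,4) L(1)] by (intro mult_le_mono power_mono) auto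
  finally show "(M + N)\<^sup>2 * L < 2 * r\<^sup>2 * (count_below r L + 1)\<^sup>2" .
qed

text \<open>
  A chunk \<open>(hi, s, as)\<close> starts where the previous one ends. It lists the row lengths \<open>as\<close> of the
  lattice points below its start, and \<open>s\<close> is the integer square root of its last value \<open>hi\<close>.
\<close>

fun chunks_suffice :: "nat \<Rightarrow> nat \<Rightarrow> nat \<Rightarrow> (nat \<times> nat \<times> nat list) list \<Rightarrow> bool" where
  "chunks_suffice r lo en [] = (en \<le> lo)"
| "chunks_suffice r lo en ((hi, s, as) # cs) = (rows_below r lo 0 as \<and> hi < (s + 1)\<^sup>2 \<and>
     (s + r * (s div r))\<^sup>2 * hi < 2 * r\<^sup>2 * (row_sum 0 as + 1)\<^sup>2 \<and> chunks_suffice r (hi + 1) en cs)"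

lemma chunks_suffice:
  assumes "r > 0" "chunks_suffice r lo en cs" "lo \<le> L" "L < en"
  shows "count_suffices r L"
  using assms(2,3)
proof (induction cs arbitrary: lo)
  case Nil
  then show ?case using assms(4) by simp
next
  case (Cons x cs)
  obtain hi s as where x: "x = (hi, s, as)" by (cases x)
  show ?case
  proof (cases "L \<le> hi")
    case True
    show ?thesis
      by (rule count_sufficesI[OF Cons.prems(2) True assms(1), of as s]) (use Cons.prems(1) x in simp_all)
  next
    case False
    show ?thesis
      by (rule Cons.IH[of "hi + 1"]) (use Cons.prems(1) x False in simp_all)
  qed
qed

lemma count_suffices_1_small:
  assumes "8 \<le> L" "L < 196"
  shows "count_suffices 1 L"
proof -
  have "chunks_suffice 1 8 196
     [(8, 2, [2, 2, 1]),
      (10, 3, [2, 2, 2]),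
      (15, 3, [3, 3, 2, 1]),
      (16, 4, [3, 3, 3, 2]),
      (21, 4, [4, 3, 3, 2, 0]),
      (25, 5, [4, 4, 4, 3, 2]),
      (33, 5, [5, 4, 4, 4, 3, 0]),
      (36, 6, [5, 5, 5, 4, 4, 2]),
      (46, 6, [6, 5, 5, 5, 4, 3, 0]),
      (55, 7, [6, 6, 6, 6, 5, 4, 3]),
      (63, 7, [7, 7, 7, 6, 6, 5, 4, 2]),
      (73, 8, [7, 7, 7, 7, 6, 6, 5, 3]),
      (85, 9, [8, 8, 8, 8, 7, 6, 6, 4, 3]),
      (99, 9, [9, 9, 9, 8, 8, 7, 7, 6, 4, 2]),
      (117, 10, [9, 9, 9, 9, 9, 8, 7, 7, 5, 4]),
      (143, 11, [10, 10, 10, 10, 10, 9, 9, 8, 7, 6, 4]),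
      (166, 12, [11, 11, 11, 11, 11, 10, 10, 9, 8, 7, 6, 4]),
      (195, 13, [12, 12, 12, 12, 12, 11, 11, 10, 10, 9, 8, 6, 4])]"
    by (simp del: One_nat_def)
  from chunks_suffice[OF _ this, of L] show ?thesis using assms by simp
qed

text \<open>At \<open>L = 16\<close> the criterion fails: \<open>M = N = 4\<close> gives
  \<open>64 * 16 = 1024\<close> on the left, but the count 10 gives only
  \<open>8 * 121 = 968\<close> on the right. This eigenvalue needs its explicit
  eigenfunctions.\<close>

lemma count_suffices_2_small:
  assumes "8 \<le> L" "L < 484" "L \<noteq> 16"
  shows "count_suffices 2 L"
proof (cases "L < 16")
  case True
  have "chunks_suffice 2 8 16
     [(15, 3, [1, 1, 0])]"
    by (simp del: One_nat_def)
  from chunks_suffice[OF _ this, of L] show ?thesis using assms True by simp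
next
  case False
  have "chunks_suffice 2 17 484
     [(24, 4, [2, 1, 1, 1, 0]),
      (35, 5, [2, 2, 2, 1, 1]),
      (37, 6, [2, 2, 2, 2, 2, 1]),
      (48, 6, [3, 3, 2, 2, 2, 1, 0]),
      (63, 7, [3, 3, 3, 3, 2, 2, 1]),
      (69, 8, [3, 3, 3, 3, 3, 3, 2, 1]),
      (93, 9, [4, 4, 4, 3, 3, 3, 2, 2, 1]),
      (103, 10, [4, 4, 4, 4, 4, 4, 3, 3, 2, 1]),
      (124, 11, [5, 5, 4, 4, 4, 4, 4, 3, 3, 2, 0]),
      (143, 11, [5, 5, 5, 5, 5, 4, 4, 4, 3, 3, 2, 0]),
      (165, 12, [5, 5, 5, 5, 5, 5, 5, 4, 4, 3, 3, 2]),
      (195, 13, [6, 6, 6, 6, 6, 5, 5, 5, 5, 4, 4, 3, 2]),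
      (224, 14, [6, 6, 6, 6, 6, 6, 6, 6, 5, 5, 4, 4, 3, 2]),
      (255, 15, [7, 7, 7, 7, 7, 7, 6, 6, 6, 5, 5, 5, 4, 3, 2]),
      (288, 16, [7, 7, 7, 7, 7, 7, 7, 7, 6, 6, 6, 5, 5, 4, 3, 2]),
      (323, 17, [8, 8, 8, 8, 8, 8, 7, 7, 7, 7, 6, 6, 6, 5, 4, 3, 2]),
      (365, 19, [8, 8, 8, 8, 8, 8, 8, 8, 8, 7, 7, 7, 6, 6, 5, 4, 4, 2]),
      (423, 20, [9, 9, 9, 9, 9, 9, 9, 8, 8, 8, 8, 7, 7, 7, 6, 5, 5, 4, 3, 1]),
      (483, 21, [10, 10, 10, 10, 10, 9, 9, 9, 9, 9, 8, 8, 8, 7, 7, 7, 6, 5, 4, 3, 2])]"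
    by (simp del: One_nat_def)
  from chunks_suffice[OF _ this, of L] show ?thesis using assms False by simp
qed

section \<open>Lattice points and the area of a disc\<close>

text \<open>Subtracting 1 sends odd numbers to even ones and can leave the range for at most one of
  them, the most negative.\<close>

lemma card_odd_le_card_even:
  fixes L :: int
  shows "card {m::int. odd m \<and> m\<^sup>2 < L} \<le> card {m::int. even m \<and> m\<^sup>2 < L} + 1"
proof -
  let ?E = "{m::int. even m \<and> m\<^sup>2 < L}" and ?O = "{m::int. odd m \<and> m\<^sup>2 < L}"
  let ?X = "{m::int. odd m \<and> m\<^sup>2 < L \<and> L \<le> (m - 1)\<^sup>2}"
  have fin: "finite {m::int. m\<^sup>2 < L}"
  proof (rule finite_subset)
    show "{m::int. m\<^sup>2 < L} \<subseteq> {- L..L}"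
    proof
      fix m :: int assume "m \<in> {m. m\<^sup>2 < L}"
      then show "m \<in> {- L..L}" using abs_le_square_int[of m] by auto
    qed
  qed simp
  have finE: "finite ?E" by (rule finite_subset[OF _ fin]) auto
  have eq: "m = m'" if m: "m \<in> ?X" and m': "m' \<in> ?X" for m m'
  proof -
    have neg: "k < 0" if "k \<in> ?X" for k
    proof (rule ccontr)
      assume "\<not> k < 0"
      moreover have "odd k" using that by simp
      ultimately have "k > 0" by (cases "k = 0") auto
      then have "(k - 1)\<^sup>2 \<le> k\<^sup>2" by (intro power_mono) auto
      then show False using that by simp
    qed
    have no: False if k: "k \<in> ?X" "k' \<in> ?X" "k < k'" for k k'
    proof -
      have "odd k" "odd k'" using k by simp_all
      then have "k + 2 \<le> k'" using k(3) by presburger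
      then have "(1 - k')\<^sup>2 \<le> (- k)\<^sup>2" using neg[OF k(2)] by (intro power_mono) auto
      moreover have "(1 - k')\<^sup>2 = (k' - 1)\<^sup>2" by (rule power2_commute)
      ultimately show False using k by simp
    qed
    show ?thesis
      by (rule linorder_cases[of m m']) (use no[OF m m'] no[OF m' m] in blast)+
  qed
  have "?O \<subseteq> (\<lambda>m. m + 1) ` ?E \<union> ?X"
  proof
    fix m assume m: "m \<in> ?O"
    show "m \<in> (\<lambda>m. m + 1) ` ?E \<union> ?X"
    proof (cases "L \<le> (m - 1)\<^sup>2")
      case False
      then have "m - 1 \<in> ?E" using m by simp
      then have "(m - 1) + 1 \<in> (\<lambda>m. m + 1) ` ?E" by (rule imageI)
      then show ?thesis by simp
    qed (use m in simp)
  qed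
  moreover have finX: "finite ?X" by (rule finite_subset[OF _ fin]) auto
  moreover have X1: "card ?X \<le> 1"
    unfolding One_nat_def card_le_Suc0_iff_eq[OF finX] using eq by blast
  ultimately have "card ?O \<le> card ((\<lambda>m. m + 1) ` ?E \<union> ?X)"
    by (intro card_mono) (use finE in auto)
  also have "\<dots> \<le> card ((\<lambda>m. m + 1) ` ?E) + card ?X" by (rule card_Un_le)
  also have "\<dots> \<le> card ?E + 1"
    using card_image_le[OF finE, of "\<lambda>m. m + 1"] X1 by linarith
  finally show ?thesis .
qed

text \<open>\<open>J r\<close> and its mirror image in \<open>n\<close> cover the lattice up to the
  points \<open>(m, 0)\<close> with \<open>m\<close> odd, and they overlap in the points
  \<open>(m, 0)\<close> with \<open>m\<close> even. These two defects differ by at most 1.\<close>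

lemma card_lattice_le_count_below:
  "card {(m::int, n::int). int r dvd n \<and> m\<^sup>2 + n\<^sup>2 < int L} \<le> 2 * count_below r L + 1"
proof -
  let ?A = "{(m, n) \<in> J r. m\<^sup>2 + n\<^sup>2 < int L}"
  let ?f = "\<lambda>(m::int, n::int). (m, - n)"
  let ?E = "(\<lambda>m::int. (m, 0::int)) ` {m. even m \<and> m\<^sup>2 < int L}"
  let ?O = "(\<lambda>m::int. (m, 0::int)) ` {m. odd m \<and> m\<^sup>2 < int L}"
  have finA: "finite ?A" by (rule finite_J_less)
  have fin: "finite {(m::int, n::int). m\<^sup>2 + n\<^sup>2 < int L}"
    by (rule finite_subset[OF _ finite_sum_squares_le[of "int L"]]) auto
  have "?A \<inter> ?f ` ?A = ?E"
    by (auto simp: J_def image_iff split: if_splits)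
  then have 1: "card (?A \<union> ?f ` ?A) + card ?E = card ?A + card (?f ` ?A)"
    using card_Un_Int[OF finA finite_imageI[OF finA, of ?f]] by simp
  have 2: "card (?f ` ?A) \<le> card ?A" by (rule card_image_le[OF finA])
  have 3: "card ?O \<le> card ?E + 1"
    using card_odd_le_card_even[of "int L"] by (simp add: card_image inj_on_def)
  have "{(m::int, n::int). int r dvd n \<and> m\<^sup>2 + n\<^sup>2 < int L} \<subseteq> (?A \<union> ?f ` ?A) \<union> ?O"
  proof
    fix z assume "z \<in> {(m::int, n::int). int r dvd n \<and> m\<^sup>2 + n\<^sup>2 < int L}"
    then obtain m n where z: "z = (m, n)" "int r dvd n" "m\<^sup>2 + n\<^sup>2 < int L" by auto
    consider "(m, n) \<in> J r" | "(m, - n) \<in> J r" | "odd m" "n = 0"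
      using z(2) by (cases "even m"; cases "n = 0"; cases "n < 0") (auto simp: J_def)
    then show "z \<in> (?A \<union> ?f ` ?A) \<union> ?O"
    proof cases
      case 2
      then have "(m, - n) \<in> ?A" using z(3) by simp
      then have "?f (m, - n) \<in> ?f ` ?A" by (rule imageI)
      then show ?thesis using z(1) by simp
    qed (use z in auto)
  qed
  then have "card {(m::int, n::int). int r dvd n \<and> m\<^sup>2 + n\<^sup>2 < int L} \<le> card ((?A \<union> ?f ` ?A) \<union> ?O)"
  proof (rule card_mono[rotated])
    have "finite ?O" by (rule finite_subset[OF _ fin]) auto
    then show "finite ((?A \<union> ?f ` ?A) \<union> ?O)" using finA by blast
  qed
  also have "\<dots> \<le> card (?A \<union> ?f ` ?A) + card ?O" by (rule card_Un_le)
  finally show ?thesis using 1 2 3 unfolding count_below_def by linarith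
qed

text \<open>The cells of size 1 by \<open>r\<close> around the lattice points of norm less than \<open>sqrt L\<close> cover a smaller disc.\<close>

lemma disc_area_le_card_lattice:
  assumes r: "r > 0" and rho: "(1 + (real r)\<^sup>2) / 4 \<le> \<rho>\<^sup>2" "0 \<le> \<rho>" "\<rho> \<le> sqrt L"
  shows "pi * (sqrt L - \<rho>)\<^sup>2 \<le> r * card {(m::int, n::int). int r dvd n \<and> m\<^sup>2 + n\<^sup>2 < int L}"
proof -
  let ?R = "{(m::int, n::int). int r dvd n \<and> m\<^sup>2 + n\<^sup>2 < int L}"
  define cell where "cell = (\<lambda>(m::int, n::int). cbox (real_of_int m - 1/2, real_of_int n - r/2) (real_of_int m + 1/2, real_of_int n + r/2))"
  have fin: "finite ?R"
    by (rule finite_subset[OF _ finite_sum_squares_le[of "int L"]]) auto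
  have cell: "measure lborel (cell z) = r" "cell z \<in> fmeasurable lborel" for z
  proof -
    obtain m n where z: "z = (m, n)" by fastforce
    show "measure lborel (cell z) = r"
      unfolding z cell_def prod.case content_Pair using r by simp
    show "cell z \<in> fmeasurable lborel" unfolding z cell_def prod.case by simp
  qed
  have sub: "ball (0::plane) (sqrt L - \<rho>) \<subseteq> (\<Union>z\<in>?R. cell z)"
  proof
    fix p :: plane assume p: "p \<in> ball 0 (sqrt L - \<rho>)"
    obtain x y where xy: "p = (x, y)" by fastforce
    \<comment> \<open>Rounding to the nearest lattice point moves \<open>p\<close> by at most half
      the diagonal of a cell, a length that \<open>\<rho>\<close> bounds.\<close>
    define m where "m = round x"
    define n where "n = int r * round (y / r)"
    have mx: "\<bar>of_int m - x\<bar> \<le> 1/2" unfolding m_def by (rule of_int_round_abs_le)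
    have ny: "\<bar>of_int n - y\<bar> \<le> r / 2"
    proof -
      have "\<bar>of_int (round (y / r)) - y / r\<bar> * r \<le> 1/2 * r"
        by (intro mult_right_mono of_int_round_abs_le) simp
      moreover have "\<bar>of_int (round (y / r)) - y / r\<bar> * r = \<bar>(of_int (round (y / r)) - y / r) * r\<bar>"
        by (simp add: abs_mult)
      moreover have "(of_int (round (y / r)) - y / r) * r = of_int n - y"
        unfolding left_diff_distrib using r by (simp add: n_def mult.commute)
      ultimately show ?thesis by simp
    qed
    have "norm (of_int m - x, of_int n - y) \<le> \<rho>"
    proof -
      have "(of_int m - x)\<^sup>2 \<le> (1/2)\<^sup>2" "(of_int n - y)\<^sup>2 \<le> (r / 2)\<^sup>2"
        using mx ny by (metis abs_ge_zero power2_abs power_mono)+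
      then have "(of_int m - x)\<^sup>2 + (of_int n - y)\<^sup>2 \<le> \<rho>\<^sup>2"
        using rho(1) by (simp add: power_divide)
      then show ?thesis using rho(2) unfolding norm_Pair by (simp add: real_le_lsqrt)
    qed
    moreover have "norm p < sqrt L - \<rho>" using p by simp
    moreover have "(of_int m, of_int n) = p + (of_int m - x, of_int n - y)" by (simp add: xy)
    ultimately have "norm (of_int m :: real, of_int n :: real) < sqrt L"
      using norm_triangle_ineq[of p "(of_int m - x, of_int n - y)"] by simp
    then have "real_of_int (m\<^sup>2 + n\<^sup>2) < of_int (int L)"
      by (simp add: norm_Pair)
    then have "m\<^sup>2 + n\<^sup>2 < int L" by (simp only: of_int_less_iff)
    then have "(m, n) \<in> ?R" by (simp add: n_def)
    moreover have "p \<in> cell (m, n)"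
    proof -
      have "of_int m - 1 / 2 \<le> x" "x \<le> of_int m + 1 / 2" "of_int n - r / 2 \<le> y" "y \<le> of_int n + r / 2"
        using mx ny by linarith+
      then show ?thesis unfolding cell_def prod.case xy cbox_Pair_eq by simp
    qed
    ultimately show "p \<in> (\<Union>z\<in>?R. cell z)" by blast
  qed
  have "pi * (sqrt L - \<rho>)\<^sup>2 = measure lborel (ball (0::plane) (sqrt L - \<rho>))"
    using rho(3) by (simp add: content_ball unit_ball_vol_2 power2_eq_square)
  also have "\<dots> \<le> measure lborel (\<Union>z\<in>?R. cell z)"
    by (rule measure_mono_fmeasurable[OF sub]) (use fin cell(2) in auto)
  also have "\<dots> \<le> (\<Sum>z\<in>?R. measure lborel (cell z))"
    by (rule measure_UNION_le[OF fin]) (rule fmeasurableD[OF cell(2)])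
  also have "\<dots> = r * card ?R" by (simp add: cell)
  finally show ?thesis .
qed

text \<open>As \<open>M + N\<close> is at most \<open>2 * sqrt L\<close>, the criterion follows from
  \<open>2 * sqrt 2 * L < 2 * r * (count_below r L + 1)\<close>. The fraction 70711 / 25000 is
  slightly above 2 sqrt 2, and 6283 / 2000 slightly below pi. The summand \<open>r\<close> fills the
  gap between \<open>r * (2 * count_below r L + 1)\<close>, which bounds the area, and the right
  side.\<close>

lemma count_suffices_large:
  assumes r: "r > 0" and rho: "(1 + (real r)\<^sup>2) / 4 \<le> \<rho>\<^sup>2" "0 \<le> \<rho>" "\<rho> \<le> sqrt L"
    and num: "70711 / 25000 * real L < 6283 / 2000 * (sqrt L - \<rho>)\<^sup>2 + r"
  shows "count_suffices r L"
  unfolding count_suffices_def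
proof (intro allI impI)
  fix M N assume MN: "M\<^sup>2 \<le> L" "N\<^sup>2 \<le> L" "r dvd N"
  let ?n = "count_below r L"
  have "(M + N)\<^sup>2 \<le> 2 * (M\<^sup>2 + N\<^sup>2)"
  proof -
    have "0 \<le> (int M - int N)\<^sup>2" by simp
    then have "(int M + int N)\<^sup>2 \<le> 2 * ((int M)\<^sup>2 + (int N)\<^sup>2)"
      by (simp add: power2_eq_square algebra_simps)
    then have "int ((M + N)\<^sup>2) \<le> int (2 * (M\<^sup>2 + N\<^sup>2))" by simp
    then show ?thesis by (simp only: of_nat_le_iff)
  qed
  also have "\<dots> \<le> 2 * (L + L)" using MN by (intro mult_le_mono2 add_mono)
  finally have "(M + N)\<^sup>2 \<le> 4 * L" by simp
  then have "(M + N)\<^sup>2 * L \<le> 4 * L * L" by (rule mult_le_mono1)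
  moreover have "4 * L * L < 2 * r\<^sup>2 * (?n + 1)\<^sup>2"
  proof -
    have "6283 / 2000 * (sqrt L - \<rho>)\<^sup>2 \<le> pi * (sqrt L - \<rho>)\<^sup>2"
      using pi_approx by (intro mult_right_mono) auto
    also have "\<dots> \<le> r * card {(m::int, n::int). int r dvd n \<and> m\<^sup>2 + n\<^sup>2 < int L}"
      by (rule disc_area_le_card_lattice[OF r rho])
    also have "\<dots> \<le> real (r * (2 * ?n + 1))"
      unfolding of_nat_mult[symmetric] of_nat_le_iff by (rule mult_le_mono2[OF card_lattice_le_count_below])
    finally have "70711 / 25000 * real L < real (2 * r * (?n + 1))"
      using num by (simp add: algebra_simps)
    then have "(70711 / 25000 * real L)\<^sup>2 < (real (2 * r * (?n + 1)))\<^sup>2"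
      by (intro power_strict_mono) auto
    moreover have "8 * (real L)\<^sup>2 \<le> (70711 / 25000 * real L)\<^sup>2"
      unfolding power_mult_distrib by (intro mult_right_mono) (auto simp: power2_eq_square)
    ultimately have "8 * (real L)\<^sup>2 < (real (2 * r * (?n + 1)))\<^sup>2" by linarith
    then have "real (8 * L\<^sup>2) < real ((2 * r * (?n + 1))\<^sup>2)" by simp
    then have "8 * L\<^sup>2 < (2 * r * (?n + 1))\<^sup>2" by (simp only: of_nat_less_iff)
    moreover have "(2 * r * (?n + 1))\<^sup>2 = 4 * (r\<^sup>2 * (?n + 1)\<^sup>2)"
      by (simp only: power_mult_distrib mult.assoc) simp
    ultimately show ?thesis unfolding power2_eq_square by linarith
  qed
  ultimately show "(M + N)\<^sup>2 * L < 2 * r\<^sup>2 * (?n + 1)\<^sup>2" by linarith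
qed

lemma count_suffices_klein:
  assumes "r \<in> {1, 2}" "8 \<le> L" "(r, L) \<noteq> (2, 16)"
  shows "count_suffices r L"
proof -
  have s2: "(sqrt L)\<^sup>2 = real L" by simp
  consider "r = 1" "L < 196" | "r = 2" "L < 484" | "r = 1" "196 \<le> L" | "r = 2" "484 \<le> L"
    using assms(1) by force
  then show ?thesis
  proof cases
    case 1
    then show ?thesis using assms count_suffices_1_small by simp
  next
    case 2
    then show ?thesis using assms count_suffices_2_small by simp
  next
    case 3
    have "sqrt 196 \<le> sqrt L" using 3(2) by (intro real_sqrt_le_mono) simp
    then have s: "14 \<le> sqrt L" by simp
    \<comment> \<open>Bounding \<open>L\<close> from below by its tangent as a function of
      \<open>sqrt L\<close>, at the start of the range, makes the remaining inequality linear in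
      \<open>L\<close> and \<open>sqrt L\<close>.\<close>
    have "0 \<le> (sqrt L - 14)\<^sup>2" by simp
    then have q: "28 * sqrt L - 196 \<le> L" using s2 by (simp add: power2_diff)
    show ?thesis
    \<comment> \<open>442 / 625 is slightly above sqrt 2 / 2, half the diagonal of a unit
      square.\<close>
    proof (rule count_suffices_large[of _ "442 / 625"])
      have E: "(sqrt L - 442 / 625)\<^sup>2 = L - 884 / 625 * sqrt L + 195364 / 390625"
        unfolding power2_diff s2 by (simp add: power2_eq_square)
      have "70711 / 25000 * real L < 6283 / 2000 * (L - 884 / 625 * sqrt L + 195364 / 390625) + 1"
        using q s by (simp add: algebra_simps)
      then show "70711 / 25000 * real L < 6283 / 2000 * (sqrt L - 442 / 625)\<^sup>2 + r"
        by (simp only: E 3(1) of_nat_1)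
    qed (use 3 s in \<open>auto simp: power2_eq_square\<close>)
  next
    case 4
    have "sqrt 484 \<le> sqrt L" using 4(2) by (intro real_sqrt_le_mono) simp
    then have s: "22 \<le> sqrt L" by simp
    have "0 \<le> (sqrt L - 22)\<^sup>2" by simp
    then have q: "44 * sqrt L - 484 \<le> L" using s2 by (simp add: power2_diff)
    show ?thesis
    \<comment> \<open>11181 / 10000 is slightly above sqrt 5 / 2, half the diagonal of a 1 by 2
      cell.\<close>
    proof (rule count_suffices_large[of _ "11181 / 10000"])
      have E: "(sqrt L - 11181 / 10000)\<^sup>2 = L - 11181 / 5000 * sqrt L + 125014761 / 100000000"
        unfolding power2_diff s2 by (simp add: power2_eq_square)
      have "70711 / 25000 * real L < 6283 / 2000 * (L - 11181 / 5000 * sqrt L + 125014761 / 100000000) + 2"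
        using q s by (simp add: algebra_simps)
      then show "70711 / 25000 * real L < 6283 / 2000 * (sqrt L - 11181 / 10000)\<^sup>2 + r"
        by (simp only: E 4(1) of_nat_numeral)
    qed (use 4 s in \<open>auto simp: power2_eq_square\<close>)
  qed
qed

section \<open>Explicit eigenfunctions\<close>

lemma nodal_count_le:
  assumes "finite Q" "\<And>p. u p \<noteq> 0 \<Longrightarrow> \<exists>q\<in>Q. nodal_domain_at G u p = nodal_domain_at G u q"
  shows "finite (nodal_domains G u)" "card (nodal_domains G u) \<le> card Q"
proof -
  have sub: "nodal_domains G u \<subseteq> nodal_domain_at G u ` Q"
    unfolding nodal_domains_eq using assms(2) by blast
  then show "finite (nodal_domains G u)"
    using assms(1) finite_subset by blast
  have "card (nodal_domains G u) \<le> card (nodal_domain_at G u ` Q)"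
    using sub by (intro card_mono) (use assms(1) in auto)
  also have "\<dots> \<le> card Q" by (rule card_image_le[OF assms(1)])
  finally show "card (nodal_domains G u) \<le> card Q" .
qed

lemma nodal_domain_at_path:
  assumes "continuous_on {0..1} g" "\<And>v. v \<in> {0..1::real} \<Longrightarrow> u (g v) \<noteq> 0"
  shows "nodal_domain_at G u (g 0) = nodal_domain_at G u (g 1)"
proof (rule nodal_domain_at_component)
  have "connected (g ` {0..1})" by (rule connected_continuous_image[OF assms(1)]) simp
  moreover have "g ` {0..1} \<subseteq> {p. u p \<noteq> 0}" using assms(2) by blast
  moreover have "g 0 \<in> g ` {0..1}" "g 1 \<in> g ` {0..1}" by simp_all
  ultimately show "connected_component {p. u p \<noteq> 0} (g 0) (g 1)"
    unfolding connected_component_def by blast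
qed

lemma move_horizontal:
  fixes u :: "plane \<Rightarrow> real"
  assumes "\<And>v. v \<in> {0..1} \<Longrightarrow> u ((1 - v) * x + v * x', y) \<noteq> 0"
  shows "nodal_domain_at G u (x, y) = nodal_domain_at G u (x', y)"
  using nodal_domain_at_path[of "\<lambda>v. ((1 - v) * x + v * x', y)" u G] assms
  by (simp add: continuous_intros)

lemma move_vertical:
  fixes u :: "plane \<Rightarrow> real"
  assumes "\<And>v. v \<in> {0..1} \<Longrightarrow> u (x, (1 - v) * y + v * y') \<noteq> 0"
  shows "nodal_domain_at G u (x, y) = nodal_domain_at G u (x, y')"
  using nodal_domain_at_path[of "\<lambda>v. (x, (1 - v) * y + v * y')" u G] assms
  by (simp add: continuous_intros)

text \<open>For \<open>s < 0\<close> the maxima of \<open>s * cos\<close> are the minima of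
  \<open>cos\<close>, at the odd multiples of \<open>pi\<close>.\<close>

definition phase :: "real \<Rightarrow> real" where "phase s = (if 0 \<le> s then 0 else pi)"

text \<open>Moving \<open>x\<close> to the nearest maximum of \<open>s * cos (k * x - a)\<close> never decreases this function.\<close>

lemma cos_move:
  fixes k x a s :: real
  assumes "k > 0"
  obtains j :: int where "\<And>v. v \<in> {0..1} \<Longrightarrow>
     s * cos (k * x - a) \<le> s * cos (k * ((1 - v) * x + v * ((2 * pi * j + phase s + a) / k)) - a)"
proof -
  define w where "w = k * x - a - phase s"
  define j where "j = round (w / (2 * pi))"
  define d where "d = w - of_int j * (2 * pi)"
  have "\<bar>of_int j - w / (2 * pi)\<bar> * (2 * pi) \<le> 1/2 * (2 * pi)"
    unfolding j_def by (intro mult_right_mono of_int_round_abs_le) simp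
  moreover have "\<bar>of_int j - w / (2 * pi)\<bar> * (2 * pi) = \<bar>(of_int j - w / (2 * pi)) * (2 * pi)\<bar>"
    by (simp add: abs_mult)
  moreover have "(of_int j - w / (2 * pi)) * (2 * pi) = - d"
    by (simp add: d_def left_diff_distrib)
  ultimately have d: "\<bar>d\<bar> \<le> pi" by simp
  have cosd: "s * cos (e + phase s + of_int j * (2 * pi)) = \<bar>s\<bar> * cos e" for e
  proof -
    have "cos (e + phase s + of_int j * (2 * pi)) = cos (e + phase s)"
      by (rule periodic_add_of_int_mult) simp
    then show ?thesis by (simp add: phase_def)
  qed
  show thesis
  proof (rule that[of j])
    fix v :: real assume v: "v \<in> {0..1}"
    have 1: "k * x - a = d + phase s + of_int j * (2 * pi)" by (simp add: d_def w_def)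
    have "k * ((2 * pi * j + phase s + a) / k) = 2 * pi * j + phase s + a" using assms by simp
    then have 2: "k * ((1 - v) * x + v * ((2 * pi * j + phase s + a) / k)) - a = (1 - v) * d + phase s + of_int j * (2 * pi)"
      unfolding distrib_left mult.left_commute[of k] by (simp add: d_def w_def algebra_simps)
    have "\<bar>(1 - v) * d\<bar> \<le> \<bar>d\<bar>" using v by (simp add: abs_mult mult_left_le_one_le)
    then have "cos \<bar>d\<bar> \<le> cos \<bar>(1 - v) * d\<bar>" using d by (intro cos_monotone_0_pi_le) auto
    then have "cos d \<le> cos ((1 - v) * d)" by simp
    then have "\<bar>s\<bar> * cos d \<le> \<bar>s\<bar> * cos ((1 - v) * d)" by (intro mult_left_mono) auto
    then show "s * cos (k * x - a) \<le> s * cos (k * ((1 - v) * x + v * ((2 * pi * j + phase s + a) / k)) - a)"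
      unfolding 1 2 cosd .
  qed
qed

text \<open>This bounds the number of critical points modulo the group. A horizontal step of
  \<open>k div 2\<close> cells is a shift by \<open>pi\<close>, hence amounts to a reflection in
  \<open>y\<close>, which sends row \<open>l\<close> to row \<open>- l\<close> for
  \<open>d = 0\<close> and to row \<open>- l - 1\<close> for \<open>d = pi\<close>. A vertical step
  of \<open>k div r\<close> cells is a translation of the group.\<close>

lemma orbit_lattice_representative:
  fixes k r :: nat and x0 d :: real and j l :: int
  assumes r: "r > 0" "r dvd k" and k: "even k" "k > 0" and d: "d \<in> {0, pi}"
  obtains j' l' where "j' < k div 2" "l' < k div r"
    "orbit_of (klein r) (x0 + 2 * pi * j / k, (2 * pi * l + d) / k) =
     orbit_of (klein r) (x0 + 2 * pi * real j' / k, (2 * pi * real l' + d) / k)"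
proof -
  define h where "h = k div 2"
  have h: "k = 2 * h" "h > 0" using k by (auto simp: h_def)
  define g where "g = k div r"
  have g: "k = r * g" "g > 0" using r k by (auto simp: g_def)
  have vertical: "\<exists>l'<g. orbit_of (klein r) (x, (2 * pi * l + d) / k) = orbit_of (klein r) (x, (2 * pi * real l' + d) / k)" for x and l :: int
  proof -
    define l' q where "l' = nat (l mod int g)" and "q = l div int g"
    have l': "int l' = l mod int g" using g(2) by (simp add: l'_def)
    have "l = int g * q + int l'" unfolding l' q_def by simp
    then have "real_of_int l = real g * of_int q + real l'"
      by (metis of_int_add of_int_mult of_int_of_nat_eq)
    then have "(2 * pi * l + d) / k = (2 * pi * real l' + d) / k + of_int q * (2 * pi / r)"
      using g r(1) by (simp add: field_simps)
    moreover have "l' < g" using l' g(2) by (metis of_nat_0_less_iff of_nat_less_iff pos_mod_bound)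
    ultimately show ?thesis
      using orbit_klein_translate[of r x 0 "(2 * pi * real l' + d) / k" q] by auto
  qed
  define j' q where "j' = nat (j mod int h)" and "q = j div int h"
  have j': "int j' = j mod int h" using h(2) by (simp add: j'_def)
  have "j = int h * q + int j'" unfolding j' q_def by simp
  then have "real_of_int j = real h * of_int q + real j'"
    by (metis of_int_add of_int_mult of_int_of_nat_eq)
  then have x: "x0 + 2 * pi * j / k = x0 + 2 * pi * real j' / k + pi * of_int q"
    using h by (simp add: field_simps)
  have "j' < h" using j' h(2) by (metis of_nat_0_less_iff of_nat_less_iff pos_mod_bound)
  define x' where "x' = x0 + 2 * pi * real j' / k"
  define y where "y = (2 * pi * l + d) / k"
  have "\<exists>l2::int. orbit_of (klein r) (x' + pi * of_int q, y) = orbit_of (klein r) (x', (2 * pi * l2 + d) / k)"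
  proof (cases "even q")
    case True
    then obtain p where "q = 2 * p" by blast
    then have "orbit_of (klein r) (x' + pi * of_int q, y) = orbit_of (klein r) (x', y)"
      using orbit_klein_translate[of r x' p y 0] by (simp add: mult_ac)
    then show ?thesis unfolding y_def by blast
  next
    case False
    then obtain p where q: "q = 2 * p + 1" by (elim oddE)
    then have "x' + pi * of_int q = x' + pi + of_int p * (2 * pi)" by (simp add: algebra_simps)
    then have "orbit_of (klein r) (x' + pi * of_int q, y) = orbit_of (klein r) (x' + pi, y)"
      using orbit_klein_translate[of r "x' + pi" p y 0] by (simp add: add.assoc)
    also have "\<dots> = orbit_of (klein r) (x', - y)"
      using orbit_klein_reflect[of r x' "- y"] by simp
    also have "\<exists>l2::int. - y = (2 * pi * l2 + d) / k"
    proof (cases "d = 0")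
      case True
      then show ?thesis by (intro exI[of _ "- l"]) (simp add: y_def)
    next
      case False
      then have "d = pi" using d by simp
      then show ?thesis by (intro exI[of _ "- l - 1"]) (simp add: y_def minus_divide_left algebra_simps)
    qed
    then obtain l2 :: int where "- y = (2 * pi * l2 + d) / k" ..
    finally show ?thesis by (intro exI[of _ l2])
  qed
  then obtain l2 :: int where l2: "orbit_of (klein r) (x' + pi * of_int q, y) = orbit_of (klein r) (x', (2 * pi * l2 + d) / k)" ..
  obtain l' where l': "l' < g" "orbit_of (klein r) (x', (2 * pi * l2 + d) / k) = orbit_of (klein r) (x', (2 * pi * real l' + d) / k)"
    using vertical by blast
  show thesis
  proof (rule that)
    show "j' < k div 2" "l' < k div r" using \<open>j' < h\<close> l'(1) by (simp_all only: h_def g_def)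
    show "orbit_of (klein r) (x0 + 2 * pi * j / k, (2 * pi * l + d) / k) =
      orbit_of (klein r) (x0 + 2 * pi * real j' / k, (2 * pi * real l' + d) / k)"
      unfolding x using l2 l'(2) by (simp only: x'_def y_def)
  qed
qed

lemma phase_cases: "phase s \<in> {0, pi}"
  by (simp add: phase_def)

text \<open>From a point where \<open>u\<close> has sign \<open>\<sigma>\<close>, move first in
  \<open>x\<close> to a maximum of the first term of \<open>\<sigma> * u\<close>, then in
  \<open>y\<close> to a maximum of the second term. Neither term falls below its initial value, so
  the path stays in the domain. For each of the two signs the end points form at most
  \<open>k div 2 * (k div r)\<close> orbits.\<close>

lemma nodal_count_sum_of_cosines:
  fixes k r :: nat and A B a :: real
  assumes u: "\<And>(x::real) (y::real). u (x, y) = A * cos (k * x - a) + B * cos (k * y)"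
    and r: "r > 0" "r dvd k" and k: "even k" "k > 0"
  shows "card (nodal_domains (klein r) u) \<le> k * (k div r)"
proof -
  define f where "f \<sigma> = (\<lambda>(j, l). ((phase (\<sigma> * A) + a) / k + 2 * pi * real j / k, (2 * pi * real l + phase (\<sigma> * B)) / k))" for \<sigma>
  define I where "I = {..<k div 2} \<times> {..<k div r}"
  define Q where "Q = f 1 ` I \<union> f (- 1) ` I"
  have "card I = k div 2 * (k div r)" by (simp add: I_def)
  moreover have "finite I" by (simp add: I_def)
  ultimately have "card Q \<le> k div 2 * (k div r) + k div 2 * (k div r)"
    using card_Un_le[of "f 1 ` I" "f (- 1) ` I"] card_image_le[of I "f 1"] card_image_le[of I "f (- 1)"]
    unfolding Q_def by linarith
  also have "\<dots> = (2 * (k div 2)) * (k div r)" by simp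
  also have "2 * (k div 2) = k" using k(1) by simp
  finally have cardQ: "card Q \<le> k * (k div r)" .
  have "card (nodal_domains (klein r) u) \<le> card Q"
  proof (rule nodal_count_le(2))
    show "finite Q" by (simp add: Q_def I_def)
    fix p assume p: "u p \<noteq> 0"
    obtain x y where xy: "p = (x, y)" by fastforce
    define \<sigma> where "\<sigma> = sgn (u p)"
    have \<sigma>: "\<sigma> = 1 \<or> \<sigma> = - 1" using p by (auto simp: \<sigma>_def sgn_if)
    have pos: "0 < \<sigma> * A * cos (k * x - a) + \<sigma> * B * cos (k * y)"
    proof -
      have "0 < \<sigma> * u p" using p by (auto simp: \<sigma>_def sgn_if)
      moreover have "u p = A * cos (k * x - a) + B * cos (k * y)" unfolding xy by (rule u)
      ultimately show ?thesis by (simp only: distrib_left mult.assoc)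
    qed
    have nz: "u (x', y') \<noteq> 0" if "0 < \<sigma> * A * cos (k * (x'::real) - a) + \<sigma> * B * cos (k * y')" for x' y' :: real
    proof
      assume "u (x', y') = 0"
      then have "\<sigma> * (A * cos (k * x' - a) + B * cos (k * y')) = 0" by (simp add: u)
      then show False using that by (simp add: algebra_simps)
    qed
    have k0: "0 < real k" using k(2) by simp
    obtain j :: int where j: "\<And>v. v \<in> {0..1} \<Longrightarrow> \<sigma> * A * cos (k * x - a) \<le>
      \<sigma> * A * cos (k * ((1 - v) * x + v * ((2 * pi * j + phase (\<sigma> * A) + a) / k)) - a)"
      using cos_move[OF k0, of "\<sigma> * A" x a] by blast
    obtain l :: int where l: "\<And>v. v \<in> {0..1} \<Longrightarrow> \<sigma> * B * cos (k * y - 0) \<le>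
      \<sigma> * B * cos (k * ((1 - v) * y + v * ((2 * pi * l + phase (\<sigma> * B) + 0) / k)) - 0)"
      using cos_move[OF k0, of "\<sigma> * B" y 0] by blast
    define x' y' where "x' = (2 * pi * j + phase (\<sigma> * A) + a) / k" and "y' = (2 * pi * l + phase (\<sigma> * B)) / k"
    have "nodal_domain_at (klein r) u (x, y) = nodal_domain_at (klein r) u (x', y)"
    proof (rule move_horizontal, rule nz)
      fix v :: real assume "v \<in> {0..1}"
      from j[OF this] show "0 < \<sigma> * A * cos (k * ((1 - v) * x + v * x') - a) + \<sigma> * B * cos (k * y)"
        unfolding x'_def using pos by linarith
    qed
    also have "\<dots> = nodal_domain_at (klein r) u (x', y')"
    proof (rule move_vertical, rule nz)
      fix v :: real assume v: "v \<in> {0..1}"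
      have "\<sigma> * A * cos (k * x - a) \<le> \<sigma> * A * cos (k * x' - a)"
        using j[of 1] unfolding x'_def by simp
      moreover have "\<sigma> * B * cos (k * y) \<le> \<sigma> * B * cos (k * ((1 - v) * y + v * y'))"
        using l[OF v] unfolding y'_def by simp
      ultimately show "0 < \<sigma> * A * cos (k * x' - a) + \<sigma> * B * cos (k * ((1 - v) * y + v * y'))"
        using pos by linarith
    qed
    finally have 1: "nodal_domain_at (klein r) u p = nodal_domain_at (klein r) u (x', y')"
      by (simp only: xy)
    obtain j' l' where jl: "j' < k div 2" "l' < k div r"
      "orbit_of (klein r) ((phase (\<sigma> * A) + a) / k + 2 * pi * j / k, (2 * pi * l + phase (\<sigma> * B)) / k) =
       orbit_of (klein r) ((phase (\<sigma> * A) + a) / k + 2 * pi * real j' / k, (2 * pi * real l' + phase (\<sigma> * B)) / k)"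
      by (rule orbit_lattice_representative[OF r k phase_cases])
    have "x' = (phase (\<sigma> * A) + a) / k + 2 * pi * j / k"
      by (simp add: x'_def add_divide_distrib)
    then have "orbit_of (klein r) (x', y') = orbit_of (klein r) (f \<sigma> (j', l'))"
      using jl(3) by (simp only: y'_def f_def prod.case)
    then have "nodal_domain_at (klein r) u p = nodal_domain_at (klein r) u (f \<sigma> (j', l'))"
      unfolding 1 by (rule nodal_domain_at_orbit)
    moreover have "f \<sigma> (j', l') \<in> Q"
    proof -
      have "(j', l') \<in> I" using jl by (simp add: I_def)
      then show ?thesis using \<sigma> unfolding Q_def by blast
    qed
    ultimately show "\<exists>q\<in>Q. nodal_domain_at (klein r) u p = nodal_domain_at (klein r) u q" by blast
  qed
  then show ?thesis using cardQ by linarith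
qed

text \<open>For \<open>A \<noteq> 0\<close> the zero set cuts the torus into four rectangles, two of
  each sign, and the glide reflection identifies those of equal sign.\<close>

lemma nodal_count_product:
  fixes A a :: real
  assumes u: "\<And>(x::real) (y::real). u (x, y) = A * cos (x - a) * sin y"
  shows "card (nodal_domains (klein 1) u) \<le> 2"
proof -
  let ?Q = "{(a, pi / 2), (a, 3 * pi / 2)}"
  have "card (nodal_domains (klein 1) u) \<le> card ?Q"
  proof (rule nodal_count_le(2))
    fix p assume p: "u p \<noteq> 0"
    obtain x y where xy: "p = (x, y)" by fastforce
    define s t where "s = cos (1 * x - a)" and "t = cos (1 * y - pi / 2)"
    have st: "A \<noteq> 0" "s \<noteq> 0" "t \<noteq> 0" using p by (auto simp: xy u s_def t_def cos_diff)
    have u': "u (x, y) = A * cos (1 * x - a) * cos (1 * y - pi / 2)" for x y :: real by (simp add: u cos_diff)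
    have "0 < s * s" "0 < t * t"
      using st not_real_square_gt_zero by blast+
    then have pos: "0 < s * cos (1 * x - a)" "0 < t * cos (1 * y - pi / 2)"
      by (simp_all only: s_def t_def)
    obtain j :: int where j: "\<And>v. v \<in> {0..1} \<Longrightarrow> s * cos (1 * x - a) \<le>
      s * cos (1 * ((1 - v) * x + v * ((2 * pi * j + phase s + a) / 1)) - a)"
      using cos_move[of 1 s x a] by auto
    obtain l :: int where l: "\<And>v. v \<in> {0..1} \<Longrightarrow> t * cos (1 * y - pi / 2) \<le>
      t * cos (1 * ((1 - v) * y + v * ((2 * pi * l + phase t + pi / 2) / 1)) - pi / 2)"
      using cos_move[of 1 t y "pi / 2"] by auto
    define x' y' where "x' = (2 * pi * j + phase s + a) / 1" and "y' = (2 * pi * l + phase t + pi / 2) / 1"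
    have nz: "u (x, y) \<noteq> 0" if "0 < s * cos (1 * x - a)" "0 < t * cos (1 * y - pi / 2)" for x y :: real
      unfolding u' using that st(1) by (metis less_irrefl mult_eq_0_iff)
    have jx: "0 < s * cos (1 * ((1 - v) * x + v * x') - a)" if "v \<in> {0..1}" for v
      using j[OF that] pos(1) unfolding x'_def by linarith
    have ly: "0 < t * cos (1 * ((1 - v) * y + v * y') - pi / 2)" if "v \<in> {0..1}" for v
      using l[OF that] pos(2) unfolding y'_def by linarith
    have "nodal_domain_at (klein 1) u (x, y) = nodal_domain_at (klein 1) u (x', y)"
      by (intro move_horizontal nz jx pos(2))
    also have "\<dots> = nodal_domain_at (klein 1) u (x', y')"
      by (intro move_vertical nz ly) (use jx[of 1] in simp)
    also have "\<dots> = nodal_domain_at (klein 1) u (a + phase s, phase t + pi / 2)"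
      by (rule nodal_domain_at_orbit)
        (use orbit_klein_translate[of 1 "a + phase s" j "phase t + pi / 2" l] in \<open>simp add: x'_def y'_def algebra_simps\<close>)
    finally have 1: "nodal_domain_at (klein 1) u p = nodal_domain_at (klein 1) u (a + phase s, phase t + pi / 2)"
      by (simp only: xy)
    have "\<exists>q\<in>?Q. orbit_of (klein 1) (a + phase s, phase t + pi / 2) = orbit_of (klein 1) q"
    proof (cases "phase s = 0")
      case True
      then show ?thesis by (simp add: phase_def)
    next
      case False
      then have "orbit_of (klein 1) (a + phase s, phase t + pi / 2) = orbit_of (klein 1) (a, - (phase t + pi / 2))"
        using orbit_klein_reflect[of 1 a "- (phase t + pi / 2)"] by (simp add: phase_def split: if_splits)
      also have "\<dots> = orbit_of (klein 1) (a, - (phase t + pi / 2) + 2 * pi)"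
        using orbit_klein_translate[of 1 a 0 "- (phase t + pi / 2)" 1] by simp
      finally show ?thesis by (simp add: phase_def split: if_splits)
    qed
    then show "\<exists>q\<in>?Q. nodal_domain_at (klein 1) u p = nodal_domain_at (klein 1) u q"
      unfolding 1 using nodal_domain_at_orbit by blast
  qed simp
  also have "\<dots> \<le> 2" by (simp add: card_insert_if)
  finally show ?thesis .
qed

text \<open>By invariance the sets where \<open>u\<close> is positive or negative are unions of
  orbits, so their images in the quotient are open and disjoint. A connected set that avoids the
  zeros cannot meet both.\<close>

lemma nodal_domains_different_sign:
  assumes inv: "\<forall>g\<in>klein r. \<forall>p. u (g p) = u p" and cont: "continuous_on UNIV u"
    and sign: "u p > 0" "u q < 0"
  shows "nodal_domain_at (klein r) u p \<noteq> nodal_domain_at (klein r) u q"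
proof
  let ?O = "orbit_of (klein r)" and ?X = "quotient_plane (klein r)"
  let ?Y = "subtopology ?X (?O ` {p. u p \<noteq> 0})"
  assume eq: "nodal_domain_at (klein r) u p = nodal_domain_at (klein r) u q"
  have "?O q \<in> nodal_domain_at (klein r) u q"
    unfolding nodal_domain_at_def using sign(2) by (auto simp: connected_component_of_refl topspace_quotient_plane)
  then have "?O q \<in> nodal_domain_at (klein r) u p"
    by (simp only: eq)
  then have "connected_component_of ?Y (?O p) (?O q)"
    unfolding nodal_domain_at_def by simp
  then obtain T where T: "connectedin ?Y T" "?O p \<in> T" "?O q \<in> T"
    unfolding connected_component_of_def by blast
  have same: "u v = u w" if "?O v = ?O w" for v w
  proof -
    have "\<one>\<^bsub>BijGroup UNIV\<^esub> \<in> klein r" by (rule subgroup.one_closed[OF subgroup_klein])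
    from orbit_ofI[OF this, of v] have "v \<in> ?O v"
      using BijGroup_apply(2)[OF klein_generators_in_BijGroup(1,1)] by simp
    then have "v \<in> ?O w" using that by simp
    then obtain g where "g \<in> klein r" "v = g w" by (auto simp: orbit_of_def)
    then show ?thesis using inv by blast
  qed
  have op: "openin ?X (?O ` {p. P (u p)})" if "open {p. P (u p)}" for P
  proof -
    have "?O -` (?O ` {p. P (u p)}) = {p. P (u p)}"
    proof (intro equalityI subsetI)
      fix v assume "v \<in> ?O -` (?O ` {p. P (u p)})"
      then obtain w where w: "?O v = ?O w" "P (u w)" by blast
      have "u v = u w" by (rule same[OF w(1)])
      then show "v \<in> {p. P (u p)}" using w(2) by simp
    qed blast
    then show ?thesis unfolding openin_quotient_plane using that by auto
  qed
  have o: "openin ?X (?O ` {p. 0 < u p})" "openin ?X (?O ` {p. u p < 0})"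
    by (intro op open_Collect_less cont continuous_intros)+
  have c: "connectedin ?X T" "T \<subseteq> ?O ` {p. u p \<noteq> 0}"
    using T(1) by (auto simp: connectedin_subtopology)
  have cov: "T \<subseteq> ?O ` {p. 0 < u p} \<union> ?O ` {p. u p < 0}"
  proof
    fix t assume "t \<in> T"
    then obtain v where "t = ?O v" "u v \<noteq> 0" using \<open>T \<subseteq> ?O ` {p. u p \<noteq> 0}\<close> by blast
    then show "t \<in> ?O ` {p. 0 < u p} \<union> ?O ` {p. u p < 0}"
      by (cases "u v > 0") auto
  qed
  have disj: "?O ` {p. 0 < u p} \<inter> ?O ` {p. u p < 0} = {}"
  proof (rule ccontr)
    assume "?O ` {p. 0 < u p} \<inter> ?O ` {p. u p < 0} \<noteq> {}"
    then obtain v w where "u v > 0" "u w < 0" "?O v = ?O w" by blast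
    then show False using same[of v w] by simp
  qed
  have "?O p \<in> ?O ` {p. 0 < u p}" "?O q \<in> ?O ` {p. u p < 0}" using sign by simp_all
  then have ne: "?O ` {p. 0 < u p} \<inter> T \<noteq> {}" "?O ` {p. u p < 0} \<inter> T \<noteq> {}"
    using T(2,3) by (metis IntI empty_iff)+
  have "?O ` {p. 0 < u p} \<inter> ?O ` {p. u p < 0} \<inter> T = {}" unfolding disj by simp
  from connectedinD[OF c(1) o cov this ne] show False .
qed

section \<open>Courant-sharp eigenvalues\<close>

lemma psi_in_eigenspace:
  assumes "r \<in> {1, 2}" "(m, n) \<in> J r"
  shows "psi m n \<in> eigenspace (klein r) (of_int (m\<^sup>2 + n\<^sup>2))"
proof -
  have "\<forall>g\<in>klein r. \<forall>p. psi m n (g p) = psi m n p"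
    unfolding invariant_klein_iff psi_reflect psi_translate[OF assms(1)]
    using assms(2) by (auto simp: J_def split: if_splits)
  then show ?thesis
    by (simp add: eigenspace_def smooth_psi laplacian_psi del: of_int_add)
qed

section \<open>Eigenvalues up to 16 by enumeration\<close>

lemma small_square_cases:
  fixes m :: int
  assumes "m\<^sup>2 \<le> 16"
  shows "m \<in> {- 4, - 3, - 2, - 1, 0, 1, 2, 3, 4}"
proof -
  have "\<bar>m\<bar> \<le> \<bar>4\<bar>"
    unfolding abs_le_square_iff using assms by simp
  then have "- 4 \<le> m \<and> m \<le> 4" by linarith
  then show ?thesis by simp presburger
qed

lemma small_sum_of_squares_cases:
  fixes m n :: int
  assumes "m\<^sup>2 + n\<^sup>2 \<le> 16"
  shows "m \<in> {- 4, - 3, - 2, - 1, 0, 1, 2, 3, 4} \<and> n \<in> {- 4, - 3, - 2, - 1, 0, 1, 2, 3, 4}"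
proof -
  have "m\<^sup>2 \<le> 16" "n\<^sup>2 \<le> 16" using assms zero_le_power2[of m] zero_le_power2[of n] by linarith+
  then show ?thesis by (intro conjI small_square_cases)
qed

text \<open>These are the eigenvalues below 8, the point from which the general bound takes
  over.\<close>

lemma J_small_eigenvalues:
  assumes r: "r \<in> {1, 2}" and mn: "(m, n) \<in> J r" "m\<^sup>2 + n\<^sup>2 = int L" and L: "L < 8"
  shows "L \<in> {0, 4, 5} \<or> r = 1 \<and> L \<in> {1, 2}"
proof -
  have "L = nat (m\<^sup>2 + n\<^sup>2)" using mn(2) by simp
  moreover have "m \<in> {- 4, - 3, - 2, - 1, 0, 1, 2, 3, 4}" "n \<in> {- 4, - 3, - 2, - 1, 0, 1, 2, 3, 4}"
    using small_sum_of_squares_cases[of m n] mn(2) L by linarith+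
  moreover have "r = 1 \<or> r = 2" using r by auto
  ultimately show ?thesis
    using mn(1) L by (elim insertE emptyE disjE) (simp_all add: J_def)
qed

lemma J_two_squares:
  assumes "r \<in> {1, 2}" "k = 2 \<or> k = 4 \<and> r = 2"
  shows "{(m, n) \<in> J r. m\<^sup>2 + n\<^sup>2 = int (k\<^sup>2)} = {(int k, 0), (- int k, 0), (0, int k)}"
proof (intro equalityI subsetI)
  fix z assume "z \<in> {(m, n) \<in> J r. m\<^sup>2 + n\<^sup>2 = int (k\<^sup>2)}"
  then obtain m n where z: "z = (m, n)" and mn: "(m, n) \<in> J r" "m\<^sup>2 + n\<^sup>2 = int (k\<^sup>2)" by blast
  have "m\<^sup>2 + n\<^sup>2 \<le> 16" using mn(2) assms(2) by auto
  then have c: "m \<in> {- 4, - 3, - 2, - 1, 0, 1, 2, 3, 4}" "n \<in> {- 4, - 3, - 2, - 1, 0, 1, 2, 3, 4}"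
    using small_sum_of_squares_cases by blast+
  have "k = 2 \<or> k = 4 \<and> r = 2" "r = 1 \<or> r = 2" using assms by auto
  with c mn show "z \<in> {(int k, 0), (- int k, 0), (0, int k)}"
    unfolding z by (elim insertE emptyE disjE conjE) (simp_all add: J_def)
next
  fix z assume "z \<in> {(int k, 0), (- int k, 0), (0, int k)}"
  then show "z \<in> {(m, n) \<in> J r. m\<^sup>2 + n\<^sup>2 = int (k\<^sup>2)}"
    using assms by (auto simp: J_def)
qed

lemma J_2: "{(m, n) \<in> J 1. m\<^sup>2 + n\<^sup>2 = 2} = {(1, - 1), (- 1, - 1)}"
proof (intro equalityI subsetI)
  fix z assume "z \<in> {(m, n) \<in> J 1. m\<^sup>2 + n\<^sup>2 = 2}"
  then obtain m n where z: "z = (m, n)" and mn: "(m, n) \<in> J 1" "m\<^sup>2 + n\<^sup>2 = 2" by blast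
  have "m\<^sup>2 + n\<^sup>2 \<le> 16" using mn(2) by simp
  then have c: "m \<in> {- 4, - 3, - 2, - 1, 0, 1, 2, 3, 4}" "n \<in> {- 4, - 3, - 2, - 1, 0, 1, 2, 3, 4}"
    using small_sum_of_squares_cases by blast+
  with mn show "z \<in> {(1, - 1), (- 1, - 1)}"
    unfolding z by (elim insertE emptyE) (simp_all add: J_def)
qed (auto simp: J_def)

lemma card_J_le:
  assumes "b < 1 \<or> r = 1 \<and> b = 1 \<or> r = 2 \<and> b < 4"
  shows "card {(m, n) \<in> J r. m\<^sup>2 + n\<^sup>2 \<le> b} \<le> (if b < 1 \<or> r = 2 then 1 else 2)"
proof -
  have "{(m, n) \<in> J r. m\<^sup>2 + n\<^sup>2 \<le> b} \<subseteq> (if b < 1 \<or> r = 2 then {(0, 0)} else {(0, 0), (0, 1)})"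
  proof
    fix z assume "z \<in> {(m, n) \<in> J r. m\<^sup>2 + n\<^sup>2 \<le> b}"
    then obtain m n where z: "z = (m, n)" and mn: "(m, n) \<in> J r" "m\<^sup>2 + n\<^sup>2 \<le> b" by blast
    have "m\<^sup>2 + n\<^sup>2 \<le> 16" using mn(2) assms by auto
    then have c: "m \<in> {- 4, - 3, - 2, - 1, 0, 1, 2, 3, 4}" "n \<in> {- 4, - 3, - 2, - 1, 0, 1, 2, 3, 4}"
      using small_sum_of_squares_cases by blast+
    with mn assms show "z \<in> (if b < 1 \<or> r = 2 then {(0, 0)} else {(0, 0), (0, 1)})"
      unfolding z by (elim insertE emptyE) (auto simp: J_def)
  qed
  then have "card {(m, n) \<in> J r. m\<^sup>2 + n\<^sup>2 \<le> b} \<le> card (if b < 1 \<or> r = 2 then {(0::int, 0::int)} else {(0, 0), (0, 1)})"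
    by (intro card_mono) auto
  also have "\<dots> \<le> (if b < 1 \<or> r = 2 then 1 else 2)" by simp
  finally show ?thesis .
qed

lemma real_of_int_eq_real_iff: "real_of_int i = real n \<longleftrightarrow> i = int n"
  using of_int_eq_iff[of i "int n", where 'a = real] by (simp only: of_int_of_nat_eq)

text \<open>The eigenspace is spanned by the cosine and sine of \<open>k * x\<close> and the cosine
  of \<open>k * y\<close>; the sine of \<open>k * y\<close> is odd under the glide reflection and
  drops out. Polar coordinates merge the first two into one shifted cosine.\<close>

lemma nodal_count_one_frequency:
  assumes r: "r \<in> {1, 2}" and k: "k = 2 \<or> k = 4 \<and> r = 2"
    and u: "u \<in> eigenspace (klein r) (real (k\<^sup>2))"
  shows "card (nodal_domains (klein r) u) \<le> k * (k div r)"
proof -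
  have k0: "k > 0" "even k" "r dvd k" "r > 0" using k r by auto
  have K: "{(m, n) \<in> J r. real_of_int (m\<^sup>2 + n\<^sup>2) = real (k\<^sup>2)} = {(int k, 0), (- int k, 0), (0, int k)}"
    using J_two_squares[OF r k] by (simp only: real_of_int_eq_real_iff)
  obtain c where c: "u = (\<lambda>p. \<Sum>(m, n)\<in>{(int k, 0), (- int k, 0), (0, int k)}. c m n * psi m n p)"
    using u unfolding eigenspace_klein[OF r] K by blast
  obtain A a where Aa: "c (int k) 0 = A * cos a" "c (- int k) 0 = A * sin a"
    using polar_Ex by blast
  have "u (x, y) = A * cos (k * x - a) + c 0 (int k) * cos (k * y)" for x y :: real
    unfolding c using k0(1) by (simp add: psi_def trig_def Aa cos_diff algebra_simps)
  then show ?thesis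
    using nodal_count_sum_of_cosines[of u A k a "c 0 (int k)" r] k0 by blast
qed

lemma nodal_count_eigenvalue_2:
  assumes u: "u \<in> eigenspace (klein 1) 2"
  shows "card (nodal_domains (klein 1) u) \<le> 2"
proof -
  have r1: "(1::nat) \<in> {1, 2}" by simp
  have K: "{(m, n) \<in> J 1. real_of_int (m\<^sup>2 + n\<^sup>2) = 2} = {(1, - 1), (- 1, - 1)}"
    using J_2 by (simp only: of_int_eq_numeral_iff)
  obtain c where c: "u = (\<lambda>p. \<Sum>(m, n)\<in>{(1, - 1), (- 1, - 1)}. c m n * psi m n p)"
    using u unfolding eigenspace_klein[OF r1] K by blast
  obtain A a where Aa: "c 1 (- 1) = A * cos a" "c (- 1) (- 1) = A * sin a"
    using polar_Ex by blast
  have "u (x, y) = A * cos (x - a) * sin y" for x y :: real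
    unfolding c by (simp add: psi_def trig_def Aa cos_diff algebra_simps)
  then show ?thesis by (rule nodal_count_product)
qed

lemma nodal_count_eigenvalue_bound:
  assumes r: "r \<in> {1, 2}" and L: "L \<ge> 5" and u: "u \<in> eigenspace (klein r) (real L)"
    and nz: "u p0 \<noteq> 0" and fin: "finite (nodal_domains (klein r) u)"
  obtains M N where "M\<^sup>2 \<le> L" "N\<^sup>2 \<le> L" "r dvd N"
    "\<And>k. k \<le> pi \<Longrightarrow> k\<^sup>2 * real L < 8 * pi\<^sup>2 \<Longrightarrow> k * card (nodal_domains (klein r) u) < 2 * pi * (M + N) / r"
proof -
  \<comment> \<open>\<open>M\<close> is the integer square root of \<open>L\<close>, and
    \<open>N\<close> the largest multiple of \<open>r\<close> up to \<open>M\<close>. The assumption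
    on \<open>L\<close> gives \<open>M \<ge> 2\<close>, which keeps \<open>N\<close> positive for
    \<open>r = 2\<close> as well.\<close>
  define M where "M = nat \<lfloor>sqrt L\<rfloor>"
  define N where "N = r * (M div r)"
  have s2: "2 \<le> sqrt L" using L by (intro real_le_rsqrt) simp
  then have M2: "2 \<le> M" unfolding M_def by linarith
  have intM: "int M = \<lfloor>sqrt L\<rfloor>" using s2 by (simp add: M_def)
  then have "real M \<le> sqrt L" by linarith
  then have "(real M)\<^sup>2 \<le> (sqrt L)\<^sup>2" by (intro power_mono) auto
  then have Msq: "M\<^sup>2 \<le> L" by (simp flip: of_nat_power)
  have NM: "N \<le> M" by (simp add: N_def)
  have N1: "1 \<le> N" using M2 r by (auto simp: N_def)
  have "N\<^sup>2 \<le> M\<^sup>2" using NM by (intro power_mono) auto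
  then have Nsq: "N\<^sup>2 \<le> L" using Msq by (rule order.trans)
  have leM: "\<bar>m\<bar> \<le> int M" if "m\<^sup>2 \<le> int L" for m
  proof -
    have "real_of_int (m\<^sup>2) \<le> of_int (int L)" using that by (simp only: of_int_le_iff)
    then have "sqrt ((real_of_int m)\<^sup>2) \<le> sqrt L" by (intro real_sqrt_le_mono) simp
    then have "real_of_int \<bar>m\<bar> \<le> sqrt L" by simp
    then show ?thesis unfolding intM by (simp only: le_floor_iff)
  qed
  have leN: "\<bar>n\<bar> \<le> int N" if "n\<^sup>2 \<le> int L" "int r dvd n" for n
  proof -
    have "\<bar>n\<bar> div int r \<le> int M div int r"
      using leM[OF that(1)] r by (intro zdiv_mono1) auto
    then have "int r * (\<bar>n\<bar> div int r) \<le> int r * (int M div int r)" by (intro mult_left_mono) auto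
    moreover have "int r * (\<bar>n\<bar> div int r) = \<bar>n\<bar>" using that(2) by simp
    ultimately show ?thesis by (simp add: N_def zdiv_int)
  qed
  let ?K = "{(m, n) \<in> J r. real_of_int (m\<^sup>2 + n\<^sup>2) = real L}"
  obtain c where c: "u = (\<lambda>p. \<Sum>(m, n)\<in>?K. c m n * psi m n p)"
    using u unfolding eigenspace_klein[OF r] by blast
  define c' where "c' m n = (if (m, n) \<in> ?K then c m n else 0)" for m n
  have K: "\<bar>m\<bar> \<le> int M \<and> \<bar>n\<bar> \<le> int N" if "(m, n) \<in> ?K" for m n
  proof -
    have "m\<^sup>2 + n\<^sup>2 = int L" using that by (simp only: real_of_int_eq_real_iff mem_Collect_eq prod.case)
    then have "m\<^sup>2 \<le> int L" "n\<^sup>2 \<le> int L" using zero_le_power2[of m] zero_le_power2[of n] by linarith+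
    moreover have "int r dvd n" using that by (simp add: J_def)
    ultimately show ?thesis using leM leN by blast
  qed
  have u_eq: "u = (\<lambda>p. \<Sum>m = - int M..int M. \<Sum>n = - int N..int N. c' m n * psi m n p)"
  proof
    fix p
    have "u p = (\<Sum>z\<in>?K. c' (fst z) (snd z) * psi (fst z) (snd z) p)"
      unfolding c by (intro sum.cong HOL.refl) (auto simp: c'_def)
    also have "\<dots> = (\<Sum>z\<in>{- int M..int M} \<times> {- int N..int N}. c' (fst z) (snd z) * psi (fst z) (snd z) p)"
    proof (rule sum.mono_neutral_left)
      show "?K \<subseteq> {- int M..int M} \<times> {- int N..int N}"
      proof
        fix z assume z: "z \<in> ?K"
        obtain m n where mn: "z = (m, n)" by fastforce
        show "z \<in> {- int M..int M} \<times> {- int N..int N}"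
          using K[of m n] z unfolding mn by (auto simp: abs_le_iff)
      qed
    qed (auto simp: c'_def)
    finally show "u p = (\<Sum>m = - int M..int M. \<Sum>n = - int N..int N. c' m n * psi m n p)"
      by (simp only: sum.cartesian_product case_prod_unfold)
  qed
  have coeff: "(m, n) \<in> J r \<and> of_int (m\<^sup>2 + n\<^sup>2) = real L" if "c' m n \<noteq> 0" for m n
    using that by (simp add: c'_def split: if_splits)
  have "\<exists>p. u p \<noteq> 0" using nz by - (rule exI)
  from r u_eq coeff this interpret klein_eigenfunction r u c' M N "real L"
    by (rule klein_eigenfunction.intro) (use M2 N1 in simp_all)
  obtain P where P: "P \<subseteq> {p. u p \<noteq> 0}" "inj_on (nodal_domain_at (klein r) u) P"
    "nodal_domains (klein r) u = nodal_domain_at (klein r) u ` P"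
    using subset_image_inj[of "nodal_domains (klein r) u" "nodal_domain_at (klein r) u" "{p. u p \<noteq> 0}"]
    by (auto simp: nodal_domains_eq)
  have finP: "finite P" using fin P(2,3) finite_imageD by metis
  have cardP: "card (nodal_domains (klein r) u) = card P" unfolding P(3) by (rule card_image[OF P(2)])
  have "P \<noteq> {}"
  proof
    assume "P = {}"
    then have "nodal_domains (klein r) u = {}" using P(3) by simp
    moreover have "nodal_domain_at (klein r) u p0 \<in> nodal_domains (klein r) u"
      unfolding nodal_domains_eq using nz by (intro imageI) simp
    ultimately show False by blast
  qed
  show thesis
  proof (rule that[OF Msq Nsq])
    show "r dvd N" by (simp add: N_def)
    show "k * card (nodal_domains (klein r) u) < 2 * pi * (M + N) / r"
      if "k \<le> pi" "k\<^sup>2 * real L < 8 * pi\<^sup>2" for k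
      unfolding cardP by (rule nodal_count_bound[OF finP _ P(2) \<open>P \<noteq> {}\<close> that]) (use P(1) Z_def in simp)
  qed
qed

lemma nodal_count_le_count_below:
  assumes r: "r \<in> {1, 2}" and L: "8 \<le> L" "(r, L) \<noteq> (2, 16)" and u: "u \<in> eigenspace (klein r) (real L)"
    and nz: "u p0 \<noteq> 0" and fin: "finite (nodal_domains (klein r) u)"
  shows "card (nodal_domains (klein r) u) \<le> count_below r L"
proof (rule ccontr)
  assume "\<not> card (nodal_domains (klein r) u) \<le> count_below r L"
  then have k: "count_below r L + 1 \<le> card (nodal_domains (klein r) u)" (is "_ \<le> ?k") by simp
  have "5 \<le> L" using L(1) by simp
  then obtain M N where MN: "M\<^sup>2 \<le> L" "N\<^sup>2 \<le> L" "r dvd N"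
    and bound: "\<And>k. k \<le> pi \<Longrightarrow> k\<^sup>2 * real L < 8 * pi\<^sup>2 \<Longrightarrow> k * ?k < 2 * pi * (M + N) / r"
    by (rule nodal_count_eigenvalue_bound[OF r _ u nz fin]) (rule that)
  have "(M + N)\<^sup>2 * L < 2 * r\<^sup>2 * (count_below r L + 1)\<^sup>2"
    using count_suffices_klein[OF r L] MN unfolding count_suffices_def by blast
  also have "\<dots> \<le> 2 * r\<^sup>2 * ?k\<^sup>2" using k by (intro mult_le_mono2 power_mono) auto
  finally have "real ((M + N)\<^sup>2 * L) < real (2 * r\<^sup>2 * ?k\<^sup>2)" by (simp only: of_nat_less_iff)
  then have less: "(real (M + N))\<^sup>2 * real L < 2 * (real r)\<^sup>2 * (real ?k)\<^sup>2" by simp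
  have r0: "real r > 0" using r by auto
  have k0: "real ?k > 0" using k by simp
  \<comment> \<open>The value of \<open>k\<close> for which the strict inequality
    \<open>bound\<close> would become an equality. The criterion \<open>count_suffices\<close> makes
    it admissible, and \<open>L \<ge> 8\<close> makes it at most \<open>pi\<close>; so
    \<open>bound\<close> contradicts itself.\<close>
  define \<kappa> where "\<kappa> = 2 * pi * real (M + N) / (real r * real ?k)"
  have "\<kappa>\<^sup>2 * real L = 4 * pi\<^sup>2 * ((real (M + N))\<^sup>2 * real L) / ((real r)\<^sup>2 * (real ?k)\<^sup>2)"
    by (simp only: \<kappa>_def power_divide power_mult_distrib) simp
  also have "\<dots> < 4 * pi\<^sup>2 * (2 * (real r)\<^sup>2 * (real ?k)\<^sup>2) / ((real r)\<^sup>2 * (real ?k)\<^sup>2)"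
    using less r0 k0 by (intro divide_strict_right_mono mult_strict_left_mono) auto
  also have "\<dots> = 8 * pi\<^sup>2" using r0 k0 by simp
  finally have lt: "\<kappa>\<^sup>2 * real L < 8 * pi\<^sup>2" .
  have "\<kappa>\<^sup>2 * 8 \<le> \<kappa>\<^sup>2 * real L" using L(1) by (intro mult_left_mono) auto
  then have "\<kappa>\<^sup>2 \<le> pi\<^sup>2" using lt by linarith
  then have "\<kappa> \<le> pi" by (rule power2_le_imp_le) simp
  from bound[OF this lt] have "\<kappa> * real ?k < 2 * pi * real (M + N) / real r" .
  moreover have "\<kappa> * real ?k = 2 * pi * real (M + N) / real r" using k0 by (simp add: \<kappa>_def)
  ultimately show False by simp
qed

lemma count_below_small:
  "4 \<le> count_below 1 4" "7 \<le> count_below 1 5" "4 \<le> count_below 2 5" "10 \<le> count_below 2 16"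
  using row_sum_le_count_below[of 1 4 "[1, 1]" 4] row_sum_le_count_below[of 1 5 "[2, 1, 0]" 5]
    row_sum_le_count_below[of 2 5 "[1, 0, 0]" 5] row_sum_le_count_below[of 2 16 "[1, 1, 1, 1]" 16]
  by (simp_all del: One_nat_def)

text \<open>Since 5 < 8, the extreme value \<open>k = pi\<close> is admissible in the weight bound
  and leaves fewer than \<open>8 / r\<close> domains: at most 7 for \<open>r = 1\<close> and at most
  3 for \<open>r = 2\<close>, which the counts in \<open>count_below_small\<close> match or
  exceed.\<close>

lemma nodal_count_eigenvalue_5:
  assumes r: "r \<in> {1, 2}" and u: "u \<in> eigenspace (klein r) 5"
    and nz: "u p0 \<noteq> 0" and fin: "finite (nodal_domains (klein r) u)"
  shows "card (nodal_domains (klein r) u) \<le> count_below r 5"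
proof -
  have u5: "u \<in> eigenspace (klein r) (real 5)" using u by simp
  obtain M N :: nat where MN: "M\<^sup>2 \<le> 5" "N\<^sup>2 \<le> 5"
    and bound: "\<And>k. k \<le> pi \<Longrightarrow> k\<^sup>2 * real 5 < 8 * pi\<^sup>2 \<Longrightarrow> k * card (nodal_domains (klein r) u) < 2 * pi * (M + N) / r"
    using nodal_count_eigenvalue_bound[OF r _ u5 nz fin] by (metis order_refl)
  have le: "k \<le> 2" if "k\<^sup>2 \<le> 5" for k :: nat
  proof (rule ccontr)
    assume "\<not> k \<le> 2"
    then have "3\<^sup>2 \<le> k\<^sup>2" by (intro power_mono) auto
    then show False using that by simp
  qed
  have "pi * card (nodal_domains (klein r) u) < 2 * pi * (M + N) / r"
    by (rule bound) simp_all
  also have "\<dots> \<le> 2 * pi * 4 / r"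
    using le[OF MN(1)] le[OF MN(2)] by (intro divide_right_mono mult_left_mono) auto
  also have "\<dots> = pi * (8 / r)" by simp
  finally have less: "card (nodal_domains (klein r) u) < 8 / real r"
    unfolding mult_less_cancel_left_pos[OF pi_gt_zero] .
  have "r = 1 \<or> r = 2" using r by auto
  then show ?thesis
  proof
    assume "r = 1"
    then show ?thesis using less count_below_small(2) by simp
  next
    assume "r = 2"
    then show ?thesis using less count_below_small(3) by simp
  qed
qed

lemma not_courant_sharp_klein:
  assumes r: "r \<in> {1, 2}" and k: "k \<ge> 3"
  shows "\<not> courant_sharp (klein r) k"
proof
  assume "courant_sharp (klein r) k"
  then obtain u p0 where u: "u \<in> eigenspace (klein r) (eigenvalue (klein r) k)" and nz: "u p0 \<noteq> 0"
    and fin: "finite (nodal_domains (klein r) u)" and card: "card (nodal_domains (klein r) u) = k"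
    unfolding courant_sharp_def by blast
  obtain L where L: "eigenvalue (klein r) k = real L"
    "card {(m, n) \<in> J r. m\<^sup>2 + n\<^sup>2 < int L} \<le> k - 1"
    "k - 1 < card {(m, n) \<in> J r. m\<^sup>2 + n\<^sup>2 \<le> int L}"
    by (rule eigenvalue_klein[OF r])
  have uL: "u \<in> eigenspace (klein r) (real L)" using u L(1) by simp
  have no: False if "card (nodal_domains (klein r) u) \<le> count_below r L"
    using that card L(2) k unfolding count_below_def by linarith
  show False
  proof (cases "8 \<le> L")
    case True
    show False
    proof (cases "(r, L) = (2, 16)")
      case False
      show False by (rule no[OF nodal_count_le_count_below[OF r True False uL nz fin]])
    next
      case eq: True
      have "card (nodal_domains (klein r) u) \<le> 4 * (4 div r)"
        by (rule nodal_count_one_frequency[OF r]) (use eq uL in simp_all)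
      then show False using eq no count_below_small(4) by simp
    qed
  next
    case False
    have "{(m, n) \<in> J r. real_of_int (m\<^sup>2 + n\<^sup>2) = real L} \<noteq> {}"
    proof
      assume e: "{(m, n) \<in> J r. real_of_int (m\<^sup>2 + n\<^sup>2) = real L} = {}"
      obtain c where "u = (\<lambda>p. \<Sum>(m, n)\<in>{(m, n) \<in> J r. real_of_int (m\<^sup>2 + n\<^sup>2) = real L}. c m n * psi m n p)"
        using uL unfolding eigenspace_klein[OF r] by blast
      then have "u p0 = 0" unfolding e by simp
      then show False using nz by simp
    qed
    then obtain m n where mn: "(m, n) \<in> J r" "real_of_int (m\<^sup>2 + n\<^sup>2) = real L" by blast
    have "m\<^sup>2 + n\<^sup>2 = int L" using mn(2) by (simp only: real_of_int_eq_real_iff)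
    then have "L \<in> {0, 4, 5} \<or> r = 1 \<and> L \<in> {1, 2}"
      using J_small_eigenvalues[OF r mn(1)] False by simp
    then consider "L = 0" | "r = 1" "L = 1" | "r = 1" "L = 2" | "L = 4" | "L = 5" by auto
    then show False
    proof cases
      case 1
      then show False using L(3) card_J_le[of 0 r] k by simp
    next
      case 2
      then show False using L(3) card_J_le[of 1 1] k by simp
    next
      case 3
      then have "card (nodal_domains (klein 1) u) \<le> 2"
        using nodal_count_eigenvalue_2[of u] uL by simp
      then show False using 3 card k by simp
    next
      case 4
      have le: "card (nodal_domains (klein r) u) \<le> 2 * (2 div r)"
        by (rule nodal_count_one_frequency[OF r]) (use 4 uL in simp_all)
      have "r = 1 \<or> r = 2" using r by auto
      then show False
      proof
        assume "r = 1"
        then show False using le no 4 count_below_small(1) by simp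
      next
        assume "r = 2"
        \<comment> \<open>Here only one eigenvalue lies below 4, so comparison with
          \<open>count_below\<close> cannot work: the labels 2, 3 and 4 share the eigenvalue 4, and
          2 is sharp. The labels 3 and 4 are excluded because no eigenfunction has more than two
          domains.\<close>
        then show False using le card k by simp
      qed
    next
      case 5
      have "card (nodal_domains (klein r) u) \<le> count_below r 5"
        by (rule nodal_count_eigenvalue_5[OF r _ nz fin]) (use 5 uL in simp)
      then show False using no 5 by simp
    qed
  qed
qed

lemma courant_sharp_klein_1:
  assumes r: "r \<in> {1, 2}"
  shows "courant_sharp (klein r) 1"
proof -
  obtain L where L: "eigenvalue (klein r) 1 = real L" "card {(m, n) \<in> J r. m\<^sup>2 + n\<^sup>2 < int L} \<le> 1 - 1"
    "1 - 1 < card {(m, n) \<in> J r. m\<^sup>2 + n\<^sup>2 \<le> int L}"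
    by (rule eigenvalue_klein[OF r])
  have "L = 0"
  proof (rule ccontr)
    assume "L \<noteq> 0"
    then have "(0, 0) \<in> {(m, n) \<in> J r. m\<^sup>2 + n\<^sup>2 < int L}" by (simp add: J_def)
    then have "card {(m, n) \<in> J r. m\<^sup>2 + n\<^sup>2 < int L} \<noteq> 0"
      using card_0_eq[OF finite_J_less[of r "int L"]] by blast
    then show False using L(2) by simp
  qed
  let ?u = "psi 0 0" and ?G = "klein r"
  have u: "?u p = 1" for p by (simp add: psi_def)
  have "?u \<in> eigenspace ?G (eigenvalue ?G 1)"
    using psi_in_eigenspace[OF r, of 0 0] L(1) \<open>L = 0\<close> by (simp add: J_def)
  moreover have all: "\<exists>q\<in>{(0, 0)}. nodal_domain_at ?G ?u p = nodal_domain_at ?G ?u q" for p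
  proof -
    obtain x y where p: "p = (x, y)" by fastforce
    have "nodal_domain_at ?G ?u (x, y) = nodal_domain_at ?G ?u (0, y)"
      by (rule move_horizontal) (simp add: u)
    also have "\<dots> = nodal_domain_at ?G ?u (0, 0)"
      by (rule move_vertical) (simp add: u)
    finally show ?thesis by (simp only: p bex_simps singleton_iff) blast
  qed
  have fin: "finite (nodal_domains ?G ?u)" by (rule nodal_count_le(1)[OF _ all]) simp
  moreover have "card (nodal_domains ?G ?u) = 1"
  proof (rule antisym)
    show "card (nodal_domains ?G ?u) \<le> 1"
      using nodal_count_le(2)[OF _ all] by simp
    have "nodal_domain_at ?G ?u (0, 0) \<in> nodal_domains ?G ?u"
      unfolding nodal_domains_eq by (intro imageI) (simp add: u)
    then have "nodal_domains ?G ?u \<noteq> {}" by blast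
    then have "card (nodal_domains ?G ?u) \<noteq> 0" using fin by simp
    then show "1 \<le> card (nodal_domains ?G ?u)" by simp
  qed
  moreover have "\<exists>p. ?u p \<noteq> 0" using u by auto
  ultimately show ?thesis unfolding courant_sharp_def by blast
qed

text \<open>The eigenfunction is \<open>cos (r * y)\<close>, a single oscillation over the vertical
  period. Its domains are the strips around \<open>y = 0\<close> and \<open>y = pi / r\<close>, kept
  apart in the quotient by the sign.\<close>

lemma courant_sharp_klein_2:
  assumes r: "r \<in> {1, 2}"
  shows "courant_sharp (klein r) 2"
proof -
  let ?u = "psi 0 (int r)" and ?G = "klein r"
  obtain L where L: "eigenvalue ?G 2 = real L" "card {(m, n) \<in> J r. m\<^sup>2 + n\<^sup>2 < int L} \<le> 2 - 1"
    "2 - 1 < card {(m, n) \<in> J r. m\<^sup>2 + n\<^sup>2 \<le> int L}"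
    by (rule eigenvalue_klein[OF r])
  have r0: "0 < r" using r by auto
  have "r\<^sup>2 \<le> L"
  proof (rule ccontr)
    assume "\<not> r\<^sup>2 \<le> L"
    then have "int L < 1 \<or> r = 2 \<and> int L < 4" using r by auto
    then have "card {(m, n) \<in> J r. m\<^sup>2 + n\<^sup>2 \<le> int L} \<le> 1"
      using card_J_le[of "int L" r] by (auto split: if_splits)
    then show False using L(3) by simp
  qed
  moreover have "L \<le> r\<^sup>2"
  proof (rule ccontr)
    assume "\<not> L \<le> r\<^sup>2"
    then have "int (r\<^sup>2) < int L" by (simp only: not_le of_nat_less_iff)
    then have "{(0, 0), (0, int r)} \<subseteq> {(m, n) \<in> J r. m\<^sup>2 + n\<^sup>2 < int L}"
      by (auto simp: J_def)
    then have "card {(0::int, 0::int), (0, int r)} \<le> card {(m, n) \<in> J r. m\<^sup>2 + n\<^sup>2 < int L}"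
      by (intro card_mono finite_J_less)
    then show False using L(2) r0 by simp
  qed
  ultimately have Lr: "L = r\<^sup>2" by simp
  have u: "?u (x, y) = cos (r * y)" for x y :: real by (simp add: psi_def trig_def)
  have E: "?u \<in> eigenspace ?G (eigenvalue ?G 2)"
    using psi_in_eigenspace[OF r, of 0 "int r"] L(1) Lr by (simp add: J_def)
  \<comment> \<open>One maximum and one minimum of \<open>cos (r * y)\<close>; every point is moved
    to one of them within its domain, up to a translation of the group.\<close>
  let ?Q = "{(0 :: real, 0 :: real), (0, pi / r)}"
  have all: "\<exists>q\<in>?Q. nodal_domain_at ?G ?u p = nodal_domain_at ?G ?u q" if p: "?u p \<noteq> 0" for p
  proof -
    obtain x y where xy: "p = (x, y)" by fastforce
    define s where "s = cos (r * y - 0)"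
    have "s \<noteq> 0" using p by (simp add: xy u s_def)
    then have "0 < s * s" using not_real_square_gt_zero by blast
    then have pos: "0 < s * cos (r * y - 0)" by (simp only: s_def)
    obtain l :: int where l: "\<And>v. v \<in> {0..1} \<Longrightarrow> s * cos (r * y - 0) \<le>
      s * cos (r * ((1 - v) * y + v * ((2 * pi * l + phase s + 0) / r)) - 0)"
      using cos_move[of "real r" s y 0] r0 by auto
    define y' where "y' = (2 * pi * l + phase s + 0) / r"
    have "nodal_domain_at ?G ?u (x, y) = nodal_domain_at ?G ?u (0, y)"
      by (rule move_horizontal) (use p in \<open>simp add: xy u\<close>)
    also have "\<dots> = nodal_domain_at ?G ?u (0, y')"
    proof (rule move_vertical)
      fix v :: real assume "v \<in> {0..1}"
      from l[OF this] have "0 < s * cos (r * ((1 - v) * y + v * y') - 0)"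
        using pos unfolding y'_def by linarith
      then have "cos (r * ((1 - v) * y + v * y')) \<noteq> 0" by auto
      then show "?u (0, (1 - v) * y + v * y') \<noteq> 0" by (simp add: u)
    qed
    also have "\<dots> = nodal_domain_at ?G ?u (0, phase s / r)"
    proof (rule nodal_domain_at_orbit)
      have "y' = phase s / r + of_int l * (2 * pi / r)" by (simp add: y'_def add_divide_distrib)
      then show "orbit_of ?G (0, y') = orbit_of ?G (0, phase s / r)"
        using orbit_klein_translate[of r 0 0 "phase s / r" l] by simp
    qed
    finally have "nodal_domain_at ?G ?u p = nodal_domain_at ?G ?u (0, phase s / r)" by (simp only: xy)
    moreover have "(0, phase s / r) \<in> ?Q" by (simp add: phase_def)
    ultimately show ?thesis by blast
  qed
  have fin: "finite (nodal_domains ?G ?u)" by (rule nodal_count_le(1)[OF _ all]) auto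
  have "card (nodal_domains ?G ?u) \<le> card ?Q" by (rule nodal_count_le(2)[OF _ all]) auto
  then have le: "card (nodal_domains ?G ?u) \<le> 2" by (simp add: card_insert_if split: if_splits)
  have "nodal_domain_at ?G ?u (0, 0) \<noteq> nodal_domain_at ?G ?u (0, pi / r)"
  proof (rule nodal_domains_different_sign)
    show "\<forall>g\<in>?G. \<forall>p. ?u (g p) = ?u p" using E by (simp add: eigenspace_def)
    show "continuous_on UNIV ?u" by (rule smooth_continuous_on[OF smooth_psi])
  qed (use r0 in \<open>simp_all add: u\<close>)
  moreover have "{nodal_domain_at ?G ?u (0, 0), nodal_domain_at ?G ?u (0, pi / r)} \<subseteq> nodal_domains ?G ?u"
    unfolding nodal_domains_eq using r0 by (auto simp: u)
  then have "card {nodal_domain_at ?G ?u (0, 0), nodal_domain_at ?G ?u (0, pi / r)} \<le> card (nodal_domains ?G ?u)"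
    by (rule card_mono[OF fin])
  ultimately have "2 \<le> card (nodal_domains ?G ?u)" by simp
  then have "card (nodal_domains ?G ?u) = 2" using le by simp
  moreover have "\<exists>p. ?u p \<noteq> 0" using u[of 0 0] by (intro exI[of _ "(0, 0)"]) simp
  ultimately show ?thesis using E fin unfolding courant_sharp_def by blast
qed

theorem theorem1p1:
  fixes G :: "(plane \<Rightarrow> plane) set" and k :: nat
  assumes "G = klein_group (2 * pi) (2 * pi) \<or> G = klein_group (2 * pi) pi"
    and "k \<ge> 1"
  shows "courant_sharp G k \<longleftrightarrow> k \<in> {1, 2}"
proof -
  have "klein_group (2 * pi) (2 * pi) = klein 1" "klein_group (2 * pi) pi = klein 2"
    by (simp_all add: klein_def)
  then obtain r where r: "r \<in> {1, 2}" "G = klein r"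
    using assms(1) by blast
  have "k \<in> {1, 2} \<or> k \<ge> 3" using assms(2) by auto
  then show ?thesis
    using courant_sharp_klein_1[OF r(1)] courant_sharp_klein_2[OF r(1)] not_courant_sharp_klein[OF r(1), of k]
    unfolding r(2) by auto
qed

end
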